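(* Let $k \in \mathbb N$ and let $\phi \colon \mathcal H_{2k}^0 \to \mathcal H_{2k}^0$ be a map. Then the following are equivalent: (i) $\phi$ is (real) linear and $\phi(\mathcal{IH}_{2k}^0) \subset \mathcal{IH}_{2k}^0$; (ii) there exist $U \in \mathcal U_{2k}$ and $s \in \{-1,1\}$ such that either $\phi(A) = s\,UAU^\ast$ for all $A \in \mathcal H_{2k}^0$, or $k \ge 2$ and $\phi(A) = s\,U\overline{A}U^\ast$ for all $A \in \mathcal H_{2k}^0$.
   Context: $\mathcal H_n$ denotes the real vector space of $n\times n$ complex hermitian matrices, $\mathcal H_n^0 = \{A \in \mathcal H_n : \operatorname{tr} A = 0\}$, $\mathcal U_n$ the set of $n \times n$ complex unitary matrices, and $\mathcal{IH}_n^0 = \mathcal H_n^0 \cap \mathcal U_n$. $\overline{A}$ denotes the entrywise complex conjugate of $A$ and $A^\ast$ the conjugate transpose. *)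

theory Defs
  imports Complex_Main "Jordan_Normal_Form.Matrix"
begin

definition adj :: "complex mat \<Rightarrow> complex mat" where
  "adj A = mat (dim_col A) (dim_row A) (\<lambda>(i,j). cnj (A $$ (j,i)))"

definition conj_mat :: "complex mat \<Rightarrow> complex mat" where
  "conj_mat A = map_mat cnj A"

definition mtrace :: "complex mat \<Rightarrow> complex" where
  "mtrace A = (\<Sum>i<dim_row A. A $$ (i,i))"

definition herm :: "nat \<Rightarrow> complex mat set" where
  "herm n = {A \<in> carrier_mat n n. adj A = A}"

definition herm0 :: "nat \<Rightarrow> complex mat set" where
  "herm0 n = {A \<in> herm n. mtrace A = 0}"

definition unitary_mats :: "nat \<Rightarrow> complex mat set" where
  "unitary_mats n = {U \<in> carrier_mat n n. U * adj U = 1\<^sub>m n \<and> adj U * U = 1\<^sub>m n}"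

definition IH0 :: "nat \<Rightarrow> complex mat set" where
  "IH0 n = herm0 n \<inter> unitary_mats n"

definition real_linear_on :: "complex mat set \<Rightarrow> (complex mat \<Rightarrow> complex mat) \<Rightarrow> bool" where
  "real_linear_on S \<phi> \<longleftrightarrow>
     (\<forall>A\<in>S. \<forall>B\<in>S. \<forall>a b :: real.
        \<phi> (complex_of_real a \<cdot>\<^sub>m A + complex_of_real b \<cdot>\<^sub>m B)
          = complex_of_real a \<cdot>\<^sub>m \<phi> A + complex_of_real b \<cdot>\<^sub>m \<phi> B)"

end

theory Submission
  imports Defs "HOL-Computational_Algebra.Fundamental_Theorem_Algebra"
begin

text \<open>Write \<open>E i\<close> for the diagonal matrix units. Sign changes in a decomposition into orthogonal
  blocks show that \<open>\<phi>\<close> maps traceless symmetries of orthogonal blocks to anticommuting matrices, and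
  the Pauli triple of one two-dimensional block to an anticommuting triple with a common square
  \<open>p\<close>. For a decomposition of the whole space into \<open>k\<close> such blocks these squares commute and sum to
  the identity. Where \<open>r\<close> of them are nonzero, \<open>3 * r\<close> anticommuting symmetries act, which needs
  more than \<open>2 * r\<close> dimensions unless \<open>r \<le> 1\<close>; as only \<open>2 * k\<close> dimensions are available, the
  squares are mutually orthogonal projections of rank two, provided none of them vanishes, and a
  suitable orthonormal frame ensures the latter. Comparing the pairings of the frame makes the
  images of \<open>E i - E j\<close> commute, so up to unitary conjugation and a sign they are \<open>E i - E j\<close>
  again. The off-diagonal entries are then moved by real linear isometries \<open>f i j\<close> of the complex
  plane that satisfy \<open>f i j (a * b) = f i l a * f l j b\<close> for unimodular \<open>a\<close> and \<open>b\<close>, so up to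
  phases they all are the identity or all are the conjugation.\<close>

section \<open>Finitely supported matrices\<close>

text \<open>The domain contains no \<open>E i\<close>, and for hermitian matrices unitarity only
  says that the square is the identity, so \<open>\<phi>\<close> is tested through traceless
  symmetries of the whole space alone. Evenness of the dimension gives access to blocks: the
  complement of a block of even size again carries a traceless symmetry, and changing its sign
  isolates the block. The obstacle is that this controls only the square of the image of a block,
  which may even vanish, and that images of disjoint blocks are known to anticommute but not to
  multiply to zero. Orthogonality has to come from counting. Among \<open>m\<close> anticommuting
  symmetries the generators and their pairwise products are orthogonal for the trace form, so
  \<open>m * (m + 1) / 2\<close> is at most the squared dimension; for \<open>m = 3 * r\<close> it
  exceeds \<open>4 * r * r\<close>. The comparison of pairings uses a fourth index, so dimension 2
  is treated apart. There entrywise conjugation is minus a unitary conjugation on traceless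
  hermitian matrices, which is why the second form asks for \<open>k \<ge> 2\<close>.\<close>

text \<open>All sizes share one non-unital ring type, so that ring identities need no carrier conditions;
  \<open>n \<times> n\<close> matrices are those supported in the upper left corner.\<close>

typedef cmat = "{f :: nat \<Rightarrow> nat \<Rightarrow> complex. finite {(i, j). f i j \<noteq> 0}}"
  morphisms ent Cmat
  by (rule exI[of _ "\<lambda>_ _. 0"]) simp

setup_lifting type_definition_cmat

lemma finite_ent: "finite {(i, j). ent A i j \<noteq> 0}"
  using ent[of A] by simp

lemma cmat_eqI: "(\<And>i j. ent A i j = ent B i j) \<Longrightarrow> A = B"
  by (metis ent_inject ext)

lemma finite_ent_row: "finite {k. ent A i k \<noteq> 0}"
  by (rule finite_surj[OF finite_ent[of A], of _ snd]) (force simp: image_iff)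

lemma finite_ent_diag: "finite {k. ent A k k \<noteq> 0}"
  by (rule finite_surj[OF finite_ent[of A], of _ snd]) (force simp: image_iff)

instantiation cmat :: ab_group_add
begin
lift_definition zero_cmat :: cmat is "\<lambda>_ _. 0" by simp
lift_definition uminus_cmat :: "cmat \<Rightarrow> cmat" is "\<lambda>f i j. - f i j" by simp
lift_definition plus_cmat :: "cmat \<Rightarrow> cmat \<Rightarrow> cmat" is "\<lambda>f g i j. f i j + g i j"
  by (erule (1) finite_subset[OF _ finite_UnI, rotated]) auto
lift_definition minus_cmat :: "cmat \<Rightarrow> cmat \<Rightarrow> cmat" is "\<lambda>f g i j. f i j - g i j"
  by (erule (1) finite_subset[OF _ finite_UnI, rotated]) auto
instance by standard (transfer, simp add: fun_eq_iff algebra_simps)+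
end

lemma ent_zero [simp]: "ent 0 i j = 0" by transfer simp
lemma ent_uminus [simp]: "ent (- A) i j = - ent A i j" by transfer simp
lemma ent_plus [simp]: "ent (A + B) i j = ent A i j + ent B i j" by transfer simp
lemma ent_minus [simp]: "ent (A - B) i j = ent A i j - ent B i j" by transfer simp

lemma ent_sum [simp]: "ent (sum f S) i j = (\<Sum>x\<in>S. ent (f x) i j)"
  by (induction S rule: infinite_finite_induct) auto

instantiation cmat :: real_vector
begin
lift_definition scaleR_cmat :: "real \<Rightarrow> cmat \<Rightarrow> cmat" is "\<lambda>c f i j. of_real c * f i j"
  by (erule finite_subset[rotated]) auto
instance by standard (transfer, simp add: fun_eq_iff algebra_simps)+
end

lemma ent_scaleR [simp]: "ent (c *\<^sub>R A) i j = of_real c * ent A i j" by transfer simp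

instantiation cmat :: times
begin
definition "A * B = Cmat (\<lambda>i j. \<Sum>k | ent A i k \<noteq> 0. ent A i k * ent B k j)"
instance ..
end

text \<open>The support of the product lies in the rows of \<open>A\<close> times the columns of
  \<open>B\<close>, hence is finite, as inverting \<open>Cmat\<close> requires.\<close>

lemma ent_mult_raw: "ent (A * B) i j = (\<Sum>k | ent A i k \<noteq> 0. ent A i k * ent B k j)"
proof -
  have "{(i, j). (\<Sum>k | ent A i k \<noteq> 0. ent A i k * ent B k j) \<noteq> 0}
      \<subseteq> fst ` {(i, j). ent A i j \<noteq> 0} \<times> snd ` {(i, j). ent B i j \<noteq> 0}"
  proof (clarify, intro conjI)
    fix i j assume "(\<Sum>k | ent A i k \<noteq> 0. ent A i k * ent B k j) \<noteq> 0"
    then obtain k where "ent A i k * ent B k j \<noteq> 0" by (metis (mono_tags, lifting) sum.neutral)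
    then show "i \<in> fst ` {(i, j). ent A i j \<noteq> 0}" "j \<in> snd ` {(i, j). ent B i j \<noteq> 0}"
      by (force simp: image_iff)+
  qed
  from finite_subset[OF this] show ?thesis
    unfolding times_cmat_def by (subst Cmat_inverse) (auto intro!: finite_imageI finite_ent)
qed

text \<open>In \<open>ent_mult_raw\<close> the range of summation depends on \<open>A\<close>; any
  finite \<open>K\<close> covering the nonzero terms puts the sums for several matrices over one
  range.\<close>

lemma ent_mult:
  assumes "finite K" "\<And>k. k \<notin> K \<Longrightarrow> ent A i k * ent B k j = 0"
  shows "ent (A * B) i j = (\<Sum>k\<in>K. ent A i k * ent B k j)"
  unfolding ent_mult_raw
  by (rule sum.mono_neutral_cong) (use assms finite_ent_row in auto)

instance cmat :: real_algebra
proof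
  fix A B C :: cmat and r :: real
  have fin: "finite {k. ent X i k \<noteq> 0}" for X i by (rule finite_ent_row)
  show "A * B * C = A * (B * C)"
  proof (rule cmat_eqI)
    fix i j
    let ?K = "{k. ent A i k \<noteq> 0}"
    obtain L where L: "finite L" and nL: "\<And>k l. l \<notin> L \<Longrightarrow> ent B k l = 0"
    proof
      show "finite (snd ` {(i, j). ent B i j \<noteq> 0})" by (intro finite_imageI finite_ent)
    qed (force simp: image_iff)
    have AB: "ent (A * B) i l = (\<Sum>k\<in>?K. ent A i k * ent B k l)" for l
      by (rule ent_mult) (auto simp: fin)
    have BC: "ent (B * C) k j = (\<Sum>l\<in>L. ent B k l * ent C l j)" for k
      by (rule ent_mult) (auto simp: L nL)
    have "ent (A * B * C) i j = (\<Sum>l\<in>L. ent (A * B) i l * ent C l j)"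
      by (rule ent_mult) (auto simp: L AB nL)
    also have "\<dots> = (\<Sum>l\<in>L. \<Sum>k\<in>?K. ent A i k * ent B k l * ent C l j)"
      by (simp add: AB sum_distrib_right)
    also have "\<dots> = (\<Sum>k\<in>?K. \<Sum>l\<in>L. ent A i k * ent B k l * ent C l j)" by (rule sum.swap)
    also have "\<dots> = (\<Sum>k\<in>?K. ent A i k * ent (B * C) k j)"
      by (simp add: BC sum_distrib_left mult.assoc)
    also have "\<dots> = ent (A * (B * C)) i j" by (rule ent_mult[symmetric]) (auto simp: fin)
    finally show "ent (A * B * C) i j = ent (A * (B * C)) i j" .
  qed
  show "(A + B) * C = A * C + B * C"
  proof (rule cmat_eqI)
    fix i j
    let ?K = "{k. ent A i k \<noteq> 0} \<union> {k. ent B i k \<noteq> 0}"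
    have "ent ((A + B) * C) i j = (\<Sum>k\<in>?K. ent (A + B) i k * ent C k j)"
      by (rule ent_mult) (auto simp: fin)
    moreover have "ent (A * C) i j = (\<Sum>k\<in>?K. ent A i k * ent C k j)"
      by (rule ent_mult) (auto simp: fin)
    moreover have "ent (B * C) i j = (\<Sum>k\<in>?K. ent B i k * ent C k j)"
      by (rule ent_mult) (auto simp: fin)
    ultimately show "ent ((A + B) * C) i j = ent (A * C + B * C) i j"
      by (simp add: distrib_right sum.distrib)
  qed
  show "A * (B + C) = A * B + A * C"
    by (rule cmat_eqI) (simp add: ent_mult_raw distrib_left sum.distrib)
  show "A * (r *\<^sub>R B) = r *\<^sub>R (A * B)"
    by (rule cmat_eqI) (simp add: ent_mult_raw sum_distrib_left mult_ac)
  show "(r *\<^sub>R A) * B = r *\<^sub>R (A * B)"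
  proof (rule cmat_eqI)
    fix i j
    have "ent ((r *\<^sub>R A) * B) i j = (\<Sum>k | ent A i k \<noteq> 0. ent (r *\<^sub>R A) i k * ent B k j)"
      by (rule ent_mult) (auto simp: fin)
    then show "ent ((r *\<^sub>R A) * B) i j = ent (r *\<^sub>R (A * B)) i j"
      by (simp add: ent_mult_raw sum_distrib_left mult_ac)
  qed
qed

section \<open>Adjoint, conjugation, matrix units, diagonal projections and trace\<close>

lift_definition adjm :: "cmat \<Rightarrow> cmat" is "\<lambda>f i j. cnj (f j i)"
  by (erule finite_surj[of _ _ "\<lambda>(i, j). (j, i)"]) (auto simp: image_iff)

lift_definition conjm :: "cmat \<Rightarrow> cmat" is "\<lambda>f i j. cnj (f i j)" by simp

lift_definition single :: "nat \<Rightarrow> nat \<Rightarrow> complex \<Rightarrow> cmat"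
  is "\<lambda>i j x k l. if k = i \<and> l = j then x else 0"
  by (rule finite_subset[of _ "{(i, j)}" for i j]) (auto split: if_splits)

lift_definition dg :: "nat set \<Rightarrow> cmat"
  is "\<lambda>S k l. if k = l \<and> k \<in> S \<and> finite S then 1 else 0"
proof -
  fix S :: "nat set"
  have "{(k, l). (if k = l \<and> k \<in> S \<and> finite S then 1 else 0 :: complex) \<noteq> 0}
    \<subseteq> (if finite S then S \<times> S else {})" by auto
  then show "finite {(k, l). (if k = l \<and> k \<in> S \<and> finite S then 1 else 0 :: complex) \<noteq> 0}"
    by (rule finite_subset) auto
qed

lemma ent_adjm [simp]: "ent (adjm A) i j = cnj (ent A j i)" by transfer simp
lemma ent_conjm [simp]: "ent (conjm A) i j = cnj (ent A i j)" by transfer simp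
lemma ent_single [simp]: "ent (single i j x) k l = (if k = i \<and> l = j then x else 0)"
  by transfer simp
lemma ent_dg [simp]: "ent (dg S) k l = (if k = l \<and> k \<in> S \<and> finite S then 1 else 0)"
  by transfer simp

text \<open>The ring has no unit; this projection is the identity of the \<open>n \<times> n\<close>
  corner and stands in for it.\<close>

abbreviation one_cm :: "nat \<Rightarrow> cmat" where "one_cm n \<equiv> dg {..<n}"

definition tr :: "cmat \<Rightarrow> complex" where "tr A = (\<Sum>i | ent A i i \<noteq> 0. ent A i i)"

lemma tr_eq_sum:
  assumes "finite K" "\<And>k. k \<notin> K \<Longrightarrow> ent A k k = 0"
  shows "tr A = (\<Sum>k\<in>K. ent A k k)"
  unfolding tr_def by (rule sum.mono_neutral_cong) (use assms finite_ent_diag in auto)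

lemma tr_add [simp]: "tr (A + B) = tr A + tr B"
proof -
  let ?K = "{k. ent A k k \<noteq> 0} \<union> {k. ent B k k \<noteq> 0}"
  have "tr (A + B) = (\<Sum>k\<in>?K. ent (A + B) k k)" "tr A = (\<Sum>k\<in>?K. ent A k k)"
    "tr B = (\<Sum>k\<in>?K. ent B k k)"
    by (rule tr_eq_sum; auto simp: finite_ent_diag)+
  then show ?thesis by (simp add: sum.distrib)
qed

lemma tr_scaleR [simp]: "tr (r *\<^sub>R A) = of_real r * tr A"
proof -
  have "tr (r *\<^sub>R A) = (\<Sum>k | ent A k k \<noteq> 0. ent (r *\<^sub>R A) k k)"
    by (rule tr_eq_sum) (auto simp: finite_ent_diag)
  then show ?thesis by (simp add: tr_def sum_distrib_left)
qed

lemma tr_zero [simp]: "tr 0 = 0" by (simp add: tr_def)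

lemma tr_uminus [simp]: "tr (- A) = - tr A"
  using tr_scaleR[of "- 1" A] by simp

lemma tr_minus [simp]: "tr (A - B) = tr A - tr B"
  using tr_add[of A "- B"] by simp

lemma tr_sum [simp]: "tr (sum f S) = (\<Sum>x\<in>S. tr (f x))"
  by (induction S rule: infinite_finite_induct) auto

lemma tr_mult_eq_sum:
  assumes "finite I" "finite J" "\<And>i j. ent A i j \<noteq> 0 \<Longrightarrow> i \<in> I \<and> j \<in> J"
  shows "tr (A * B) = (\<Sum>i\<in>I. \<Sum>j\<in>J. ent A i j * ent B j i)"
proof -
  have e: "ent (A * B) i k = (\<Sum>j\<in>J. ent A i j * ent B j k)" for i k
    by (rule ent_mult) (use assms in auto)
  have "tr (A * B) = (\<Sum>i\<in>I. ent (A * B) i i)"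
  proof (rule tr_eq_sum[OF assms(1)])
    fix i assume "i \<notin> I"
    then have "ent A i j = 0" for j using assms(3) by blast
    then show "ent (A * B) i i = 0" by (simp add: e)
  qed
  then show ?thesis by (simp add: e)
qed

lemma tr_commute: "tr (A * B) = tr (B * A)"
proof -
  let ?I = "fst ` ({(i, j). ent A i j \<noteq> 0} \<union> {(i, j). ent B i j \<noteq> 0})
    \<union> snd ` ({(i, j). ent A i j \<noteq> 0} \<union> {(i, j). ent B i j \<noteq> 0})"
  have fin: "finite ?I" by (intro finite_UnI finite_imageI finite_ent)
  have *: "tr (A * B) = (\<Sum>i\<in>?I. \<Sum>j\<in>?I. ent A i j * ent B j i)"
    by (rule tr_mult_eq_sum[OF fin fin]) (force simp: image_iff)
  have **: "tr (B * A) = (\<Sum>i\<in>?I. \<Sum>j\<in>?I. ent B i j * ent A j i)"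
    by (rule tr_mult_eq_sum[OF fin fin]) (force simp: image_iff)
  show ?thesis unfolding * ** by (subst sum.swap) (simp add: mult.commute)
qed

lemma adjm_zero [simp]: "adjm 0 = 0" by (rule cmat_eqI) simp
lemma adjm_add [simp]: "adjm (A + B) = adjm A + adjm B" by (rule cmat_eqI) simp
lemma adjm_minus [simp]: "adjm (A - B) = adjm A - adjm B" by (rule cmat_eqI) simp
lemma adjm_uminus [simp]: "adjm (- A) = - adjm A" by (rule cmat_eqI) simp
lemma adjm_scaleR [simp]: "adjm (r *\<^sub>R A) = r *\<^sub>R adjm A" by (rule cmat_eqI) simp
lemma adjm_adjm [simp]: "adjm (adjm A) = A" by (rule cmat_eqI) simp
lemma adjm_single [simp]: "adjm (single i j x) = single j i (cnj x)" by (rule cmat_eqI) auto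
lemma adjm_dg [simp]: "adjm (dg S) = dg S" by (rule cmat_eqI) auto
lemma adjm_sum: "adjm (sum f S) = (\<Sum>x\<in>S. adjm (f x))" by (rule cmat_eqI) simp

lemma adjm_mult [simp]: "adjm (A * B) = adjm B * adjm A"
proof (rule cmat_eqI)
  fix i j
  let ?K = "{k. ent A j k \<noteq> 0}"
  have "ent (adjm B * adjm A) i j = (\<Sum>k\<in>?K. ent (adjm B) i k * ent (adjm A) k j)"
    by (rule ent_mult) (auto simp: finite_ent_row)
  then show "ent (adjm (A * B)) i j = ent (adjm B * adjm A) i j"
    by (simp add: ent_mult_raw mult.commute)
qed

lemma conjm_add [simp]: "conjm (A + B) = conjm A + conjm B" by (rule cmat_eqI) simp
lemma conjm_minus [simp]: "conjm (A - B) = conjm A - conjm B" by (rule cmat_eqI) simp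
lemma conjm_scaleR [simp]: "conjm (r *\<^sub>R A) = r *\<^sub>R conjm A" by (rule cmat_eqI) simp
lemma conjm_single [simp]: "conjm (single i j x) = single i j (cnj x)" by (rule cmat_eqI) auto
lemma conjm_dg [simp]: "conjm (dg S) = dg S" by (rule cmat_eqI) auto
lemma conjm_adjm: "conjm (adjm A) = adjm (conjm A)" by (rule cmat_eqI) simp
lemma conjm_mult [simp]: "conjm (A * B) = conjm A * conjm B"
  by (rule cmat_eqI) (simp add: ent_mult_raw)

lemma single_mult [simp]:
  "single i j x * single k l y = (if j = k then single i l (x * y) else 0)"
proof (rule cmat_eqI)
  fix a b
  have "ent (single i j x * single k l y) a b
      = (\<Sum>c\<in>{j}. ent (single i j x) a c * ent (single k l y) c b)"
    by (rule ent_mult) auto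
  then show "ent (single i j x * single k l y) a b
      = ent (if j = k then single i l (x * y) else 0) a b" by auto
qed

lemma tr_single [simp]: "tr (single i j x) = (if i = j then x else 0)"
proof -
  have "tr (single i j x) = (\<Sum>k\<in>{i}. ent (single i j x) k k)"
    by (rule tr_eq_sum) auto
  then show ?thesis by simp
qed

lemma single_zero [simp]: "single i j 0 = 0" by (rule cmat_eqI) auto
lemma scaleR_single [simp]: "r *\<^sub>R single i j x = single i j (of_real r * x)"
  by (rule cmat_eqI) auto
lemma single_add: "single i j (x + y) = single i j x + single i j y" by (rule cmat_eqI) auto
lemma single_uminus: "single i j (- x) = - single i j x" by (rule cmat_eqI) auto

lemma ent_dg_mult [simp]: "ent (dg S * A) i j = (if i \<in> S \<and> finite S then ent A i j else 0)"
proof -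
  have "ent (dg S * A) i j = (\<Sum>k\<in>{i}. ent (dg S) i k * ent A k j)"
    by (rule ent_mult) auto
  then show ?thesis by auto
qed

lemma ent_mult_dg [simp]: "ent (A * dg S) i j = (if j \<in> S \<and> finite S then ent A i j else 0)"
proof -
  have "ent (A * dg S) i j = (\<Sum>k\<in>{j}. ent A i k * ent (dg S) k j)"
    by (rule ent_mult) auto
  then show ?thesis by auto
qed

lemma dg_mult_dg: "finite S \<Longrightarrow> finite T \<Longrightarrow> dg S * dg T = dg (S \<inter> T)"
  by (rule cmat_eqI) auto

lemma dg_empty [simp]: "dg {} = 0" by (rule cmat_eqI) simp
lemma dg_Un: "finite S \<Longrightarrow> finite T \<Longrightarrow> S \<inter> T = {} \<Longrightarrow> dg (S \<union> T) = dg S + dg T"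
  by (rule cmat_eqI) auto
lemma dg_singleton: "dg {i} = single i i 1" by (rule cmat_eqI) auto
lemma dg_insert: "finite S \<Longrightarrow> i \<notin> S \<Longrightarrow> dg (insert i S) = single i i 1 + dg S"
  by (rule cmat_eqI) auto
lemma one_cm_eq_sum: "one_cm n = (\<Sum>i<n. single i i 1)"
proof (rule cmat_eqI)
  fix i j
  have "ent (\<Sum>x<n. single x x 1) i j = (\<Sum>x<n. if x = i then if i = j then 1 else 0 else 0)"
    unfolding ent_sum by (intro sum.cong refl) auto
  then show "ent (one_cm n) i j = ent (\<Sum>x<n. single x x 1) i j" by simp
qed

lemma tr_dg: "tr (dg S) = of_nat (card S)" if "finite S"
proof -
  have "tr (dg S) = (\<Sum>k\<in>S. ent (dg S) k k)" by (rule tr_eq_sum) (use that in auto)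
  then show ?thesis using that by simp
qed

lemma dg_mult_single [simp]: "finite S \<Longrightarrow> dg S * single i j x = (if i \<in> S then single i j x else 0)"
  by (rule cmat_eqI) auto
lemma single_mult_dg [simp]: "finite S \<Longrightarrow> single i j x * dg S = (if j \<in> S then single i j x else 0)"
  by (rule cmat_eqI) auto

lemma ent_single_mult_single: "single i j x * A * single k l y = single i l (x * ent A j k * y)"
proof (rule cmat_eqI)
  fix a b
  have 1: "ent (single i j x * A) a c = (if a = i then x * ent A j c else 0)" for c
  proof -
    have "ent (single i j x * A) a c = (\<Sum>d\<in>{j}. ent (single i j x) a d * ent A d c)"
      by (rule ent_mult) auto
    then show ?thesis by auto
  qed
  have "ent (single i j x * A * single k l y) a b
      = (\<Sum>d\<in>{k}. ent (single i j x * A) a d * ent (single k l y) d b)"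
    by (rule ent_mult) auto
  then show "ent (single i j x * A * single k l y) a b = ent (single i l (x * ent A j k * y)) a b"
    by (auto simp: 1)
qed

text \<open>The squared Hilbert-Schmidt norm. That it vanishes only at 0 is how positivity of
  \<open>A * adjm A\<close> enters.\<close>

definition nsq :: "cmat \<Rightarrow> real" where "nsq A = Re (tr (A * adjm A))"

lemma tr_mult_adjm: "tr (A * adjm A) = of_real (nsq A)"
  and nsq_nonneg: "nsq A \<ge> 0"
  and nsq_eq_0: "nsq A = 0 \<longleftrightarrow> A = 0"
proof -
  obtain I J where fin: "finite I" "finite J" and inIJ: "\<And>i j. ent A i j \<noteq> 0 \<Longrightarrow> i \<in> I \<and> j \<in> J"
  proof
    show "finite (fst ` {(i, j). ent A i j \<noteq> 0})" "finite (snd ` {(i, j). ent A i j \<noteq> 0})"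
      by (intro finite_imageI finite_ent)+
  qed (force simp: image_iff)
  have "tr (A * adjm A) = (\<Sum>i\<in>I. \<Sum>j\<in>J. ent A i j * ent (adjm A) j i)"
    by (rule tr_mult_eq_sum[OF fin]) (rule inIJ)
  also have "\<dots> = of_real (\<Sum>i\<in>I. \<Sum>j\<in>J. (cmod (ent A i j))\<^sup>2)"
    by (simp add: complex_norm_square del: of_real_power)
  finally have *: "tr (A * adjm A) = of_real (\<Sum>i\<in>I. \<Sum>j\<in>J. (cmod (ent A i j))\<^sup>2)" .
  then have n: "nsq A = (\<Sum>i\<in>I. \<Sum>j\<in>J. (cmod (ent A i j))\<^sup>2)" by (simp add: nsq_def)
  show "tr (A * adjm A) = of_real (nsq A)" unfolding n by (rule *)
  show "nsq A \<ge> 0" unfolding n by (intro sum_nonneg) simp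
  show "nsq A = 0 \<longleftrightarrow> A = 0"
  proof
    assume "nsq A = 0"
    then have "\<forall>i\<in>I. (\<Sum>j\<in>J. (cmod (ent A i j))\<^sup>2) = 0"
      unfolding n by (subst (asm) sum_nonneg_eq_0_iff) (auto intro!: sum_nonneg fin)
    then have "\<forall>i\<in>I. \<forall>j\<in>J. (cmod (ent A i j))\<^sup>2 = 0"
      by (subst (asm) sum_nonneg_eq_0_iff) (auto intro!: fin)
    then have "ent A i j = 0" for i j using inIJ[of i j] by auto
    then show "A = 0" by (intro cmat_eqI) simp
  qed (simp add: nsq_def)
qed

lemma herm_sq_eq_0: "adjm A = A \<Longrightarrow> A * A = 0 \<Longrightarrow> A = 0"
  using nsq_eq_0[of A] by (simp add: nsq_def)

section \<open>Projections and orthogonal families of matrices\<close>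

definition inM :: "nat \<Rightarrow> cmat \<Rightarrow> bool" where
  "inM n A \<longleftrightarrow> (\<forall>i j. ent A i j \<noteq> 0 \<longrightarrow> i < n \<and> j < n)"

lemma inM_iff: "inM n A \<longleftrightarrow> one_cm n * A = A \<and> A * one_cm n = A"
proof
  assume "inM n A"
  then show "one_cm n * A = A \<and> A * one_cm n = A"
    by (intro conjI cmat_eqI) (auto simp: inM_def)
next
  assume *: "one_cm n * A = A \<and> A * one_cm n = A"
  show "inM n A" unfolding inM_def
  proof (intro allI impI conjI)
    fix i j assume nz: "ent A i j \<noteq> 0"
    have "ent (one_cm n * A) i j \<noteq> 0" "ent (A * one_cm n) i j \<noteq> 0" using * nz by simp_all
    then show "i < n" "j < n" by (auto split: if_splits)
  qed
qed

lemma one_mult: "inM n A \<Longrightarrow> one_cm n * A = A" by (simp add: inM_iff)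
lemma mult_one: "inM n A \<Longrightarrow> A * one_cm n = A" by (simp add: inM_iff)

lemma inM_zero [simp]: "inM n 0" by (simp add: inM_def)
lemma inM_add: "inM n A \<Longrightarrow> inM n B \<Longrightarrow> inM n (A + B)"
  by (simp add: inM_iff algebra_simps)
lemma inM_minus: "inM n A \<Longrightarrow> inM n B \<Longrightarrow> inM n (A - B)"
  by (simp add: inM_iff algebra_simps)
lemma inM_scaleR: "inM n A \<Longrightarrow> inM n (r *\<^sub>R A)" by (simp add: inM_iff)
lemma inM_mult: "inM n A \<Longrightarrow> inM n B \<Longrightarrow> inM n (A * B)"
  unfolding inM_iff by (metis mult.assoc)
lemma inM_adjm: "inM n A \<Longrightarrow> inM n (adjm A)" by (auto simp: inM_def)
lemma inM_conjm: "inM n A \<Longrightarrow> inM n (conjm A)" by (auto simp: inM_def)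
lemma inM_single [simp]: "i < n \<Longrightarrow> j < n \<Longrightarrow> inM n (single i j x)"
  by (auto simp: inM_def)
lemma inM_dg [simp]: "S \<subseteq> {..<n} \<Longrightarrow> inM n (dg S)" by (auto simp: inM_def)
lemma inM_sum: "(\<And>x. x \<in> S \<Longrightarrow> inM n (f x)) \<Longrightarrow> inM n (sum f S)"
  by (induction S rule: infinite_finite_induct) (auto intro: inM_add)

lemmas inM_intros = inM_add inM_minus inM_scaleR inM_mult inM_adjm inM_conjm

definition proj :: "cmat \<Rightarrow> bool" where "proj E \<longleftrightarrow> E * E = E \<and> adjm E = E"

lemma proj_idem: "proj E \<Longrightarrow> E * E = E" and proj_adjm: "proj E \<Longrightarrow> adjm E = E"
  by (simp_all add: proj_def)

lemma proj_dg: "proj (dg S)" by (auto simp: proj_def intro!: cmat_eqI)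

lemma proj_tr: "proj E \<Longrightarrow> tr E = of_real (nsq E)"
  using tr_mult_adjm[of E] by (simp add: proj_def)

lemma proj_diff:
  assumes "proj E" "proj Q" "E * Q = Q" "Q * E = Q"
  shows "proj (E - Q)"
  using assms by (simp add: proj_def algebra_simps)

text \<open>Compressing a diagonal matrix unit at a nonzero diagonal entry \<open>c\<close> of
  \<open>E\<close> gives, after division by that entry, a projection \<open>Q\<close> of trace 1
  below \<open>E\<close>. The remainder \<open>E - Q\<close> is a projection of nonnegative trace,
  so \<open>tr E\<close> is at least 1, and equality means \<open>E = Q\<close>.\<close>

lemma proj_rank_one:
  assumes E: "proj E" "E \<noteq> 0"
  obtains c r where "0 < r" "ent E c c = of_real r"
    "tr E = 1 \<Longrightarrow> E = (1 / r) *\<^sub>R (E * single c c 1 * E)" "1 \<le> Re (tr E)"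
proof -
  have EE: "E * E = E" and EA: "adjm E = E" using E by (simp_all add: proj_def)
  have "tr E \<noteq> 0" using proj_tr[OF E(1)] E(2) nsq_eq_0 by simp
  then obtain c where c: "ent E c c \<noteq> 0" unfolding tr_def by (metis (mono_tags, lifting) sum.neutral)
  define T where "T = single c c 1 * E"
  have ET: "adjm T * T = E * single c c 1 * E" "T * adjm T = single c c (ent E c c)"
    using ent_single_mult_single[of c c 1 E c c 1] by (simp_all add: T_def EA EE mult.assoc)
      (metis EE mult.assoc single_mult mult_1)+
  have "ent E c c = tr (T * adjm T)" by (simp add: ET)
  also have "\<dots> = of_real (nsq T)" by (rule tr_mult_adjm)
  finally have r: "ent E c c = of_real (nsq T)" .
  with c nsq_nonneg[of T] have pos: "0 < nsq T" by simp
  define Q where "Q = (1 / nsq T) *\<^sub>R (E * single c c 1 * E)"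
  have EQ: "E * Q = Q" "Q * E = Q" by (simp_all add: Q_def EE mult.assoc) (metis EE mult.assoc)
  have "E * single c c 1 * E * (E * single c c 1 * E) = E * (single c c 1 * E * single c c 1) * E"
    by (metis EE mult.assoc)
  also have "\<dots> = nsq T *\<^sub>R (E * single c c 1 * E)"
    by (simp only: ent_single_mult_single r)
      (metis mult_1 mult_scaleR_left mult_scaleR_right scaleR_single mult.right_neutral)
  finally have QQ: "Q * Q = Q" using pos by (simp add: Q_def)
  have Q: "proj Q" using QQ by (simp add: proj_def Q_def EA mult.assoc)
  have "tr (E * single c c 1 * E) = tr (single c c 1 * E * single c c 1)"
    by (metis ET tr_commute T_def mult.assoc single_mult EA EE adjm_mult adjm_single complex_cnj_one mult_1)
  also have "\<dots> = of_real (nsq T)" by (simp add: ent_single_mult_single r)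
  finally have trQ: "tr Q = 1" using pos by (simp add: Q_def)
  have D: "proj (E - Q)" by (rule proj_diff[OF E(1) Q EQ])
  have trD: "tr E = 1 + of_real (nsq (E - Q))"
    using proj_tr[OF D] trQ by (simp add: diff_eq_eq add.commute)
  show thesis
  proof (rule that[OF pos r])
    assume "tr E = 1"
    with trD have "E - Q = 0" by (simp add: nsq_eq_0)
    then show "E = (1 / nsq T) *\<^sub>R (E * single c c 1 * E)" by (simp add: Q_def)
  next
    show "1 \<le> Re (tr E)" using trD nsq_nonneg[of "E - Q"] by simp
  qed
qed

lemma proj_tr_ge_1: "proj E \<Longrightarrow> E \<noteq> 0 \<Longrightarrow> 1 \<le> Re (tr E)"
  by (metis proj_rank_one)

section \<open>Size of orthogonal families of matrices and of systems of anticommuting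
  symmetries\<close>

lemma tr_mult_inM:
  assumes "inM n A"
  shows "tr (A * B) = (\<Sum>i<n. \<Sum>j<n. ent A i j * ent B j i)"
  by (rule tr_mult_eq_sum) (use assms in \<open>auto simp: inM_def\<close>)

text \<open>Bessel's inequality in coordinates, for a family that is orthogonal but not normalised.
  \<open>Z\<close> is the orthogonal projection of \<open>Y\<close> to its span; the inner products
  of \<open>Z\<close> with \<open>Y\<close> and with itself both equal the left side, and
  \<open>Y - Z\<close> has nonnegative norm.\<close>

lemma bessel:
  fixes W :: "'t \<Rightarrow> 'b \<Rightarrow> complex" and Y :: "'b \<Rightarrow> complex" and N :: "'t \<Rightarrow> real"
  assumes fin: "finite T" "finite B" and N: "\<And>s. s \<in> T \<Longrightarrow> 0 < N s"
    and orth: "\<And>s t. s \<in> T \<Longrightarrow> t \<in> T \<Longrightarrow>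
      (\<Sum>b\<in>B. W s b * cnj (W t b)) = (if s = t then of_real (N s) else 0)"
  shows "(\<Sum>s\<in>T. (cmod (\<Sum>b\<in>B. Y b * cnj (W s b)))\<^sup>2 / N s) \<le> (\<Sum>b\<in>B. (cmod (Y b))\<^sup>2)"
proof -
  define v where "v s = (\<Sum>b\<in>B. Y b * cnj (W s b))" for s
  define c where "c s = v s / of_real (N s)" for s
  define Z where "Z b = (\<Sum>s\<in>T. c s * W s b)" for b
  let ?R = "\<Sum>s\<in>T. (cmod (v s))\<^sup>2 / N s"
  have cv: "cnj (c s) * v s = of_real ((cmod (v s))\<^sup>2 / N s)" for s
    by (simp add: c_def complex_norm_square mult.commute del: of_real_power)
  have YZ: "(\<Sum>b\<in>B. Y b * cnj (Z b)) = of_real ?R"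
  proof -
    have "(\<Sum>b\<in>B. Y b * cnj (Z b)) = (\<Sum>b\<in>B. \<Sum>s\<in>T. cnj (c s) * (Y b * cnj (W s b)))"
      by (simp add: Z_def sum_distrib_left mult_ac)
    also have "\<dots> = (\<Sum>s\<in>T. cnj (c s) * v s)"
      by (subst sum.swap) (simp add: v_def sum_distrib_left)
    finally show ?thesis by (simp only: cv of_real_sum)
  qed
  have ZZ: "(\<Sum>b\<in>B. Z b * cnj (Z b)) = of_real ?R"
  proof -
    have "(\<Sum>b\<in>B. Z b * cnj (Z b))
        = (\<Sum>b\<in>B. \<Sum>s\<in>T. \<Sum>t\<in>T. c s * cnj (c t) * (W s b * cnj (W t b)))"
      by (simp add: Z_def sum_product mult_ac)
    also have "\<dots> = (\<Sum>s\<in>T. \<Sum>b\<in>B. \<Sum>t\<in>T. c s * cnj (c t) * (W s b * cnj (W t b)))"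
      by (rule sum.swap)
    also have "\<dots> = (\<Sum>s\<in>T. \<Sum>t\<in>T. \<Sum>b\<in>B. c s * cnj (c t) * (W s b * cnj (W t b)))"
      by (intro sum.cong refl sum.swap)
    also have "\<dots> = (\<Sum>s\<in>T. \<Sum>t\<in>T. c s * cnj (c t) * (if s = t then of_real (N s) else 0))"
      by (intro sum.cong refl) (simp add: orth flip: sum_distrib_left)
    also have "\<dots> = (\<Sum>s\<in>T. c s * cnj (c s) * of_real (N s))"
      using fin by (intro sum.cong refl) (simp add: if_distrib[of "\<lambda>x. _ * x"] cong: if_cong)
    also have "\<dots> = (\<Sum>s\<in>T. cnj (c s) * v s)"
      by (intro sum.cong refl) (use N in \<open>force simp: c_def\<close>)
    finally show ?thesis by (simp only: cv of_real_sum)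
  qed
  have ZY: "(\<Sum>b\<in>B. Z b * cnj (Y b)) = of_real ?R"
    using arg_cong[OF YZ, of cnj] by (simp add: mult.commute)
  have "of_real (\<Sum>b\<in>B. (cmod (Y b - Z b))\<^sup>2) = (\<Sum>b\<in>B. (Y b - Z b) * cnj (Y b - Z b))"
    by (simp add: complex_norm_square del: of_real_power)
  also have "\<dots> = (\<Sum>b\<in>B. Y b * cnj (Y b)) - (\<Sum>b\<in>B. Y b * cnj (Z b))
      - (\<Sum>b\<in>B. Z b * cnj (Y b)) + (\<Sum>b\<in>B. Z b * cnj (Z b))"
    by (simp add: algebra_simps sum.distrib sum_subtractf)
  also have "\<dots> = of_real ((\<Sum>b\<in>B. (cmod (Y b))\<^sup>2) - ?R)"
    unfolding YZ ZY ZZ by (simp add: complex_norm_square del: of_real_power)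
  finally have "(\<Sum>b\<in>B. (cmod (Y b))\<^sup>2) - ?R = (\<Sum>b\<in>B. (cmod (Y b - Z b))\<^sup>2)"
    by (simp only: of_real_eq_iff)
  also have "\<dots> \<ge> 0" by (simp add: sum_nonneg)
  finally show ?thesis by (simp add: v_def)
qed

text \<open>The matrices fixed by \<open>E\<close> from both sides form a space of dimension
  \<open>(tr E)\<^sup>2\<close>. Instead of choosing a basis of it, Bessel's inequality is applied
  to all compressed matrix units and summed.\<close>

lemma card_orthogonal_le:
  assumes E: "proj E" "inM n E" and T: "finite T"
    and W: "\<And>s. s \<in> T \<Longrightarrow> E * W s = W s" "\<And>s. s \<in> T \<Longrightarrow> W s * E = W s"
      "\<And>s. s \<in> T \<Longrightarrow> W s \<noteq> 0"
    and orth: "\<And>s t. s \<in> T \<Longrightarrow> t \<in> T \<Longrightarrow> s \<noteq> t \<Longrightarrow> tr (W s * adjm (W t)) = 0"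
  shows "real (card T) \<le> (Re (tr E))\<^sup>2"
proof -
  let ?B = "{..<n} \<times> {..<n}"
  have WM: "inM n (W s)" if "s \<in> T" for s
    using W(1,2)[OF that] E(2) unfolding inM_iff by (metis mult.assoc)
  have N: "0 < nsq (W s)" if "s \<in> T" for s
    using W(3)[OF that] nsq_nonneg[of "W s"] nsq_eq_0[of "W s"] by linarith
  have ip: "(\<Sum>b\<in>?B. ent (W s) (fst b) (snd b) * cnj (ent (W t) (fst b) (snd b)))
      = (if s = t then of_real (nsq (W s)) else 0)" if "s \<in> T" "t \<in> T" for s t
  proof -
    have "(\<Sum>b\<in>?B. ent (W s) (fst b) (snd b) * cnj (ent (W t) (fst b) (snd b)))
        = tr (W s * adjm (W t))"
      unfolding tr_mult_inM[OF WM[OF that(1)]] by (simp add: sum.cartesian_product split_def)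
    then show ?thesis using orth[OF that] tr_mult_adjm[of "W s"] by auto
  qed
  have Ee: "ent E j i = cnj (ent E i j)" for i j
    using E(1) by (metis ent_adjm proj_adjm)
  have diag: "ent E i i = of_real (\<Sum>a<n. (cmod (ent E a i))\<^sup>2)" for i
  proof -
    have "ent E i i = ent (E * E) i i" using E(1) by (simp add: proj_idem)
    also have "\<dots> = (\<Sum>a<n. ent E i a * ent E a i)"
      by (rule ent_mult) (use E(2) in \<open>auto simp: inM_def\<close>)
    also have "\<dots> = (\<Sum>a<n. ent E a i * cnj (ent E a i))"
      by (subst Ee) (simp add: mult.commute)
    finally show ?thesis by (simp add: complex_norm_square del: of_real_power)
  qed
  \<comment> \<open>\<open>Y i j\<close> lists the entries of
    \<open>E * single i j 1 * E\<close>.\<close>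
  define Y where "Y i j b = ent E (fst b) i * ent E j (snd b)" for i j and b :: "nat \<times> nat"
  have YW: "(\<Sum>b\<in>?B. Y i j b * cnj (ent (W s) (fst b) (snd b))) = cnj (ent (W s) i j)"
    if "s \<in> T" for s i j
  proof -
    have "ent (W s) i j = ent (E * (W s * E)) i j" using W[OF that] by simp
    also have "\<dots> = (\<Sum>a<n. ent E i a * ent (W s * E) a j)"
      by (rule ent_mult) (use E(2) in \<open>auto simp: inM_def\<close>)
    also have "\<dots> = (\<Sum>a<n. ent E i a * (\<Sum>b<n. ent (W s) a b * ent E b j))"
      by (intro sum.cong refl arg_cong2[of _ _ _ _ "(*)"] ent_mult)
        (use E(2) in \<open>auto simp: inM_def\<close>)
    also have "\<dots> = (\<Sum>b\<in>?B. ent E i (fst b) * ent (W s) (fst b) (snd b) * ent E (snd b) j)"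
      by (simp add: sum_distrib_left sum.cartesian_product split_def mult_ac)
    finally have "cnj (ent (W s) i j)
        = (\<Sum>b\<in>?B. cnj (ent E i (fst b)) * cnj (ent (W s) (fst b) (snd b)) * cnj (ent E (snd b) j))"
      by simp
    then show ?thesis unfolding Y_def by (simp add: Ee[symmetric] mult_ac)
  qed
  have YY: "(\<Sum>b\<in>?B. (cmod (Y i j b))\<^sup>2) = Re (ent E i i) * Re (ent E j j)" for i j
  proof -
    have "(\<Sum>b\<in>?B. (cmod (Y i j b))\<^sup>2)
        = (\<Sum>a<n. \<Sum>b<n. (cmod (ent E a i))\<^sup>2 * (cmod (ent E b j))\<^sup>2)"
      unfolding sum.cartesian_product Y_def
      by (intro sum.cong refl) (auto simp: norm_mult power_mult_distrib Ee[of j])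
    also have "\<dots> = Re (ent E i i) * Re (ent E j j)"
      unfolding diag by (simp add: sum_product)
    finally show ?thesis .
  qed
  \<comment> \<open>Bessel's inequality for one compressed unit. Summed over \<open>i\<close> and
    \<open>j\<close>, the left side becomes the number of matrices and the right side the squared
    trace.\<close>
  have "(\<Sum>s\<in>T. (cmod (ent (W s) i j))\<^sup>2 / nsq (W s)) \<le> Re (ent E i i) * Re (ent E j j)" for i j
  proof -
    have "(\<Sum>s\<in>T. (cmod (\<Sum>b\<in>?B. Y i j b * cnj (ent (W s) (fst b) (snd b))))\<^sup>2 / nsq (W s))
        \<le> (\<Sum>b\<in>?B. (cmod (Y i j b))\<^sup>2)"
      by (rule bessel[OF T _ N ip]) auto
    then show ?thesis by (simp add: YW YY cong: sum.cong)
  qed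
  then have "(\<Sum>b\<in>?B. \<Sum>s\<in>T. (cmod (ent (W s) (fst b) (snd b)))\<^sup>2 / nsq (W s))
      \<le> (\<Sum>b\<in>?B. Re (ent E (fst b) (fst b)) * Re (ent E (snd b) (snd b)))"
    by (intro sum_mono) auto
  also have "\<dots> = (\<Sum>i<n. Re (ent E i i))\<^sup>2"
    by (simp add: power2_eq_square sum_product sum.cartesian_product split_def)
  also have "(\<Sum>i<n. Re (ent E i i)) = Re (tr E)"
  proof -
    have "tr E = (\<Sum>i<n. ent E i i)"
      by (rule tr_eq_sum) (use E(2) in \<open>auto simp: inM_def\<close>)
    then show ?thesis by simp
  qed
  also have "(\<Sum>b\<in>?B. \<Sum>s\<in>T. (cmod (ent (W s) (fst b) (snd b)))\<^sup>2 / nsq (W s))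
      = (\<Sum>s\<in>T. (\<Sum>b\<in>?B. (cmod (ent (W s) (fst b) (snd b)))\<^sup>2) / nsq (W s))"
    by (subst sum.swap) (simp add: sum_divide_distrib)
  also have "\<dots> = (\<Sum>s\<in>T. 1)"
  proof (intro sum.cong refl)
    fix s assume s: "s \<in> T"
    have "of_real (\<Sum>b\<in>?B. (cmod (ent (W s) (fst b) (snd b)))\<^sup>2) = complex_of_real (nsq (W s))"
      using ip[OF s s] by (simp add: complex_norm_square del: of_real_power)
    then have "(\<Sum>b\<in>?B. (cmod (ent (W s) (fst b) (snd b)))\<^sup>2) = nsq (W s)"
      by (simp only: of_real_eq_iff)
    then show "(\<Sum>b\<in>?B. (cmod (ent (W s) (fst b) (snd b)))\<^sup>2) / nsq (W s) = 1"
      using N[OF s] by simp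
  qed
  finally show ?thesis by simp
qed

text \<open>Conjugation by \<open>g\<close> preserves the trace of \<open>X\<close>, by cyclicity,
  and reverses its sign.\<close>

lemma tr_eq_0_if_anticommute:
  assumes "g * X = - (X * g)" "g * g = E" "X * E = X"
  shows "tr X = 0"
proof -
  have "tr X = tr (X * g * g)" using assms by (simp add: mult.assoc)
  also have "\<dots> = tr (g * (X * g))" by (rule tr_commute)
  also have "\<dots> = tr (- (X * g * g))"
    by (metis assms(1) mult.assoc mult_minus_left)
  also have "\<dots> = - tr X" using assms by (simp add: mult.assoc)
  finally show ?thesis by simp
qed

text \<open>The \<open>m\<close> generators and their \<open>m * (m - 1) / 2\<close> pairwise
  products are orthogonal for the trace form: a product of two different ones always has a generator
  that anticommutes with it.\<close>

lemma clifford_bound: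
  fixes g :: "nat \<Rightarrow> cmat"
  assumes E: "proj E" "inM n E" "E \<noteq> 0" and m: "4 \<le> m"
    and g: "\<And>s. s < m \<Longrightarrow> adjm (g s) = g s" "\<And>s. s < m \<Longrightarrow> g s * g s = E"
      "\<And>s. s < m \<Longrightarrow> E * g s = g s" "\<And>s. s < m \<Longrightarrow> g s * E = g s"
    and anti: "\<And>s t. s < m \<Longrightarrow> t < m \<Longrightarrow> s \<noteq> t \<Longrightarrow> g s * g t = - (g t * g s)"
  shows "real (m * (m + 1)) / 2 \<le> (Re (tr E))\<^sup>2"
proof -
  \<comment> \<open>A pair \<open>(t, s)\<close> with \<open>s = t\<close> stands for the generator
    \<open>g s\<close>, one with \<open>s < t\<close> for the product
    \<open>g s * g t\<close>.\<close>
  define T where "T = (SIGMA t:{..<m}. {..t})"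
  define W where "W = (\<lambda>(t, s). if s = t then g s else g s * g t)"
  have fin: "finite T" by (auto simp: T_def)
  have "(\<Sum>t<m. real (Suc t)) = real (m * (m + 1)) / 2"
    by (induction m) (auto simp: field_simps)
  moreover have "real (card T) = (\<Sum>t<m. real (Suc t))" by (simp add: T_def)
  ultimately have cT: "real (card T) = real (m * (m + 1)) / 2" by simp
  have WE: "E * W x = W x" "W x * E = W x" "W x * adjm (W x) = E" if xT: "x \<in> T" for x
  proof -
    obtain t s where x: "x = (t, s)" "t < m" "s < m" using xT by (auto simp: T_def)
    show "E * W x = W x" using g x by (auto simp: W_def simp flip: mult.assoc)
    show "W x * E = W x" using g x by (auto simp: W_def mult.assoc)
    have "g s * g t * (g t * g s) = E"
      using g(2,4)[OF x(2)] g(2,4)[OF x(3)] by (metis mult.assoc)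
    then show "W x * adjm (W x) = E" using g x by (auto simp: W_def)
  qed
  have anti3: "w * (a * b * c) = - (a * b * c * w)"
    if "w * a = - (a * w)" "w * b = - (b * w)" "w * c = - (c * w)" for w a b c :: cmat
    by (metis (no_types, lifting) that mult.assoc mult_minus_left mult_minus_right minus_minus)
  \<comment> \<open>At most three generators occur, so \<open>4 \<le> m\<close> leaves a further
    one, and it anticommutes with each of the three factors.\<close>
  have tr3: "tr (g a * g b * g c) = 0" if abc: "a < m" "b < m" "c < m" for a b c
  proof -
    have "card {a, b, c} < m" using m by (auto simp: card_insert_if)
    then have "{a, b, c} \<noteq> {..<m}" by (metis card_lessThan less_irrefl)
    then obtain w where w: "w < m" "w \<noteq> a" "w \<noteq> b" "w \<noteq> c" using abc by auto
    have "g w * (g a * g b * g c) = - (g a * g b * g c * g w)"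
      by (rule anti3; rule anti) (use w abc in auto)
    then show ?thesis
      by (rule tr_eq_0_if_anticommute[of _ _ E]) (use w abc g in \<open>auto simp: mult.assoc\<close>)
  qed
  have tr2: "tr (g a * g b) = 0" if ab: "a < m" "b < m" "a \<noteq> b" for a b
  proof -
    have "g b * g a = - (g a * g b)" by (rule anti) (use ab in auto)
    then have "g a * (g a * g b) = - (g a * g b * g a)"
      by (metis mult.assoc mult_minus_right minus_minus)
    then show ?thesis
      by (rule tr_eq_0_if_anticommute[of _ _ E]) (use ab g in \<open>auto simp: mult.assoc\<close>)
  qed
  \<comment> \<open>A generator of the first pair that is absent from the second anticommutes with
    the first product and commutes with the second, hence anticommutes with the whole.\<close>
  have tr4: "tr (g a * g b * (g c * g d)) = 0"
    if *: "a < m" "b < m" "c < m" "d < m" "a \<noteq> b" "c \<noteq> d" "{a, b} \<noteq> {c, d}" for a b c d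
  proof -
    have "\<exists>w\<in>{a, b}. w \<noteq> c \<and> w \<noteq> d" using * by auto
    then consider "a \<noteq> c" "a \<noteq> d" | "b \<noteq> c" "b \<noteq> d" by auto
    then show ?thesis
    proof cases
      case 1
      have "g a * (g b * g c * g d) = - (g b * g c * g d * g a)"
        by (rule anti3; rule anti) (use * 1 in auto)
      then have "g a * (g a * g b * (g c * g d)) = - (g a * g b * (g c * g d) * g a)"
        by (metis mult.assoc mult_minus_right)
      then show ?thesis
        by (rule tr_eq_0_if_anticommute[of _ _ E]) (use * g in \<open>auto simp: mult.assoc\<close>)
    next
      case 2
      have "g b * g c = - (g c * g b)" "g b * g d = - (g d * g b)"
        by (rule anti; use * 2 in auto)+
      then have "g b * (g c * g d) = g c * g d * g b"
        by (metis mult.assoc mult_minus_left mult_minus_right minus_minus)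
      moreover have "g b * g a = - (g a * g b)" by (rule anti) (use * in auto)
      ultimately have "g b * (g a * g b * (g c * g d)) = - (g a * g b * (g c * g d) * g b)"
        by (metis mult.assoc mult_minus_left)
      then show ?thesis
        by (rule tr_eq_0_if_anticommute[of _ _ E]) (use * g in \<open>auto simp: mult.assoc\<close>)
    qed
  qed
  have "tr (W x * adjm (W y)) = 0" if xy: "x \<in> T" "y \<in> T" "x \<noteq> y" for x y
  proof -
    obtain t s v u where x: "x = (t, s)" "t < m" "s \<le> t" "s < m"
      and y: "y = (v, u)" "v < m" "u \<le> v" "u < m" using xy by (auto simp: T_def)
    show ?thesis
    proof (cases "s = t"; cases "u = v")
      assume "s = t" "u = v"
      then show ?thesis using x y xy by (simp add: W_def g tr2)
    next
      assume "s = t" "u \<noteq> v"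
      then show ?thesis using x y tr3[of s v u] by (simp add: W_def g mult.assoc)
    next
      assume "s \<noteq> t" "u = v"
      then show ?thesis using x y tr3[of s t u] by (simp add: W_def g mult.assoc)
    next
      assume "s \<noteq> t" "u \<noteq> v"
      moreover from this have "{s, t} \<noteq> {v, u}" using x y xy by (auto simp: doubleton_eq_iff)
      ultimately show ?thesis using x y tr4[of s t v u] by (simp add: W_def g)
    qed
  qed
  moreover have "W x \<noteq> 0" if "x \<in> T" for x using WE(3)[OF that] E(3) by auto
  ultimately have "real (card T) \<le> (Re (tr E))\<^sup>2"
    by (intro card_orthogonal_le[OF E(1,2) fin, of W]) (use WE in auto)
  then show ?thesis by (simp only: cT)
qed

section \<open>Eigenprojections\<close>

text \<open>Evaluation of a real polynomial at \<open>a\<close>, with \<open>e\<close> in the role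
  of the unit. The general algebra type serves twice: in \<open>cmat\<close> with a projection for
  \<open>e\<close>, and in the complex numbers with \<open>e = 1\<close>, where the fundamental
  theorem of algebra supplies a root.\<close>

definition pe :: "'a::real_algebra \<Rightarrow> 'a \<Rightarrow> real poly \<Rightarrow> 'a" where
  "pe e a p = fold_coeffs (\<lambda>c z. c *\<^sub>R e + a * z) p 0"

lemma pe_0 [simp]: "pe e a 0 = 0" by (simp add: pe_def)

lemma pe_pCons [simp]: "pe e a (pCons c p) = c *\<^sub>R e + a * pe e a p"
  by (cases "p = 0 \<and> c = 0") (auto simp: pe_def)

lemma pe_add [simp]: "pe e a (p + q) = pe e a p + pe e a q"
  by (induction p q rule: poly_induct2) (simp_all add: algebra_simps)

lemma pe_smult [simp]: "pe e a (smult c p) = c *\<^sub>R pe e a p"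
  by (induction p) (simp_all add: algebra_simps)

lemma pe_diff [simp]: "pe e a (p - q) = pe e a p - pe e a q"
proof -
  have "pe e a (p - q) + pe e a q = pe e a p" by (simp flip: pe_add)
  then show ?thesis by (simp add: algebra_simps)
qed

lemma pe_sum [simp]: "pe e a (sum f S) = (\<Sum>x\<in>S. pe e a (f x))"
  by (induction S rule: infinite_finite_induct) auto

lemma pe_unit:
  fixes e :: "'a::real_algebra"
  assumes "e * e = e" "e * a = a"
  shows "e * pe e a p = pe e a p"
  using assms by (induction p) (simp_all add: algebra_simps flip: mult.assoc)

lemma pe_mult:
  fixes e :: "'a::real_algebra"
  assumes "e * e = e" "e * a = a"
  shows "pe e a (p * q) = pe e a p * pe e a q"
  using assms by (induction p) (simp_all add: algebra_simps pe_unit mult.assoc)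

lemma pe_commute:
  assumes "x * a = a * x" "x * e = e * x"
  shows "x * pe e a p = pe e a p * x"
proof (induction p)
  case (pCons c p)
  have "x * (a * pe e a p) = a * pe e a p * x" by (metis assms(1) mult.assoc pCons.IH)
  then show ?case using assms by (simp add: algebra_simps)
qed simp

lemma pe_adjm:
  assumes "adjm A = A" "adjm E = E" "A * E = E * A"
  shows "adjm (pe E A p) = pe E A p"
proof (induction p)
  case (pCons c p)
  then show ?case using pe_commute[of A A E p] assms by simp
qed simp

lemma pe_complex: "pe 1 z p = poly (map_poly of_real p) (z :: complex)"
  by (induction p) (simp_all add: map_poly_pCons scaleR_conv_of_real)

lemma pe_inM: "inM n E \<Longrightarrow> inM n A \<Longrightarrow> inM n (pe E A p)"
  by (induction p) (auto intro: inM_intros)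

text \<open>The powers of \<open>A\<close> lie in a space of finite real dimension, so enough of
  them are linearly dependent.\<close>

lemma ex_annihilating_poly:
  assumes "inM n E" "inM n A"
  shows "\<exists>p. p \<noteq> 0 \<and> pe E A p = 0"
proof -
  \<comment> \<open>The span is a real one, so each matrix unit is taken with the factors 1 and
    \<open>\<i>\<close>.\<close>
  define B where "B = (\<lambda>((i, j), x). single i j x) ` (({..<n} \<times> {..<n}) \<times> {1, \<i>})"
  have finB: "finite B" by (auto simp: B_def)
  have spanB: "X \<in> span B" if X: "inM n X" for X
  proof -
    have "X = (\<Sum>i<n. \<Sum>j<n. Re (ent X i j) *\<^sub>R single i j 1 + Im (ent X i j) *\<^sub>R single i j \<i>)"
    proof (rule cmat_eqI)
      fix a b
      have "ent (\<Sum>i<n. \<Sum>j<n. Re (ent X i j) *\<^sub>R single i j 1 + Im (ent X i j) *\<^sub>R single i j \<i>) a b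
        = (\<Sum>i<n. \<Sum>j<n. if a = i then if b = j then ent X i j else 0 else 0)"
        unfolding ent_sum
        by (intro sum.cong refl) (auto simp: complex_eq_iff)
      also have "\<dots> = (\<Sum>i<n. if a = i then \<Sum>j<n. if b = j then ent X i j else 0 else 0)"
        by (intro sum.cong refl) auto
      also have "\<dots> = ent X a b" using X by (auto simp: inM_def)
      finally show "ent X a b = ent (\<Sum>i<n. \<Sum>j<n. Re (ent X i j) *\<^sub>R single i j 1
          + Im (ent X i j) *\<^sub>R single i j \<i>) a b" by simp
    qed
    also have "\<dots> \<in> span B"
      by (intro span_sum span_add span_scale span_base) (force simp: B_def)+
    finally show ?thesis .
  qed
  define f where "f i = pe E A (monom 1 i)" for i
  define N where "N = card B"
  have f_span: "f ` {..N} \<subseteq> span B"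
    using assms by (auto simp: f_def intro!: spanB pe_inM)
  show ?thesis
  \<comment> \<open>Two equal powers already give an annihilating difference of monomials; only
    distinct powers form a set too large to be independent.\<close>
  proof (cases "inj_on f {..N}")
    case False
    then obtain i j where ij: "i \<noteq> j" "f i = f j" by (auto simp: inj_on_def)
    have "coeff (monom 1 i - monom 1 j :: real poly) i \<noteq> 0" using ij by simp
    then have "monom 1 i - monom 1 j \<noteq> (0 :: real poly)" by (metis coeff_0)
    then show ?thesis using ij by (intro exI[of _ "monom 1 i - monom 1 j"]) (simp add: f_def)
  next
    case True
    then have "card (f ` {..N}) = Suc N" by (simp add: card_image)
    then have "dependent (f ` {..N})"
      using independent_span_bound[OF finB _ f_span] by (auto simp: N_def)
    then obtain u where u: "\<exists>v\<in>f ` {..N}. u v \<noteq> 0" "(\<Sum>v\<in>f ` {..N}. u v *\<^sub>R v) = 0"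
      by (auto simp: dependent_finite)
    let ?p = "\<Sum>i\<le>N. smult (u (f i)) (monom 1 i)"
    obtain i where i: "i \<le> N" "u (f i) \<noteq> 0" using u(1) by auto
    have "coeff ?p i = u (f i)" using i by (simp add: coeff_sum if_distrib[of "(*) _"] cong: if_cong)
    then have "?p \<noteq> 0" using i by (metis coeff_0)
    moreover have "pe E A ?p = (\<Sum>i\<le>N. u (f i) *\<^sub>R f i)"
      by (simp add: f_def del: smult_monom)
    then have "pe E A ?p = 0" using u(2) by (simp add: sum.reindex[OF True])
    ultimately show ?thesis by blast
  qed
qed

text \<open>The eigenprojection is a polynomial in \<open>A\<close>, so it commutes with whatever commutes with \<open>A\<close>.\<close>

lemma ex_eigenprojection:
  assumes E: "proj E" "inM n E" and A: "adjm A = A" "E * A = A" "A * E = A"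
    and nonscalar: "\<nexists>c. A = c *\<^sub>R E"
  obtains Q where "proj Q" "Q \<noteq> 0" "Q \<noteq> E" "E * Q = Q" "Q * E = Q" "inM n Q"
    "\<And>X. X * A = A * X \<Longrightarrow> X * E = E * X \<Longrightarrow> X * Q = Q * X"
proof -
  have EE: "E * E = E" and EA: "adjm E = E" using E by (auto simp: proj_def)
  have AM: "inM n A" using A(2,3) E(2) unfolding inM_iff by (metis mult.assoc)
  have E0: "E \<noteq> 0" using nonscalar A by force
  obtain p0 where "p0 \<noteq> 0 \<and> pe E A p0 = 0" using ex_annihilating_poly[OF E(2) AM] by blast
  \<comment> \<open>\<open>q\<close> is a minimal polynomial of \<open>A\<close>, up to a scalar
    factor.\<close>
  then obtain q where q: "q \<noteq> 0" "pe E A q = 0"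
    and qmin: "\<And>p. p \<noteq> 0 \<Longrightarrow> pe E A p = 0 \<Longrightarrow> degree q \<le> degree p"
    using ex_has_least_nat[of "\<lambda>p. p \<noteq> 0 \<and> pe E A p = 0" p0 degree] by blast
  have herm: "adjm (pe E A p) = pe E A p" for p using A EA by (intro pe_adjm) auto
  have mult: "pe E A (p * r) = pe E A p * pe E A r" for p r by (rule pe_mult[OF EE A(2)])
  have "degree q \<noteq> 0"
  proof
    assume "degree q = 0"
    then obtain c where c: "q = [:c:]" by (metis degree_eq_zeroE)
    then have "c \<noteq> 0" "c *\<^sub>R E = 0" using q by auto
    then show False using E0 by simp
  qed
  then have "\<not> constant (poly (map_poly complex_of_real q))"
    by (simp add: constant_degree degree_map_poly)
  from fundamental_theorem_of_algebra[OF this] obtain z :: complex where z: "pe 1 z q = 0"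
    by (auto simp: pe_complex)
  \<comment> \<open>For a root off the real line the real quadratic \<open>s\<close> with roots
    \<open>z\<close> and \<open>cnj z\<close> divides \<open>q\<close>. By minimality the cofactor
    gives \<open>N \<noteq> 0\<close>, although the value of \<open>s\<close> at \<open>A\<close>
    annihilates it. That value is the square of \<open>A - Re z *\<^sub>R E\<close> plus a positive
    multiple of \<open>E\<close>, so a sum of two squared norms, one of them positive, would
    vanish.\<close>
  have "Im z = 0"
  proof (rule ccontr)
    assume b: "Im z \<noteq> 0"
    define s where "s = [:(Re z)\<^sup>2 + (Im z)\<^sup>2, - 2 * Re z, 1:]"
    have s: "pe 1 z s = 0"
      by (simp add: s_def complex_eq_iff power2_eq_square algebra_simps)
    have ds: "degree s = 2" by (simp add: s_def)
    define r where "r = q mod s"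
    have qs: "q = s * (q div s) + r" by (simp add: r_def)
    have "pe 1 z q = pe 1 z s * pe 1 z (q div s) + pe 1 z r"
      by (subst qs) (simp add: pe_mult)
    then have rz: "pe 1 z r = 0" using z s by simp
    have "degree r < 2"
      using degree_mod_less'[of s q] ds by (cases "s = 0"; cases "r = 0") (auto simp: r_def)
    then obtain r0 r1 where r01: "r = [:r0, r1:]"
      by (metis One_nat_def degree_eq_zeroE degree_pCons_eq_if less_2_cases_iff pCons_cases
        Suc_inject nat.distinct(1) pCons_0_0)
    have "r1 = 0" "r0 = 0" using rz b unfolding r01 by (auto simp: complex_eq_iff)
    then have qs': "q = s * (q div s)" using qs r01 by simp
    define N where "N = pe E A (q div s)"
    have nz: "q div s \<noteq> 0" using qs' q(1) by auto
    have "degree q = degree s + degree (q div s)"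
      using qs' q(1) nz by (metis degree_mult_eq mult_zero_left)
    then have N0: "N \<noteq> 0" using qmin[OF nz] ds unfolding N_def by auto
    define Y where "Y = (A - Re z *\<^sub>R E) * N"
    have "N * A = A * N" unfolding N_def by (rule pe_commute[symmetric]) (use A in auto)
    have EN: "E * N = N" unfolding N_def by (rule pe_unit[OF EE A(2)])
    have "pe E A s * N = 0" using mult[of s "q div s"] qs' q(2) by (simp add: N_def)
    moreover have "pe E A s = (A - Re z *\<^sub>R E) * (A - Re z *\<^sub>R E) + (Im z)\<^sup>2 *\<^sub>R E"
      using A EE by (simp add: s_def algebra_simps power2_eq_square) (simp flip: scaleR_add_left)
    ultimately have "N * ((A - Re z *\<^sub>R E) * (A - Re z *\<^sub>R E) * N + (Im z)\<^sup>2 *\<^sub>R N) = 0"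
      by (simp add: distrib_right EN)
    then have "adjm Y * Y + (Im z)\<^sup>2 *\<^sub>R (N * N) = 0"
      using herm[of "q div s"] A(1) EA
      by (simp add: Y_def N_def distrib_left mult.assoc)
    then have "tr (adjm Y * adjm (adjm Y)) + (Im z)\<^sup>2 * tr (N * adjm N) = 0"
      using herm[of "q div s"] by (metis N_def adjm_adjm tr_add tr_scaleR tr_zero of_real_power)
    then have "complex_of_real (nsq (adjm Y) + (Im z)\<^sup>2 * nsq N) = 0"
      unfolding tr_mult_adjm by simp
    then have "nsq (adjm Y) + (Im z)\<^sup>2 * nsq N = 0" by (simp only: of_real_eq_0_iff)
    moreover have "0 < (Im z)\<^sup>2 * nsq N"
      using b N0 nsq_nonneg[of N] nsq_eq_0[of N] by (simp add: less_le)
    ultimately show False using nsq_nonneg[of "adjm Y"] by linarith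
  qed
  define l where "l = Re z"
  have zl: "z = of_real l" using \<open>Im z = 0\<close> by (simp add: l_def complex_eq_iff)
  have pe_l: "pe 1 z p = of_real (poly p l)" for p
    by (induction p) (simp_all add: zl scaleR_conv_of_real)
  have "poly q l = 0" using z pe_l[of q] by simp
  \<comment> \<open>The cofactor \<open>v\<close> of a linear factor gives a nonzero
    \<open>N\<close> with \<open>A * N = l *\<^sub>R N\<close>, so \<open>N * N\<close> is
    \<open>N\<close> times the number \<open>poly v l\<close>. Being hermitian, \<open>N\<close> has
    a nonzero square, and division by that number makes it a projection.\<close>
  then obtain v where v: "q = [:- l, 1:] * v" by (auto simp: poly_eq_0_iff_dvd dvd_def)
  have v0: "v \<noteq> 0" using v q(1) by auto
  define N where "N = pe E A v"
  have "degree q = 1 + degree v" unfolding v using v0 by (subst degree_mult_eq) auto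
  then have N0: "N \<noteq> 0" using qmin[OF v0] unfolding N_def by auto
  have EN: "E * N = N" unfolding N_def by (rule pe_unit[OF EE A(2)])
  have "pe E A [:- l, 1:] * N = 0" using mult[of "[:- l, 1:]" v] v q(2) by (simp add: N_def)
  then have AN: "A * N = l *\<^sub>R N" using EN A by (simp add: algebra_simps)
  have pN: "pe E A p * N = poly p l *\<^sub>R N" for p
    by (induction p) (simp_all add: EN AN distrib_right mult.assoc scaleR_add_left scaleR_left_commute flip: scaleR_scaleR)
  define c where "c = poly v l"
  have NN: "N * N = c *\<^sub>R N" using pN[of v] by (simp add: N_def c_def)
  have Nh: "adjm N = N" by (simp add: N_def herm)
  have c0: "c \<noteq> 0" using herm_sq_eq_0[OF Nh] NN N0 by auto
  define Q where "Q = (1 / c) *\<^sub>R N"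
  have comm: "X * Q = Q * X" if "X * A = A * X" "X * E = E * X" for X
    using pe_commute[OF that, of v] by (simp add: Q_def N_def)
  show thesis
  proof (rule that[of Q])
    show "proj Q" using NN c0 by (simp add: proj_def Q_def Nh)
    show "Q \<noteq> 0" using N0 c0 by (simp add: Q_def)
    show "E * Q = Q" by (simp add: Q_def EN)
    show "Q * E = Q" using comm[of E] A EN by (auto simp: Q_def)
    show "inM n Q" unfolding Q_def N_def by (intro inM_scaleR pe_inM E AM)
    show "Q \<noteq> E"
    proof
      assume "Q = E"
      then have "A = A * Q" using A by simp
      also have "\<dots> = l *\<^sub>R E" using AN \<open>Q = E\<close>[symmetric] by (simp add: Q_def)
      finally show False using nonscalar by blast
    qed
  qed (rule comm)
qed

section \<open>Orthogonal decompositions of the space that reduce a set of matrices\<close>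

definition decomp :: "nat \<Rightarrow> cmat set \<Rightarrow> cmat set \<Rightarrow> bool" where
  "decomp n G D \<longleftrightarrow> finite D \<and> (\<forall>E\<in>D. proj E \<and> E \<noteq> 0 \<and> inM n E \<and> (\<forall>g\<in>G. g * E = E * g))
    \<and> (\<forall>E\<in>D. \<forall>F\<in>D. E \<noteq> F \<longrightarrow> E * F = 0) \<and> \<Sum>D = one_cm n"

lemma decompD:
  assumes "decomp n G D"
  shows "finite D" "\<And>E. E \<in> D \<Longrightarrow> proj E" "\<And>E. E \<in> D \<Longrightarrow> E \<noteq> 0" "\<And>E. E \<in> D \<Longrightarrow> inM n E"
    "\<And>E g. E \<in> D \<Longrightarrow> g \<in> G \<Longrightarrow> g * E = E * g"
    "\<And>E F. E \<in> D \<Longrightarrow> F \<in> D \<Longrightarrow> E \<noteq> F \<Longrightarrow> E * F = 0" "\<Sum>D = one_cm n"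
  using assms by (auto simp: decomp_def)

lemma decomp_tr: "decomp n G D \<Longrightarrow> (\<Sum>E\<in>D. Re (tr E)) = n"
proof -
  assume "decomp n G D"
  then have "tr (\<Sum>D) = of_nat n" by (simp add: decompD tr_dg)
  then show ?thesis by (simp flip: Re_sum)
qed

text \<open>In a decomposition with the maximal number of summands, \<open>A * E\<close> has no eigenprojection
  that would refine it.\<close>

lemma ex_scalar_decomp:
  assumes n: "0 < n" and G: "\<And>g. g \<in> G \<Longrightarrow> inM n g"
  obtains D where "decomp n G D"
    "\<And>A E. adjm A = A \<Longrightarrow> (\<And>g. g \<in> G \<Longrightarrow> g * A = A * g) \<Longrightarrow> E \<in> D \<Longrightarrow> A * E = E * A
      \<Longrightarrow> \<exists>c. A * E = c *\<^sub>R E"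
proof -
  have "ent (one_cm n) 0 0 \<noteq> ent 0 0 0" using n by simp
  then have one: "one_cm n \<noteq> 0" by metis
  have "decomp n G {one_cm n}"
    using one G by (auto simp: decomp_def proj_dg mult_one one_mult)
  \<comment> \<open>Each nonzero projection takes at least 1 of the total trace \<open>n\<close>, so
    the number of summands has a maximum.\<close>
  moreover have bound: "card D \<le> n" if "decomp n G D" for D
  proof -
    have "real (card D) = (\<Sum>E\<in>D. 1)" by simp
    also have "\<dots> \<le> (\<Sum>E\<in>D. Re (tr E))"
      by (intro sum_mono proj_tr_ge_1) (use decompD[OF that] in auto)
    finally show ?thesis using decomp_tr[OF that] by simp
  qed
  ultimately obtain D where D: "decomp n G D" and max: "\<And>D'. decomp n G D' \<Longrightarrow> card D' \<le> card D"
    using ex_has_greatest_nat[of "decomp n G" "{one_cm n}" card "Suc n"] by (auto simp: less_Suc_eq_le)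
  note d = decompD[OF D]
  show thesis
  proof (rule that[OF D])
    fix A E
    assume A: "adjm A = A" "\<And>g. g \<in> G \<Longrightarrow> g * A = A * g" and ED: "E \<in> D" and AE: "A * E = E * A"
    show "\<exists>c. A * E = c *\<^sub>R E"
    proof (rule ccontr)
      assume ns: "\<nexists>c. A * E = c *\<^sub>R E"
      have E: "proj E" "inM n E" "E * E = E" "adjm E = E" using d ED by (auto simp: proj_def)
      obtain Q where Q: "proj Q" "Q \<noteq> 0" "Q \<noteq> E" "E * Q = Q" "Q * E = Q" "inM n Q"
        and Qc: "\<And>X. X * (A * E) = A * E * X \<Longrightarrow> X * E = E * X \<Longrightarrow> X * Q = Q * X"
      proof (rule ex_eigenprojection[OF E(1,2) _ _ _ ns])
        show "adjm (A * E) = A * E" using A E AE by simp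
        show "E * (A * E) = A * E" using AE E(3) by (metis mult.assoc)
        show "A * E * E = A * E" using E(3) by (simp add: mult.assoc)
      qed blast
      have gQ: "g * Q = Q * g" if g: "g \<in> G" for g
        by (rule Qc) (metis A(2) d(5) ED g mult.assoc)+
      have QF: "Q * F = 0" "F * Q = 0" if "F \<in> D" "F \<noteq> E" for F
        using d(6)[of E F] d(6)[of F E] that ED Q(4,5)
        by (metis mult.assoc mult_zero_left mult_zero_right)+
      have EQ: "E - Q \<noteq> Q"
      proof
        assume "E - Q = Q"
        then have "Q * (E - Q) = Q * Q" by simp
        then show False using Q proj_idem[OF Q(1)] by (simp add: algebra_simps)
      qed
      have nin: "Q \<notin> D - {E}" "E - Q \<notin> D - {E}"
      proof -
        show "Q \<notin> D - {E}" using QF(1)[of Q] Q(2) proj_idem[OF Q(1)] by auto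
        show "E - Q \<notin> D - {E}"
        proof
          assume "E - Q \<in> D - {E}"
          then have "E * (E - Q) = 0" using d(6)[OF ED] by auto
          then show False using E Q by (simp add: algebra_simps)
        qed
      qed
      \<comment> \<open>Splitting \<open>E\<close> into \<open>Q\<close> and \<open>E - Q\<close>
        adds one summand, and both parts still commute with \<open>G\<close>.\<close>
      let ?D = "insert Q (insert (E - Q) (D - {E}))"
      have "decomp n G ?D" unfolding decomp_def
      proof (intro conjI)
        show "finite ?D" using d by simp
        show "\<forall>E\<in>?D. proj E \<and> E \<noteq> 0 \<and> inM n E \<and> (\<forall>g\<in>G. g * E = E * g)"
          using d Q E gQ ED by (auto intro!: proj_diff inM_minus simp: algebra_simps)
        show "\<forall>X\<in>?D. \<forall>Y\<in>?D. X \<noteq> Y \<longrightarrow> X * Y = 0"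
          using d(6) QF Q proj_idem[OF Q(1)] ED by (auto simp: algebra_simps)
        have "\<Sum>?D = Q + (E - Q + \<Sum>(D - {E}))"
          using nin d(1) EQ by (subst sum.insert, simp, force, subst sum.insert) auto
        also have "\<dots> = \<Sum>D" using sum.remove[OF d(1) ED, of "\<lambda>x. x"] by simp
        finally show "\<Sum>?D = one_cm n" using d(7) by simp
      qed
      moreover have "card ?D = Suc (card D)"
        using nin EQ d(1) ED card_Suc_Diff1[OF d(1) ED] by (subst card_insert_disjoint, simp, force, subst card_insert_disjoint) auto
      ultimately show False using max[of ?D] by simp
    qed
  qed
qed

section \<open>Triples of anticommuting symmetries\<close>

text \<open>The eigenprojections \<open>(E + g) / 2\<close> and \<open>(E - g) / 2\<close> have sum
  \<open>E\<close>, and each has trace at least 1 unless it vanishes. If one did, \<open>g\<close>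
  would be \<open>E\<close> or \<open>- E\<close> and would commute with \<open>h\<close>.\<close>

lemma anticommuting_pair_tr:
  assumes E: "proj E" "E \<noteq> 0"
    and g: "adjm g = g" "g * g = E" "E * g = g" "g * E = g"
    and h: "h * h = E" "E * h = h" "h * E = h"
    and anti: "g * h = - (h * g)"
  shows "2 \<le> Re (tr E)"
proof -
  have EE: "E * E = E" "adjm E = E" using E by (auto simp: proj_def)
  have p: "proj ((1/2) *\<^sub>R (E + g))" "proj ((1/2) *\<^sub>R (E - g))"
    using EE g by (simp_all add: proj_def algebra_simps) (simp_all flip: scaleR_add_left)
  have n: "(1/2) *\<^sub>R (E + g) \<noteq> 0"
  proof
    assume "(1/2) *\<^sub>R (E + g) = 0"
    then have "g = - E" by (simp add: eq_neg_iff_add_eq_0 add.commute)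
    then have "h = - h" using anti h by simp
    then have "2 *\<^sub>R h = 0" by (simp add: scaleR_2 eq_neg_iff_add_eq_0)
    then show False using h E by simp
  qed
  have n': "(1/2) *\<^sub>R (E - g) \<noteq> 0"
  proof
    assume "(1/2) *\<^sub>R (E - g) = 0"
    then have "g = E" by simp
    then have "h = - h" using anti h by simp
    then have "2 *\<^sub>R h = 0" by (simp add: scaleR_2 eq_neg_iff_add_eq_0)
    then show False using h E by simp
  qed
  show ?thesis using proj_tr_ge_1[OF p(1) n] proj_tr_ge_1[OF p(2) n'] by simp
qed

text \<open>The eigenvalues of \<open>g\<close> can only be 0, 1 and -1. Without a spectral theorem:
  the hermitian matrix \<open>g * g * g - g\<close> has square zero.\<close>

lemma herm_cube:
  assumes "adjm g = g" "proj (g * g)"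
  shows "g * g * g = g"
proof -
  have "g * g * (g * g) = g * g" using assms by (simp add: proj_def)
  then have "g * g * g * (g * g * g) = g * g" "g * (g * g * g) = g * g" "g * g * g * g = g * g"
    by (metis mult.assoc)+
  then have "(g * g * g - g) * (g * g * g - g) = 0"
    by (simp only: left_diff_distrib right_diff_distrib diff_self)
  moreover have "adjm (g * g * g - g) = g * g * g - g" using assms(1) by (simp add: mult.assoc)
  ultimately have "g * g * g - g = 0" by (rule herm_sq_eq_0[rotated])
  then show ?thesis by simp
qed

text \<open>On each summand \<open>E\<close> of a maximal decomposition every \<open>p a\<close> is a scalar; \<open>S E\<close> collects
  the nonzero ones, and the traces leave room for \<open>card (S E) \<le> 1\<close> only.\<close>

lemma anticommuting_triples:
  fixes \<gamma> :: "nat \<Rightarrow> nat \<Rightarrow> cmat" and p :: "nat \<Rightarrow> cmat"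
  assumes herm: "\<And>a i. a < k \<Longrightarrow> i < 3 \<Longrightarrow> adjm (\<gamma> a i) = \<gamma> a i"
    and inM: "\<And>a i. a < k \<Longrightarrow> i < 3 \<Longrightarrow> inM (2 * k) (\<gamma> a i)"
    and sq: "\<And>a i. a < k \<Longrightarrow> i < 3 \<Longrightarrow> \<gamma> a i * \<gamma> a i = p a"
    and anti: "\<And>a i b j. a < k \<Longrightarrow> i < 3 \<Longrightarrow> b < k \<Longrightarrow> j < 3 \<Longrightarrow> (a, i) \<noteq> (b, j) \<Longrightarrow>
      \<gamma> a i * \<gamma> b j = - (\<gamma> b j * \<gamma> a i)"
    and sum: "(\<Sum>a<k. p a) = one_cm (2 * k)"
    and nz: "\<And>a. a < k \<Longrightarrow> p a \<noteq> 0"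
  shows "\<And>a b. a < k \<Longrightarrow> b < k \<Longrightarrow> a \<noteq> b \<Longrightarrow> p a * p b = 0"
    and "\<And>a. a < k \<Longrightarrow> proj (p a)" and "\<And>a. a < k \<Longrightarrow> tr (p a) = 2"
proof -
  define G where "G = (\<lambda>(a, i). \<gamma> a i) ` ({..<k} \<times> {..<3})"
  have GI: "\<gamma> a i \<in> G" if "a < k" "i < 3" for a i using that by (auto simp: G_def)
  have pM: "inM (2 * k) (p a)" if "a < k" for a
    using inM_mult[OF inM[OF that, of 0] inM[OF that, of 0]] sq[OF that, of 0] by simp
  have ph: "adjm (p a) = p a" if "a < k" for a
    using sq[OF that, of 0] herm[OF that, of 0] by (metis adjm_mult zero_less_numeral)
  \<comment> \<open>\<open>p a\<close> is a square of a generator, so moving another generator past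
    it changes the sign twice.\<close>
  have pc: "g * p a = p a * g" if a: "a < k" and g: "g \<in> G" for a g
  proof -
    obtain b j where bj: "b < k" "j < 3" "g = \<gamma> b j" using g by (auto simp: G_def)
    have "\<gamma> b j * (\<gamma> a 0 * \<gamma> a 0) = \<gamma> a 0 * \<gamma> a 0 * \<gamma> b j"
    proof (cases "(b, j) = (a, 0)")
      case False
      then have "\<gamma> b j * \<gamma> a 0 = - (\<gamma> a 0 * \<gamma> b j)" using a bj by (intro anti) auto
      then show ?thesis by (metis mult.assoc mult_minus_left mult_minus_right minus_minus)
    qed (simp add: mult.assoc)
    then show ?thesis using sq[OF a, of 0] bj by simp
  qed
  have main: "p a * p b = 0" if ab: "a < k" "b < k" "a \<noteq> b" for a b
  proof -
    have k: "0 < 2 * k" using ab by simp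
    obtain D where D: "decomp (2 * k) G D" and scal: "\<And>A E. adjm A = A \<Longrightarrow>
        (\<And>g. g \<in> G \<Longrightarrow> g * A = A * g) \<Longrightarrow> E \<in> D \<Longrightarrow> A * E = E * A \<Longrightarrow> \<exists>c. A * E = c *\<^sub>R E"
    proof (rule ex_scalar_decomp[OF k])
      show "inM (2 * k) g" if "g \<in> G" for g using that inM by (auto simp: G_def)
    qed blast
    note d = decompD[OF D]
    have pE: "p a * E = E * p a" if "E \<in> D" "a < k" for a E
      using d(5)[OF that(1) GI[OF that(2), of 0]] sq[OF that(2), of 0]
      by (metis mult.assoc zero_less_numeral)
    define c where "c a E = (SOME c. p a * E = c *\<^sub>R E)" for a E
    have c: "p a * E = c a E *\<^sub>R E" if "E \<in> D" "a < k" for a E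
    proof -
      have "\<exists>c. p a * E = c *\<^sub>R E" by (rule scal) (use that ph pc pE in auto)
      then show ?thesis unfolding c_def by (rule someI_ex)
    qed
    define S where "S E = {a. a < k \<and> p a * E \<noteq> 0}" for E
    have finS: "finite (S E)" for E by (simp add: S_def)
    \<comment> \<open>The scalar times the squared norm of \<open>E\<close> is the squared norm of
      \<open>\<gamma> a 0 * E\<close>, so it cannot be negative.\<close>
    have cpos: "0 < c a E" if E: "E \<in> D" and a: "a \<in> S E" for a E
    proof -
      have ak: "a < k" using a by (simp add: S_def)
      have EE: "E * E = E" "adjm E = E" using d(2)[OF E] by (auto simp: proj_def)
      have gE: "\<gamma> a 0 * E = E * \<gamma> a 0" using d(5)[OF E GI[OF ak]] by simp
      have "\<gamma> a 0 * E * adjm (\<gamma> a 0 * E) = p a * E"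
        using EE gE herm[OF ak, of 0] sq[OF ak, of 0] by simp (metis mult.assoc)
      then have "of_real (nsq (\<gamma> a 0 * E)) = tr (c a E *\<^sub>R E)"
        using tr_mult_adjm[of "\<gamma> a 0 * E"] c[OF E ak] by simp
      also have "\<dots> = of_real (c a E * nsq E)" using proj_tr[OF d(2)[OF E]] by simp
      finally have "nsq (\<gamma> a 0 * E) = c a E * nsq E" by (simp only: of_real_eq_iff)
      moreover have "0 < nsq E" using d(3)[OF E] nsq_nonneg[of E] nsq_eq_0[of E] by linarith
      ultimately have "0 \<le> c a E" using nsq_nonneg[of "\<gamma> a 0 * E"] by (simp add: zero_le_mult_iff)
      moreover have "c a E \<noteq> 0" using a c[OF E ak] by (auto simp: S_def)
      ultimately show ?thesis by simp
    qed
    \<comment> \<open>Dividing by the root of the scalar turns the compressed generators into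
      symmetries of \<open>E\<close>.\<close>
    define g where "g E a i = (1 / sqrt (c a E)) *\<^sub>R (\<gamma> a i * E)" for E a i
    have g: "adjm (g E a i) = g E a i" "g E a i * g E a i = E" "E * g E a i = g E a i"
      "g E a i * E = g E a i" if E: "E \<in> D" and a: "a \<in> S E" and i: "i < 3" for E a i
    proof -
      have ak: "a < k" using a by (simp add: S_def)
      have EE: "E * E = E" "adjm E = E" using d(2)[OF E] by (auto simp: proj_def)
      have gE: "\<gamma> a i * E = E * \<gamma> a i" using d(5)[OF E GI[OF ak i]] by simp
      show "adjm (g E a i) = g E a i" using EE gE herm[OF ak i] by (simp add: g_def)
      have "E * (\<gamma> a i * E) = \<gamma> a i * E" "\<gamma> a i * E * E = \<gamma> a i * E"
        using EE gE by (metis mult.assoc)+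
      then show "E * g E a i = g E a i" "g E a i * E = g E a i" by (simp_all add: g_def)
      have "\<gamma> a i * E * (\<gamma> a i * E) = p a * E" using EE gE sq[OF ak i] by (metis mult.assoc)
      then show "g E a i * g E a i = E"
        using cpos[OF E a] c[OF E ak] by (simp add: g_def)
    qed
    have ganti: "g E a i * g E b j = - (g E b j * g E a i)"
      if E: "E \<in> D" and a: "a \<in> S E" "b \<in> S E" and i: "i < 3" "j < 3" "(a, i) \<noteq> (b, j)" for E a b i j
    proof -
      have ak: "a < k" "b < k" using a by (auto simp: S_def)
      have gE: "\<gamma> a i * E = E * \<gamma> a i" "\<gamma> b j * E = E * \<gamma> b j"
        using d(5)[OF E GI[OF ak(1) i(1)]] d(5)[OF E GI[OF ak(2) i(2)]] by simp_all
      have "E * E = E" using d(2)[OF E] by (rule proj_idem)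
      then have "\<gamma> a i * E * (\<gamma> b j * E) = \<gamma> a i * \<gamma> b j * E"
        "\<gamma> b j * E * (\<gamma> a i * E) = \<gamma> b j * \<gamma> a i * E"
        using gE by (metis mult.assoc)+
      then have "\<gamma> a i * E * (\<gamma> b j * E) = - (\<gamma> b j * E * (\<gamma> a i * E))"
        using anti[OF ak(1) i(1) ak(2) i(2,3)] by simp
      then show ?thesis by (simp add: g_def)
    qed
    have r1: "2 * real (card (S E)) \<le> Re (tr E)"
      and r2: "2 \<le> card (S E) \<Longrightarrow> 2 * real (card (S E)) < Re (tr E)" if E: "E \<in> D" for E
    proof -
      have tr1: "1 \<le> Re (tr E)" by (rule proj_tr_ge_1) (use d E in auto)
      show strict: "2 * real (card (S E)) < Re (tr E)" if r: "2 \<le> card (S E)"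
      proof -
        let ?r = "card (S E)"
        \<comment> \<open>\<open>h\<close> enumerates \<open>S E\<close>; a number \<open>s\<close>
          below \<open>3 * ?r\<close> encodes member \<open>s mod 3\<close> of the triple
          \<open>h (s div 3)\<close>.\<close>
        obtain h where h: "bij_betw h {0..<?r} (S E)" using ex_bij_betw_nat_finite[OF finS] by blast
        have hS: "h (s div 3) \<in> S E" if "s < 3 * ?r" for s
          using bij_betwE[OF h] that by (auto simp: less_mult_imp_div_less mult.commute)
        have hne: "(h (s div 3), s mod 3) \<noteq> (h (t div 3), t mod 3)"
          if "s < 3 * ?r" "t < 3 * ?r" "s \<noteq> t" for s t
        proof
          assume eq: "(h (s div 3), s mod 3) = (h (t div 3), t mod 3)"
          have "s div 3 = t div 3"
            using bij_betw_imp_inj_on[OF h] eq that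
            by (auto simp: inj_on_def less_mult_imp_div_less mult.commute)
          then show False using eq that by (metis Pair_inject div_mult_mod_eq)
        qed
        have "real (3 * ?r * (3 * ?r + 1)) / 2 \<le> (Re (tr E))\<^sup>2"
        proof (rule clifford_bound)
          show "g E (h (s div 3)) (s mod 3) * g E (h (t div 3)) (t mod 3)
              = - (g E (h (t div 3)) (t mod 3) * g E (h (s div 3)) (s mod 3))"
            if "s < 3 * ?r" "t < 3 * ?r" "s \<noteq> t" for s t
            by (rule ganti[OF E hS[OF that(1)] hS[OF that(2)] _ _ hne[OF that]]) auto
        qed (use d(2-4)[OF E] r g[OF E hS] in auto)
        \<comment> \<open>Three generators per triple give the leading coefficient 9/2 on the right,
          above the 4 on the left.\<close>
        moreover have "(2 * real ?r)\<^sup>2 < real (3 * ?r * (3 * ?r + 1)) / 2"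
        proof -
          have "0 < real ?r * real ?r" using r by simp
          then show ?thesis by (simp add: power2_eq_square field_simps)
        qed
        ultimately have "(2 * real ?r)\<^sup>2 < (Re (tr E))\<^sup>2" by linarith
        then show ?thesis using tr1 by (intro power2_less_imp_less[of "2 * real ?r"]) auto
      qed
      show "2 * real (card (S E)) \<le> Re (tr E)"
      proof (cases "card (S E) = 1")
        case True
        then obtain a where a: "a \<in> S E" by (metis card_1_singletonE singletonI)
        have "2 \<le> Re (tr E)"
          by (rule anticommuting_pair_tr[of E "g E a 0" "g E a 1"])
            (use d(2,3)[OF E] g[OF E a] ganti[OF E a a, of 0 1] in auto)
        then show ?thesis using True by simp
      next
        case False
        then show ?thesis using strict tr1 by (cases "card (S E) = 0") auto
      qed
    qed
    have nzE: "1 \<le> card {E \<in> D. a \<in> S E}" if a: "a < k" for a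
    proof -
      have "p a = p a * \<Sum>D" using d(7) pM[OF a] by (simp add: mult_one)
      also have "\<dots> = (\<Sum>E\<in>D. p a * E)" by (simp add: sum_distrib_left)
      finally have "(\<Sum>E\<in>D. p a * E) \<noteq> 0" using nz[OF a] by simp
      then obtain E where "E \<in> D" "p a * E \<noteq> 0" by (metis sum.neutral)
      then have "{E \<in> D. a \<in> S E} \<noteq> {}" using a by (auto simp: S_def)
      then show ?thesis using d(1) by (simp add: Suc_le_eq card_gt_0_iff)
    qed
    \<comment> \<open>Double counting: each \<open>a\<close> lies in some \<open>S E\<close>, and
      each \<open>E\<close> has at least twice the size of \<open>S E\<close> as trace. As the
      traces sum to \<open>2 * k\<close>, equality holds for every \<open>E\<close>; a set
      \<open>S E\<close> with two elements would make it strict.\<close>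
    have "k = (\<Sum>a<k. 1)" by simp
    also have "\<dots> \<le> (\<Sum>a<k. card {E \<in> D. a \<in> S E})" using nzE by (intro sum_mono) auto
    also have "\<dots> = (\<Sum>a<k. \<Sum>E\<in>D. if a \<in> S E then 1 else 0)"
      using d(1) by (simp add: sum.If_cases Int_def)
    also have "\<dots> = (\<Sum>E\<in>D. \<Sum>a<k. if a \<in> S E then 1 else 0)" by (rule sum.swap)
    also have "\<dots> = (\<Sum>E\<in>D. card (S E))"
    proof (intro sum.cong refl)
      fix E
      have "{..<k} \<inter> S E = S E" by (auto simp: S_def)
      then show "(\<Sum>a<k. if a \<in> S E then 1 else 0) = card (S E)" by (simp add: sum.If_cases)
    qed
    finally have "2 * real k \<le> (\<Sum>E\<in>D. 2 * real (card (S E)))"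
      by (simp flip: sum_distrib_left of_nat_sum)
    moreover have "(\<Sum>E\<in>D. Re (tr E)) = 2 * real k" using decomp_tr[OF D] by simp
    ultimately have le: "\<not> (\<Sum>E\<in>D. 2 * real (card (S E))) < (\<Sum>E\<in>D. Re (tr E))" by simp
    have small: "card (S E) \<le> 1" if "E \<in> D" for E
    proof (rule ccontr)
      assume "\<not> card (S E) \<le> 1"
      then have "(\<Sum>E\<in>D. 2 * real (card (S E))) < (\<Sum>E\<in>D. Re (tr E))"
        using r1 r2[OF that] that d(1) by (intro sum_strict_mono_ex1) auto
      then show False using le by simp
    qed
    have "p a * p b * E = 0" if E: "E \<in> D" for E
    proof -
      have "\<not> (a \<in> S E \<and> b \<in> S E)"
        using small[OF E] ab(3) finS[of E] card_le_Suc0_iff_eq[of "S E"] by auto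
      then have "p a * E = 0 \<or> p b * E = 0" using ab by (auto simp: S_def)
      then show ?thesis using pE[OF E ab(2)] by (metis mult.assoc mult_zero_left mult_zero_right)
    qed
    then have "p a * p b * \<Sum>D = 0" by (simp add: sum_distrib_left)
    then show ?thesis using d(7) inM_mult[OF pM[OF ab(1)] pM[OF ab(2)]] by (simp add: mult_one)
  qed
  \<comment> \<open>Multiplying the sum of all squares by \<open>p a\<close> leaves only
    \<open>p a * p a\<close>, by orthogonality.\<close>
  have pp: "p a * p a = p a" if a: "a < k" for a
  proof -
    have "p a = p a * (\<Sum>b<k. p b)" using pM[OF a] by (simp add: sum mult_one)
    also have "\<dots> = (\<Sum>b<k. if b = a then p a * p a else 0)"
      unfolding sum_distrib_left using main a by (intro sum.cong) auto
    also have "\<dots> = p a * p a" using a by simp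
    finally show ?thesis by simp
  qed
  have pr: "proj (p a)" if "a < k" for a using pp ph that by (simp add: proj_def)
  have tr2: "2 \<le> Re (tr (p a))" if a: "a < k" for a
  proof (rule anticommuting_pair_tr[of _ "\<gamma> a 0" "\<gamma> a 1"])
    have c: "\<gamma> a i * \<gamma> a i * \<gamma> a i = \<gamma> a i" if "i < 3" for i
      by (rule herm_cube) (use herm sq pr a that in auto)
    have cp: "p a * \<gamma> a i = \<gamma> a i" "\<gamma> a i * p a = \<gamma> a i" if "i < 3" for i
      using c[OF that] sq[OF a that] by (metis mult.assoc)+
    show "p a * \<gamma> a 0 = \<gamma> a 0" "\<gamma> a 0 * p a = \<gamma> a 0" by (rule cp; simp)+
    show "p a * \<gamma> a 1 = \<gamma> a 1" "\<gamma> a 1 * p a = \<gamma> a 1" by (rule cp; simp)+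
    show "\<gamma> a 0 * \<gamma> a 1 = - (\<gamma> a 1 * \<gamma> a 0)" by (rule anti) (use a in auto)
  qed (use pr a nz herm sq in auto)
  \<comment> \<open>The \<open>k\<close> traces are at least 2 and sum to \<open>2 * k\<close>, so
    each of them is 2.\<close>
  have "tr (\<Sum>a<k. p a) = of_nat (2 * k)" unfolding sum by (simp add: tr_dg)
  then have "(\<Sum>a<k. Re (tr (p a))) = (\<Sum>a<k. 2)" by (simp flip: Re_sum)
  then have eq: "(\<Sum>a<k. Re (tr (p a)) - 2) = 0" by (simp add: sum_subtractf)
  have "Re (tr (p a)) - 2 = 0" if "a < k" for a
    using eq tr2 that by (subst (asm) sum_nonneg_eq_0_iff) auto
  then have "tr (p a) = 2" if "a < k" for a
    using proj_tr[OF pr[OF that]] that by (auto simp: complex_eq_iff)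
  then show "\<And>a b. a < k \<Longrightarrow> b < k \<Longrightarrow> a \<noteq> b \<Longrightarrow> p a * p b = 0"
    "\<And>a. a < k \<Longrightarrow> proj (p a)" "\<And>a. a < k \<Longrightarrow> tr (p a) = 2"
    using main pr by auto
qed

section \<open>Maps preserving traceless symmetries\<close>

definition H0 :: "nat \<Rightarrow> cmat set" where
  "H0 n = {A. inM n A \<and> adjm A = A \<and> tr A = 0}"

definition unit :: "nat \<Rightarrow> cmat \<Rightarrow> bool" where
  "unit n U \<longleftrightarrow> inM n U \<and> U * adjm U = one_cm n \<and> adjm U * U = one_cm n"

lemma H0I: "inM n A \<Longrightarrow> adjm A = A \<Longrightarrow> tr A = 0 \<Longrightarrow> A \<in> H0 n" by (simp add: H0_def)

lemma H0D: "A \<in> H0 n \<Longrightarrow> inM n A" "A \<in> H0 n \<Longrightarrow> adjm A = A" "A \<in> H0 n \<Longrightarrow> tr A = 0"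
  by (simp_all add: H0_def)

lemma H0_zero [simp]: "0 \<in> H0 n" by (simp add: H0_def)
lemma H0_scaleR: "A \<in> H0 n \<Longrightarrow> r *\<^sub>R A \<in> H0 n" by (simp add: H0_def inM_scaleR)
lemma H0_add: "A \<in> H0 n \<Longrightarrow> B \<in> H0 n \<Longrightarrow> A + B \<in> H0 n" by (simp add: H0_def inM_add)
lemma H0_minus: "A \<in> H0 n \<Longrightarrow> B \<in> H0 n \<Longrightarrow> A - B \<in> H0 n" by (simp add: H0_def inM_minus)
lemma H0_uminus: "A \<in> H0 n \<Longrightarrow> - A \<in> H0 n" using H0_minus[of 0 n A] by simp
lemma H0_sum: "(\<And>x. x \<in> S \<Longrightarrow> f x \<in> H0 n) \<Longrightarrow> sum f S \<in> H0 n"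
  by (induction S rule: infinite_finite_induct) (auto intro: H0_add)

lemmas H0_intros = H0_scaleR H0_add H0_minus H0_uminus

lemma unitD: "unit n U \<Longrightarrow> inM n U" "unit n U \<Longrightarrow> U * adjm U = one_cm n"
  "unit n U \<Longrightarrow> adjm U * U = one_cm n"
  by (simp_all add: unit_def)

lemma unit_adjm: "unit n U \<Longrightarrow> unit n (adjm U)" by (simp add: unit_def inM_adjm)

lemma unit_conjm: "unit n U \<Longrightarrow> unit n (conjm U)"
  unfolding unit_def by (metis conjm_adjm conjm_dg conjm_mult inM_conjm)

lemma unit_mult:
  assumes "unit n U" "unit n V"
  shows "unit n (U * V)"
proof -
  have "U * V * (adjm V * adjm U) = U * (V * adjm V) * adjm U" by (simp add: mult.assoc)
  moreover have "adjm V * adjm U * (U * V) = adjm V * (adjm U * U) * V" by (simp add: mult.assoc)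
  ultimately show ?thesis
    using assms by (simp add: unit_def inM_mult mult_one inM_adjm)
qed

lemma unit_one: "unit n (one_cm n)" by (simp add: unit_def dg_mult_dg)

section \<open>Unitary conjugation and symmetries of blocks\<close>

definition cj :: "cmat \<Rightarrow> cmat \<Rightarrow> cmat" where "cj U A = U * A * adjm U"

lemma cj_zero [simp]: "cj U 0 = 0" by (simp add: cj_def)
lemma cj_add [simp]: "cj U (A + B) = cj U A + cj U B" by (simp add: cj_def algebra_simps)
lemma cj_minus [simp]: "cj U (A - B) = cj U A - cj U B" by (simp add: cj_def algebra_simps)
lemma cj_scaleR [simp]: "cj U (r *\<^sub>R A) = r *\<^sub>R cj U A" by (simp add: cj_def)
lemma cj_adjm [simp]: "adjm (cj U A) = cj U (adjm A)" by (simp add: cj_def mult.assoc)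
lemma cj_cj: "cj U (cj V A) = cj (U * V) A" by (simp add: cj_def mult.assoc)
lemma cj_conjm: "conjm (cj U A) = cj (conjm U) (conjm A)" by (simp add: cj_def conjm_adjm)

lemma cj_mult:
  assumes "unit n U" "inM n A"
  shows "cj U A * cj U B = cj U (A * B)"
proof -
  have "cj U A * cj U B = U * (A * (adjm U * U)) * B * adjm U" by (simp add: cj_def mult.assoc)
  then show ?thesis using assms by (simp add: unitD mult_one cj_def mult.assoc)
qed

lemma cj_one: "unit n U \<Longrightarrow> cj U (one_cm n) = one_cm n"
  by (simp add: cj_def unitD mult_one)

lemma cj_tr:
  assumes "unit n U" "inM n A"
  shows "tr (cj U A) = tr A"
  using tr_commute[of "U * A" "adjm U"] assms
  by (simp add: cj_def unitD one_mult flip: mult.assoc)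

lemma cj_inM: "unit n U \<Longrightarrow> inM n A \<Longrightarrow> inM n (cj U A)"
  by (simp add: cj_def inM_mult inM_adjm unitD)

lemma cj_H0: "unit n U \<Longrightarrow> A \<in> H0 n \<Longrightarrow> cj U A \<in> H0 n"
  by (simp add: H0_def cj_inM cj_tr)

lemma cj_inverse:
  assumes "unit n U" "inM n A"
  shows "cj U (cj (adjm U) A) = A" "cj (adjm U) (cj U A) = A"
  using assms by (simp_all add: cj_cj unitD) (simp_all add: cj_def one_mult mult_one)

text \<open>\<open>A\<close> is a traceless symmetry of the range of \<open>E\<close>, extended by
  zero. The relation \<open>A * E = A\<close> follows, as \<open>A\<close> commutes with its own
  square.\<close>

definition symm :: "nat \<Rightarrow> cmat \<Rightarrow> cmat \<Rightarrow> bool" where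
  "symm n E A \<longleftrightarrow> A \<in> H0 n \<and> A * A = E \<and> E * A = A"

lemma symm_orth:
  assumes "symm n E A" "symm n F B" "E * F = 0"
  shows "A * B = 0" "E * B = 0"
proof -
  have "A * E = A" "F * B = B" using assms(1,2) by (auto simp: symm_def mult.assoc)
  then have "A * B = A * E * (F * B)" by simp
  also have "\<dots> = A * (E * F) * B" by (simp add: mult.assoc)
  finally show "A * B = 0" using assms(3) by simp
  have "E * B = E * F * B" using assms(2) by (simp add: symm_def mult.assoc)
  then show "E * B = 0" using assms(3) by simp
qed

lemma symm_add:
  assumes "symm n E A" "symm n F B" "E * F = 0" "F * E = 0"
  shows "symm n (E + F) (A + B)"
  using assms symm_orth[OF assms(1,2,3)] symm_orth[OF assms(2,1,4)]
  by (simp add: symm_def H0_add algebra_simps)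

lemma symm_uminus: "symm n E A \<Longrightarrow> symm n E (- A)"
  by (simp add: symm_def H0_uminus)

lemma symm_zero: "symm n 0 0" by (simp add: symm_def)

lemma cmat_sum4_eq_0: "x + x + x + x = 0 \<Longrightarrow> x = (0 :: cmat)"
  by (metis (no_types, opaque_lifting) add.assoc scaleR_2 scaleR_eq_0_iff zero_neq_numeral)

text \<open>For hermitian \<open>A\<close> the equation \<open>A * A = one_cm n\<close> is
  unitarity, so \<open>sq_one\<close> is the preservation of traceless hermitian unitaries. Evenness
  passes from the size of a block to that of its complement.\<close>

locale pres =
  fixes n :: nat and \<phi> :: "cmat \<Rightarrow> cmat"
  assumes even_n: "even n"
    and closed: "A \<in> H0 n \<Longrightarrow> \<phi> A \<in> H0 n"
    and lin: "A \<in> H0 n \<Longrightarrow> B \<in> H0 n \<Longrightarrow> \<phi> (a *\<^sub>R A + b *\<^sub>R B) = a *\<^sub>R \<phi> A + b *\<^sub>R \<phi> B"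
    and sq_one: "A \<in> H0 n \<Longrightarrow> A * A = one_cm n \<Longrightarrow> \<phi> A * \<phi> A = one_cm n"
begin

lemma phi_add: "A \<in> H0 n \<Longrightarrow> B \<in> H0 n \<Longrightarrow> \<phi> (A + B) = \<phi> A + \<phi> B"
  using lin[of A B 1 1] by simp
lemma phi_minus: "A \<in> H0 n \<Longrightarrow> B \<in> H0 n \<Longrightarrow> \<phi> (A - B) = \<phi> A - \<phi> B"
  using lin[of A B 1 "- 1"] by simp
lemma phi_scaleR: "A \<in> H0 n \<Longrightarrow> \<phi> (r *\<^sub>R A) = r *\<^sub>R \<phi> A"
  using lin[of A 0 r 0] by simp
lemma phi_zero [simp]: "\<phi> 0 = 0" using phi_scaleR[of 0 0] by simp
lemma phi_uminus: "A \<in> H0 n \<Longrightarrow> \<phi> (- A) = - \<phi> A" using phi_minus[of 0 A] by simp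
lemma phi_sum: "(\<And>x. x \<in> S \<Longrightarrow> f x \<in> H0 n) \<Longrightarrow> \<phi> (sum f S) = (\<Sum>x\<in>S. \<phi> (f x))"
  by (induction S rule: infinite_finite_induct) (auto simp: phi_add H0_sum)

lemma phi_herm: "A \<in> H0 n \<Longrightarrow> adjm (\<phi> A) = \<phi> A" using closed H0D by blast

lemma symm_sq_one: "symm n (one_cm n) A \<Longrightarrow> \<phi> A * \<phi> A = one_cm n"
  by (rule sq_one) (auto simp: symm_def)

text \<open>Compare the squares of the images of \<open>A \<plusminus> B \<plusminus> C\<close>.\<close>

lemma anticommute_blocks:
  assumes A: "symm n E A" and B: "symm n F B" and C: "symm n G C"
    and orth: "E * F = 0" "F * E = 0" "E * G = 0" "G * E = 0" "F * G = 0" "G * F = 0"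
    and one: "E + F + G = one_cm n"
  shows "\<phi> A * \<phi> B = - (\<phi> B * \<phi> A)"
proof -
  have H: "A \<in> H0 n" "B \<in> H0 n" "C \<in> H0 n" using A B C by (auto simp: symm_def)
  have s: "symm n (E + F + G) (A' + B' + C')"
    if "symm n E A'" "symm n F B'" "symm n G C'" for A' B' C'
    by (intro symm_add that) (use orth in \<open>auto simp: algebra_simps\<close>)
  note s' = s[unfolded one, THEN symm_sq_one]
  let ?a = "\<phi> A" and ?b = "\<phi> B" and ?c = "\<phi> C"
  have q1: "(?a + ?b + ?c) * (?a + ?b + ?c) = one_cm n"
    using s'[OF A B C] H by (simp add: phi_add H0_intros)
  have q2: "(?a - ?b + ?c) * (?a - ?b + ?c) = one_cm n"
    using s'[OF A symm_uminus[OF B] C] H by (simp add: phi_add phi_minus H0_intros)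
  have q3: "(?a + ?b - ?c) * (?a + ?b - ?c) = one_cm n"
    using s'[OF A B symm_uminus[OF C]] H by (simp add: phi_add phi_minus H0_intros)
  have q4: "(?a - ?b - ?c) * (?a - ?b - ?c) = one_cm n"
    using s'[OF A symm_uminus[OF B] symm_uminus[OF C]] H
    by (simp add: phi_add phi_minus H0_intros)
  \<comment> \<open>With these signs the squares and the mixed terms involving \<open>?c\<close>
    cancel, while those of \<open>?a\<close> and \<open>?b\<close> occur four times.\<close>
  have "(?a * ?b + ?b * ?a) + (?a * ?b + ?b * ?a) + (?a * ?b + ?b * ?a) + (?a * ?b + ?b * ?a)
    = (?a + ?b + ?c) * (?a + ?b + ?c) - (?a - ?b + ?c) * (?a - ?b + ?c)
      + ((?a + ?b - ?c) * (?a + ?b - ?c) - (?a - ?b - ?c) * (?a - ?b - ?c))"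
    by (simp add: algebra_simps)
  also have "\<dots> = 0" unfolding q1 q2 q3 q4 by simp
  finally have "?a * ?b + ?b * ?a = 0" by (rule cmat_sum4_eq_0)
  then show ?thesis by (simp add: eq_neg_iff_add_eq_0)
qed

text \<open>With the zero matrix as third symmetry, \<open>anticommute_blocks\<close> removes the
  mixed terms from the square of \<open>\<phi> A + \<phi> B\<close>.\<close>

lemma sq_complement:
  assumes A: "symm n E A" and B: "symm n F B"
    and orth: "E * F = 0" "F * E = 0" and one: "E + F = one_cm n"
  shows "\<phi> A * \<phi> A + \<phi> B * \<phi> B = one_cm n"
proof -
  have "\<phi> A * \<phi> B = - (\<phi> B * \<phi> A)"
    by (rule anticommute_blocks[OF A B symm_zero]) (use orth one in auto)
  moreover have "(\<phi> A + \<phi> B) * (\<phi> A + \<phi> B) = one_cm n"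
    using symm_sq_one[OF symm_add[OF A B orth, unfolded one]] A B
    by (simp add: phi_add symm_def)
  ultimately show ?thesis by (simp add: algebra_simps)
qed

text \<open>For every symmetry of the block the square of the image is
  \<open>one_cm n - \<phi> B * \<phi> B\<close>. If \<open>A\<close> and \<open>A'\<close>
  anticommute, then \<open>(A + A') / sqrt 2\<close> is a further symmetry of the block, and the
  square of its image leaves no room for mixed terms.\<close>

lemma same_block:
  assumes A: "symm n E A" and A': "symm n E A'" and B: "symm n F B"
    and orth: "E * F = 0" "F * E = 0" and one: "E + F = one_cm n"
  shows "\<phi> A * \<phi> A = \<phi> A' * \<phi> A'"
    and "A * A' = - (A' * A) \<Longrightarrow> \<phi> A * \<phi> A' = - (\<phi> A' * \<phi> A)"
proof -
  have *: "\<phi> X * \<phi> X = one_cm n - \<phi> B * \<phi> B" if "symm n E X" for X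
    using sq_complement[OF that B orth one] by (simp add: algebra_simps)
  show sq: "\<phi> A * \<phi> A = \<phi> A' * \<phi> A'" by (simp add: *[OF A] *[OF A'])
  assume anti: "A * A' = - (A' * A)"
  have H: "A \<in> H0 n" "A' \<in> H0 n" using A A' by (auto simp: symm_def)
  let ?r = "1 / sqrt 2 :: real"
  have r: "?r * ?r = 1 / 2" by simp
  have "(A + A') * (A + A') = 2 *\<^sub>R E"
    using A A' anti by (simp add: symm_def algebra_simps scaleR_2)
  then have "?r *\<^sub>R (A + A') * (?r *\<^sub>R (A + A')) = E"
    by (simp only: mult_scaleR_left mult_scaleR_right scaleR_scaleR) simp
  moreover have "E * (?r *\<^sub>R (A + A')) = ?r *\<^sub>R (A + A')"
    using A A' by (simp add: symm_def distrib_left)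
  ultimately have "symm n E (?r *\<^sub>R (A + A'))" using H by (simp only: symm_def H0_intros simp_thms)
  from *[OF this] *[OF A] have "\<phi> (?r *\<^sub>R (A + A')) * \<phi> (?r *\<^sub>R (A + A')) = \<phi> A * \<phi> A" by simp
  moreover have "\<phi> (?r *\<^sub>R (A + A')) = ?r *\<^sub>R (\<phi> A + \<phi> A')"
    using H by (simp only: phi_scaleR phi_add H0_add)
  ultimately have "?r *\<^sub>R (\<phi> A + \<phi> A') * (?r *\<^sub>R (\<phi> A + \<phi> A')) = \<phi> A * \<phi> A" by simp
  then have "(1 / 2) *\<^sub>R ((\<phi> A + \<phi> A') * (\<phi> A + \<phi> A')) = \<phi> A * \<phi> A"
    by (simp only: mult_scaleR_left mult_scaleR_right scaleR_scaleR r)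
  moreover have "(\<phi> A + \<phi> A') * (\<phi> A + \<phi> A')
      = 2 *\<^sub>R ((1 / 2) *\<^sub>R ((\<phi> A + \<phi> A') * (\<phi> A + \<phi> A')))"
    by (simp only: scaleR_scaleR) simp
  ultimately have "(\<phi> A + \<phi> A') * (\<phi> A + \<phi> A') = 2 *\<^sub>R (\<phi> A * \<phi> A)" by simp
  then show "\<phi> A * \<phi> A' = - (\<phi> A' * \<phi> A)"
    using sq by (simp add: algebra_simps scaleR_2 eq_neg_iff_add_eq_0)
qed

end

text \<open>A change of frame in the domain: what is proved inside \<open>pres\<close> for the
  standard basis holds for any orthonormal basis, by interpreting the locale for the composed
  map.\<close>

lemma pres_cj_right:
  assumes "pres n \<phi>" "unit n U"
  shows "pres n (\<lambda>A. \<phi> (cj U A))"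
proof -
  interpret pres n \<phi> by fact
  show ?thesis
  proof
    fix A B :: cmat and a b :: real
    assume "A \<in> H0 n" "B \<in> H0 n"
    then show "\<phi> (cj U (a *\<^sub>R A + b *\<^sub>R B)) = a *\<^sub>R \<phi> (cj U A) + b *\<^sub>R \<phi> (cj U B)"
      using assms(2) by (simp add: lin cj_H0)
  next
    fix A assume "A \<in> H0 n" "A * A = one_cm n"
    then show "\<phi> (cj U A) * \<phi> (cj U A) = one_cm n"
      using assms(2) by (intro sq_one) (simp_all add: cj_H0 cj_mult H0D cj_one)
  qed (use assms(2) in \<open>auto simp: even_n closed cj_H0\<close>)
qed

lemma pres_cj_left:
  assumes "pres n \<phi>" "unit n U" "s = 1 \<or> s = (- 1 :: real)"
  shows "pres n (\<lambda>A. s *\<^sub>R cj U (\<phi> A))"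
proof -
  interpret pres n \<phi> by fact
  show ?thesis
  proof
    fix A B :: cmat and a b :: real
    assume "A \<in> H0 n" "B \<in> H0 n"
    then show "s *\<^sub>R cj U (\<phi> (a *\<^sub>R A + b *\<^sub>R B)) = a *\<^sub>R s *\<^sub>R cj U (\<phi> A) + b *\<^sub>R s *\<^sub>R cj U (\<phi> B)"
      by (simp add: lin algebra_simps)
  next
    fix A assume A: "A \<in> H0 n" "A * A = one_cm n"
    have "cj U (\<phi> A) * cj U (\<phi> A) = one_cm n"
      using A assms(2) by (simp add: cj_mult closed H0D sq_one cj_one)
    then show "s *\<^sub>R cj U (\<phi> A) * s *\<^sub>R cj U (\<phi> A) = one_cm n"
      using assms(3) by auto
  qed (use assms(2) in \<open>auto simp: even_n closed cj_H0 H0_scaleR\<close>)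
qed

text \<open>The general traceless hermitian matrix on the plane of \<open>i\<close> and
  \<open>j\<close>, a symmetry when \<open>(d, x)\<close> is a unit vector. The parameters
  \<open>(1, 0)\<close>, \<open>(0, 1)\<close> and \<open>(0, \<i>)\<close> give the Pauli matrices,
  up to sign.\<close>

definition blk :: "nat \<Rightarrow> nat \<Rightarrow> real \<Rightarrow> complex \<Rightarrow> cmat" where
  "blk i j d x = d *\<^sub>R (single i i 1 - single j j 1) + single i j x + single j i (cnj x)"

lemma blk_H0: "i < n \<Longrightarrow> j < n \<Longrightarrow> i \<noteq> j \<Longrightarrow> blk i j d x \<in> H0 n"
  unfolding blk_def by (intro H0I) (simp_all add: inM_add inM_minus algebra_simps)

lemma blk_add: "blk i j d x + blk i j e y = blk i j (d + e) (x + y)"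
  by (simp add: blk_def single_add algebra_simps)

lemma blk_scaleR: "r *\<^sub>R blk i j d x = blk i j (r * d) (of_real r * x)"
  by (simp add: blk_def algebra_simps)

lemma blk_mult:
  assumes "i \<noteq> j"
  shows "blk i j d x * blk i j e y = single i i (of_real (d * e) + x * cnj y)
    + single j j (of_real (d * e) + cnj x * y)
    + single i j (of_real d * y - of_real e * x) + single j i (of_real e * cnj x - of_real d * cnj y)"
  using assms
  by (simp add: blk_def distrib_left distrib_right left_diff_distrib right_diff_distrib)
    (rule cmat_eqI, simp)

lemma dg_pair: "i \<noteq> j \<Longrightarrow> dg {i, j} = single i i 1 + single j j 1"
  by (subst dg_insert) (auto simp: dg_singleton)

lemma symm_blk:
  assumes "i < n" "j < n" "i \<noteq> j" "d\<^sup>2 + (cmod x)\<^sup>2 = 1"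
  shows "symm n (dg {i, j}) (blk i j d x)"
proof -
  have x: "x * cnj x = of_real ((cmod x)\<^sup>2)" by (simp add: complex_norm_square del: of_real_power)
  have "complex_of_real (d * d) + x * cnj x = 1"
    using assms(4) unfolding x by (simp add: power2_eq_square flip: of_real_add of_real_mult)
  then have "blk i j d x * blk i j d x = dg {i, j}"
    using assms(3) by (simp add: blk_mult dg_pair mult.commute[of "cnj x"])
  moreover have "dg {i, j} * blk i j d x = blk i j d x"
    by (simp add: blk_def algebra_simps)
  ultimately show ?thesis using assms by (simp add: symm_def blk_H0)
qed

text \<open>Half of the indices get the diagonal entry 1, the other half -1.\<close>

lemma ex_symm_dg:
  assumes "S \<subseteq> {..<n}" "even (card S)"
  obtains R where "symm n (dg S) R"
proof -
  have fin: "finite S" using assms(1) finite_subset by blast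
  obtain T where T: "T \<subseteq> S" "card T = card S div 2"
    by (metis div_le_dividend obtain_subset_with_card_n)
  have finT: "finite T" using T fin finite_subset by blast
  have c: "card (S - T) = card T" using T assms(2) by (auto simp: card_Diff_subset finT)
  have "symm n (dg S) (dg T - dg (S - T))"
    unfolding symm_def
  proof (intro conjI H0I)
    show "(dg T - dg (S - T)) * (dg T - dg (S - T)) = dg S"
      using T fin finT by (intro cmat_eqI) (auto simp: algebra_simps)
    show "dg S * (dg T - dg (S - T)) = dg T - dg (S - T)"
      using T fin finT by (intro cmat_eqI) (auto simp: algebra_simps)
    show "inM n (dg T - dg (S - T))" using T assms(1) by (intro inM_minus inM_dg) auto
    show "tr (dg T - dg (S - T)) = 0" using fin finT by (simp add: tr_dg c)
  qed simp
  then show thesis by (rule that)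
qed

section \<open>Images of differences of diagonal matrix units\<close>

context pres
begin

abbreviation "F i j \<equiv> \<phi> (single i i 1 - single j j 1)"

lemma D_H0: "i < n \<Longrightarrow> j < n \<Longrightarrow> single i i 1 - single j j 1 \<in> H0 n"
  by (intro H0I) (auto simp: inM_minus)

lemma symm_D: "i < n \<Longrightarrow> j < n \<Longrightarrow> i \<noteq> j \<Longrightarrow> symm n (dg {i, j}) (single i i 1 - single j j 1)"
  using symm_blk[of i n j 1 0] by (simp add: blk_def)

lemma F_herm: "i < n \<Longrightarrow> j < n \<Longrightarrow> adjm (F i j) = F i j" by (simp add: phi_herm D_H0)
lemma F_trace: "i < n \<Longrightarrow> j < n \<Longrightarrow> tr (F i j) = 0" using closed D_H0 H0D by blast
lemma F_inM: "i < n \<Longrightarrow> j < n \<Longrightarrow> inM n (F i j)" using closed D_H0 H0D by blast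
lemma F_add: "i < n \<Longrightarrow> j < n \<Longrightarrow> l < n \<Longrightarrow> F i j + F j l = F i l"
  by (simp add: D_H0 flip: phi_add)
lemma F_swap: "i < n \<Longrightarrow> j < n \<Longrightarrow> F j i = - F i j"
  by (simp add: D_H0 flip: phi_uminus)

lemma dg_complement:
  assumes "S \<subseteq> {..<n}"
  shows "dg S * dg ({..<n} - S) = 0" "dg ({..<n} - S) * dg S = 0" "dg S + dg ({..<n} - S) = one_cm n"
proof -
  have f: "finite S" using assms finite_subset by blast
  have i: "S \<inter> ({..<n} - S) = {}" "({..<n} - S) \<inter> S = {}" "S \<union> ({..<n} - S) = {..<n}"
    using assms by auto
  show "dg S * dg ({..<n} - S) = 0" "dg ({..<n} - S) * dg S = 0" using f i by (simp_all add: dg_mult_dg)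
  show "dg S + dg ({..<n} - S) = one_cm n" using dg_Un[OF f _ i(1)] i by simp
qed

text \<open>The complement of \<open>S\<close> has even size as well, so \<open>ex_symm_dg\<close>
  provides the symmetry that \<open>same_block\<close> asks for there.\<close>

lemma same_dg_block:
  assumes S: "S \<subseteq> {..<n}" "even (card S)" and A: "symm n (dg S) A" "symm n (dg S) A'"
  shows "\<phi> A * \<phi> A = \<phi> A' * \<phi> A'"
    and "A * A' = - (A' * A) \<Longrightarrow> \<phi> A * \<phi> A' = - (\<phi> A' * \<phi> A)"
proof -
  have "even (card ({..<n} - S))" using even_n S by (simp add: card_Diff_subset finite_subset)
  then obtain R where R: "symm n (dg ({..<n} - S)) R" using ex_symm_dg[of "{..<n} - S" n] by auto
  note * = same_block[OF A R dg_complement[OF S(1)]]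
  show "\<phi> A * \<phi> A = \<phi> A' * \<phi> A'" by (rule *)
  show "A * A' = - (A' * A) \<Longrightarrow> \<phi> A * \<phi> A' = - (\<phi> A' * \<phi> A)" by (rule *)
qed

lemma disjoint_dg_blocks:
  assumes S: "S \<subseteq> {..<n}" "even (card S)" and T: "T \<subseteq> {..<n}" "even (card T)"
    and ST: "S \<inter> T = {}" and A: "symm n (dg S) A" and B: "symm n (dg T) B"
  shows "\<phi> A * \<phi> B = - (\<phi> B * \<phi> A)"
proof -
  have fin: "finite S" "finite T" using S T finite_subset by blast+
  have "even (card ({..<n} - (S \<union> T)))"
    using even_n S T ST fin by (simp add: card_Diff_subset card_Un_disjoint)
  then obtain R where R: "symm n (dg ({..<n} - (S \<union> T))) R"
    using ex_symm_dg[of "{..<n} - (S \<union> T)" n] by auto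
  have d: "S \<inter> ({..<n} - (S \<union> T)) = {}" "({..<n} - (S \<union> T)) \<inter> S = {}"
    "T \<inter> ({..<n} - (S \<union> T)) = {}" "({..<n} - (S \<union> T)) \<inter> T = {}" "T \<inter> S = {}" using ST by auto
  show ?thesis
  proof (rule anticommute_blocks[OF A B R])
    show "dg S + dg T + dg ({..<n} - (S \<union> T)) = one_cm n"
      using dg_complement(3)[of "S \<union> T"] S T dg_Un[OF fin ST] by simp
  qed (simp_all add: dg_mult_dg fin ST d)
qed

lemma blk_sq:
  assumes "i < n" "j < n" "i \<noteq> j" "d\<^sup>2 + (cmod x)\<^sup>2 = 1"
  shows "\<phi> (blk i j d x) * \<phi> (blk i j d x) = F i j * F i j"
  using assms by (intro same_dg_block(1)[of "{i, j}"]) (auto intro: symm_blk symm_D)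

lemma F_anticommute:
  assumes "i < n" "j < n" "l < n" "m < n" "distinct [i, j, l, m]"
  shows "F i j * F l m = - (F l m * F i j)"
  by (rule disjoint_dg_blocks[of "{i, j}" "{l, m}"]) (use assms in \<open>auto intro: symm_D\<close>)

text \<open>\<open>E i - E j + E l - E m\<close> and \<open>E i - E l + E j - E m\<close> are
  symmetries of one block of four indices, so their images have equal squares; inside each square
  the mixed terms cancel by anticommutation. This is the link between different pairings.\<close>

lemma F_sq_exchange:
  assumes "i < n" "j < n" "l < n" "m < n" "distinct [i, j, l, m]"
  shows "F i j * F i j + F l m * F l m = F i l * F i l + F j m * F j m"
proof -
  have *: "\<phi> (single a a 1 - single b b 1 + (single c c 1 - single d d 1))
        * \<phi> (single a a 1 - single b b 1 + (single c c 1 - single d d 1))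
      = F a b * F a b + F c d * F c d"
    if "a < n" "b < n" "c < n" "d < n" "distinct [a, b, c, d]" for a b c d
  proof -
    have "\<phi> (single a a 1 - single b b 1 + (single c c 1 - single d d 1)) = F a b + F c d"
      by (rule phi_add) (use that in \<open>simp_all add: D_H0\<close>)
    then show ?thesis using F_anticommute[OF that] by (simp only: distrib_left distrib_right) simp
  qed
  have s: "symm n (dg {i, j, l, m}) (single a a 1 - single b b 1 + (single c c 1 - single d d 1))"
    if abcd: "a < n" "b < n" "c < n" "d < n" "distinct [a, b, c, d]" "{a, b, c, d} = {i, j, l, m}" for a b c d
  proof -
    have "symm n (dg {a, b} + dg {c, d}) (single a a 1 - single b b 1 + (single c c 1 - single d d 1))"
      by (intro symm_add symm_D) (use abcd(1-5) in \<open>auto simp: dg_mult_dg\<close>)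
    moreover have "dg {a, b} + dg {c, d} = dg ({a, b} \<union> {c, d})"
      by (rule dg_Un[symmetric]) (use abcd in auto)
    moreover have "{a, b} \<union> {c, d} = {i, j, l, m}" using abcd(6) by auto
    ultimately show ?thesis by simp
  qed
  have "F i j * F i j + F l m * F l m = F i l * F i l + F j m * F j m"
    unfolding *[OF assms, symmetric]
    by (subst *[of i l j m, symmetric], use assms in simp_all)
      (rule same_dg_block(1)[of "{i, j, l, m}"], use assms in \<open>auto intro!: s\<close>)
  then show ?thesis .
qed

text \<open>All symmetries of the plane have images with the same square, so a zero at one is a zero
  at the others.\<close>

lemma F_eq_0_blk:
  assumes "i < n" "j < n" "i \<noteq> j" "F i j = 0"
  shows "\<phi> (blk i j 0 1) = 0"
  by (rule herm_sq_eq_0) (use blk_sq[of i j 0 1] assms in \<open>simp_all add: phi_herm blk_H0\<close>)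

end

section \<open>A frame with diagonal images\<close>

text \<open>A unitary of determinant 1 on the plane of \<open>j\<close> and \<open>l\<close> when
  \<open>\<alpha>\<close> and \<open>\<beta>\<close> are unimodular. Basis vector \<open>l\<close>
  goes to \<open>\<beta>\<close> times vector \<open>j\<close> plus \<open>\<alpha>\<close> times
  vector \<open>l\<close>, over \<open>sqrt 2\<close>: a turn by 45 degrees with free phases. The
  search for a frame takes both phases to be 1; \<open>f_cocycle\<close> varies them.\<close>

definition rotm :: "nat \<Rightarrow> nat \<Rightarrow> nat \<Rightarrow> complex \<Rightarrow> complex \<Rightarrow> cmat" where
  "rotm n j l \<alpha> \<beta> = dg ({..<n} - {j, l}) + (1 / sqrt 2) *\<^sub>R
    (single j l \<beta> + single l l \<alpha> + single j j (cnj \<alpha>) - single l j (cnj \<beta>))"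

context
  fixes n j l :: nat and \<alpha> \<beta> :: complex
  assumes jl: "j < n" "l < n" "j \<noteq> l" and norm: "cmod \<alpha> = 1" "cmod \<beta> = 1"
begin

lemma rotm_single:
  "rotm n j l \<alpha> \<beta> * single l b x = (1 / sqrt 2) *\<^sub>R (single j b (\<beta> * x) + single l b (\<alpha> * x))"
  "rotm n j l \<alpha> \<beta> * single j b x = (1 / sqrt 2) *\<^sub>R (single j b (cnj \<alpha> * x) - single l b (cnj \<beta> * x))"
  "a < n \<Longrightarrow> a \<noteq> j \<Longrightarrow> a \<noteq> l \<Longrightarrow> rotm n j l \<alpha> \<beta> * single a b x = single a b x"
  using jl by (simp_all add: rotm_def distrib_right left_diff_distrib scaleR_diff_right
      scaleR_add_right del: scaleR_single)

lemma inM_rotm: "inM n (rotm n j l \<alpha> \<beta>)"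
  unfolding rotm_def using jl by (intro inM_intros inM_dg inM_single) auto

lemma one_split: "one_cm n = dg ({..<n} - {j, l}) + single j j 1 + single l l 1"
proof -
  have "{..<n} = insert j (insert l ({..<n} - {j, l}))" using jl by auto
  then have "one_cm n = dg (insert j (insert l ({..<n} - {j, l})))" by (rule arg_cong)
  also have "\<dots> = single j j 1 + (single l l 1 + dg ({..<n} - {j, l}))"
    using jl by (subst dg_insert, simp, simp, subst dg_insert) auto
  finally show ?thesis by (simp add: add_ac)
qed

lemma rotm_dg: "rotm n j l \<alpha> \<beta> * dg ({..<n} - {j, l}) = dg ({..<n} - {j, l})"
  by (rule cmat_eqI) (use jl in \<open>auto simp: rotm_def\<close>)

lemma unit_rotm: "unit n (rotm n j l \<alpha> \<beta>)"
proof -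
  let ?V = "rotm n j l \<alpha> \<beta>" and ?r = "1 / sqrt 2 :: real"
  have r: "?r *\<^sub>R ?r *\<^sub>R A = (1 / 2) *\<^sub>R A" for A :: cmat by simp
  have n1: "\<alpha> * cnj \<alpha> = 1" "\<beta> * cnj \<beta> = 1" "cnj \<alpha> * \<alpha> = 1" "cnj \<beta> * \<beta> = 1"
    using norm by (simp_all add: complex_norm_square[symmetric] mult.commute[of "cnj _"] flip: of_real_power)
  have adj: "adjm ?V = dg ({..<n} - {j, l}) + ?r *\<^sub>R
      (single l j (cnj \<beta>) + single l l (cnj \<alpha>) + single j j \<alpha> - single j l \<beta>)"
    by (simp add: rotm_def del: scaleR_single)
  have "?V * adjm ?V = dg ({..<n} - {j, l}) + ?r *\<^sub>R ?r *\<^sub>R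
     ((single j j (\<beta> * cnj \<beta>) + single l j (\<alpha> * cnj \<beta>))
      + (single j l (\<beta> * cnj \<alpha>) + single l l (\<alpha> * cnj \<alpha>))
      + (single j j (cnj \<alpha> * \<alpha>) - single l j (cnj \<beta> * \<alpha>))
      - (single j l (cnj \<alpha> * \<beta>) - single l l (cnj \<beta> * \<beta>)))"
    unfolding adj distrib_left right_diff_distrib mult_scaleR_right rotm_dg rotm_single
    by (simp only: scaleR_add_right scaleR_diff_right)
  also have "\<dots> = one_cm n"
    unfolding one_split r using jl
    by (intro cmat_eqI) (auto simp: n1 mult.commute)
  finally have 1: "?V * adjm ?V = one_cm n" .
  have s: "adjm ?V * single a b x = adjm (single b a (cnj x) * ?V)" for a b x by simp
  have "adjm ?V * ?V = dg ({..<n} - {j, l}) + ?r *\<^sub>R ?r *\<^sub>R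
     (single l l (cnj \<beta> * \<beta>) - single j l (\<alpha> * 0) + single l l (cnj \<alpha> * \<alpha>)
      + single j j (\<alpha> * cnj \<alpha>) + single j j (\<beta> * cnj \<beta>)
      + (single j l (\<alpha> * \<beta>) - single j l (\<beta> * \<alpha>))
      + (single l j (cnj \<beta> * cnj \<alpha>) - single l j (cnj \<alpha> * cnj \<beta>)))"
    unfolding adj rotm_def using jl
    by (simp add: distrib_left distrib_right left_diff_distrib right_diff_distrib dg_mult_dg
        scaleR_diff_right scaleR_add_right del: scaleR_single)
  also have "\<dots> = one_cm n"
    unfolding one_split r using jl
    by (intro cmat_eqI) (auto simp: n1 mult.commute)
  finally show ?thesis using 1 by (simp add: unit_def inM_rotm)
qed

text \<open>The matrix unit is factored through the auxiliary index 0, so that the columns computed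
  in \<open>rotm_single\<close> determine both sides of the conjugation.\<close>

lemma cj_rotm_eq:
  "cj (rotm n j l \<alpha> \<beta>) (single a b x)
    = rotm n j l \<alpha> \<beta> * single a 0 1 * adjm (rotm n j l \<alpha> \<beta> * single b 0 (cnj x))"
  by (simp add: cj_def mult.assoc) (simp flip: mult.assoc)

lemma cj_rotm:
  assumes "x < n" "x \<noteq> j" "x \<noteq> l"
  shows "cj (rotm n j l \<alpha> \<beta>) (single l x y) = (1 / sqrt 2) *\<^sub>R (single j x (\<beta> * y) + single l x (\<alpha> * y))"
    and "cj (rotm n j l \<alpha> \<beta>) (single j x y) = (1 / sqrt 2) *\<^sub>R (single j x (cnj \<alpha> * y) - single l x (cnj \<beta> * y))"
    and "cj (rotm n j l \<alpha> \<beta>) (single x l y) = (1 / sqrt 2) *\<^sub>R (single x j (cnj \<beta> * y) + single x l (cnj \<alpha> * y))"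
    and "cj (rotm n j l \<alpha> \<beta>) (single x j y) = (1 / sqrt 2) *\<^sub>R (single x j (\<alpha> * y) - single x l (\<beta> * y))"
    and "z < n \<Longrightarrow> z \<noteq> j \<Longrightarrow> z \<noteq> l \<Longrightarrow> cj (rotm n j l \<alpha> \<beta>) (single x z y) = single x z y"
  unfolding cj_rotm_eq rotm_single rotm_single(3)[OF assms]
  by (simp_all add: rotm_single distrib_left distrib_right left_diff_distrib right_diff_distrib
      del: scaleR_single adjm_mult)

lemma cj_rotm_diag:
  "cj (rotm n j l \<alpha> \<beta>) (single l l 1) = (1 / 2) *\<^sub>R (single j j 1 + single l l 1 + blk j l 0 (\<beta> * cnj \<alpha>))"
  "cj (rotm n j l \<alpha> \<beta>) (single j j 1) = (1 / 2) *\<^sub>R (single j j 1 + single l l 1 - blk j l 0 (\<beta> * cnj \<alpha>))"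
proof -
  have n1: "\<alpha> * cnj \<alpha> = 1" "\<beta> * cnj \<beta> = 1" "cnj \<alpha> * \<alpha> = 1" "cnj \<beta> * \<beta> = 1"
    using norm by (simp_all add: complex_norm_square[symmetric] mult.commute[of "cnj _"] flip: of_real_power)
  have r: "(1 / sqrt 2 :: real) *\<^sub>R (1 / sqrt 2 :: real) *\<^sub>R A = (1 / 2) *\<^sub>R A" for A :: cmat
    by simp
  show "cj (rotm n j l \<alpha> \<beta>) (single l l 1) = (1 / 2) *\<^sub>R (single j j 1 + single l l 1 + blk j l 0 (\<beta> * cnj \<alpha>))"
    unfolding cj_rotm_eq rotm_single adjm_scaleR mult_scaleR_left mult_scaleR_right r
    by (rule arg_cong[of _ _ "scaleR (1 / 2)"])
      (simp add: distrib_left distrib_right blk_def n1 mult.commute)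
  show "cj (rotm n j l \<alpha> \<beta>) (single j j 1) = (1 / 2) *\<^sub>R (single j j 1 + single l l 1 - blk j l 0 (\<beta> * cnj \<alpha>))"
    unfolding cj_rotm_eq rotm_single adjm_scaleR mult_scaleR_left mult_scaleR_right r
    by (rule arg_cong[of _ _ "scaleR (1 / 2)"])
      (simp add: left_diff_distrib right_diff_distrib blk_def n1 mult.commute)
qed

end

lemma single_mult_assoc: "single i j x * (single k l y * A) = (if j = k then single i l (x * y) * A else 0)"
  by (simp flip: mult.assoc)

context pres
begin

text \<open>The pairs of a pairing are added one at a time. Images of disjoint blocks anticommute,
  so the square of the image of the sum is the sum of the squares, and the full sum is a symmetry of
  the whole space.\<close>

lemma sum_F_sq:
  assumes inj: "inj_on \<pi> {..<n}" and sub: "\<pi> ` {..<n} \<subseteq> {..<n}"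
  shows "(\<Sum>a<n div 2. F (\<pi> (2 * a)) (\<pi> (2 * a + 1)) * F (\<pi> (2 * a)) (\<pi> (2 * a + 1))) = one_cm n"
proof -
  define D where "D a = single (\<pi> (2 * a)) (\<pi> (2 * a)) 1 - single (\<pi> (2 * a + 1)) (\<pi> (2 * a + 1)) 1" for a
  have *: "symm n (dg (\<pi> ` {..<2 * m})) (\<Sum>a<m. D a) \<and>
      \<phi> (\<Sum>a<m. D a) * \<phi> (\<Sum>a<m. D a) = (\<Sum>a<m. \<phi> (D a) * \<phi> (D a))" if "m \<le> n div 2" for m
    using that
  proof (induction m)
    case 0
    then show ?case by (simp add: symm_zero)
  next
    case (Suc m)
    then have IH: "symm n (dg (\<pi> ` {..<2 * m})) (\<Sum>a<m. D a)"
      "\<phi> (\<Sum>a<m. D a) * \<phi> (\<Sum>a<m. D a) = (\<Sum>a<m. \<phi> (D a) * \<phi> (D a))" by auto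
    have m: "2 * m + 1 < n" using Suc.prems by linarith
    let ?S = "\<pi> ` {..<2 * m}" and ?T = "{\<pi> (2 * m), \<pi> (2 * m + 1)}"
    have ne: "\<pi> (2 * m) \<noteq> \<pi> (2 * m + 1)"
      using inj_on_eq_iff[OF inj, of "2 * m" "2 * m + 1"] m by simp
    have lt: "\<pi> (2 * m) < n" "\<pi> (2 * m + 1) < n"
      using subsetD[OF sub, OF imageI, of "2 * m"] subsetD[OF sub, OF imageI, of "2 * m + 1"] m by auto
    have T: "symm n (dg ?T) (D m)" unfolding D_def by (rule symm_D[OF lt ne])
    have dis: "?S \<inter> ?T = {}" using m by (auto simp: inj_on_eq_iff[OF inj])
    then have dis': "?T \<inter> ?S = {}" by blast
    have S: "?S \<subseteq> {..<n}" "even (card ?S)"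
      using subsetD[OF sub, OF imageI] m card_image[OF inj_on_subset[OF inj], of "{..<2 * m}"] by auto
    have "dg ?S * dg ?T = dg (?S \<inter> ?T)" "dg ?T * dg ?S = dg (?T \<inter> ?S)"
      by (simp_all only: dg_mult_dg finite_imageI finite_lessThan finite.emptyI finite.insertI)
    then have z: "dg ?S * dg ?T = 0" "dg ?T * dg ?S = 0" by (simp_all only: dis dis' dg_empty)
    have U: "\<pi> ` {..<2 * Suc m} = ?S \<union> ?T" by (auto simp: lessThan_Suc)
    have "symm n (dg ?S + dg ?T) ((\<Sum>a<m. D a) + D m)" by (rule symm_add[OF IH(1) T z])
    moreover have "dg (\<pi> ` {..<2 * Suc m}) = dg ?S + dg ?T"
      unfolding U using dis by (intro dg_Un) auto
    moreover have "\<phi> (\<Sum>a<m. D a) * \<phi> (D m) = - (\<phi> (D m) * \<phi> (\<Sum>a<m. D a))"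
      by (rule disjoint_dg_blocks[OF S _ _ dis IH(1) T]) (use lt ne in auto)
    moreover have "\<phi> ((\<Sum>a<m. D a) + D m) = \<phi> (\<Sum>a<m. D a) + \<phi> (D m)"
      using IH(1) T by (intro phi_add) (auto simp: symm_def)
    ultimately show ?case using IH(2) by (simp add: distrib_left distrib_right)
  qed
  have im: "\<pi> ` {..<n} = {..<n}" by (rule endo_inj_surj[OF _ sub inj]) simp
  have n2: "2 * (n div 2) = n" using even_n by simp
  have S: "symm n (one_cm n) (\<Sum>a<n div 2. D a)"
    and sq: "\<phi> (\<Sum>a<n div 2. D a) * \<phi> (\<Sum>a<n div 2. D a) = (\<Sum>a<n div 2. \<phi> (D a) * \<phi> (D a))"
    using *[OF order_refl, unfolded n2 im] by auto
  show ?thesis using symm_sq_one[OF S] unfolding sq by (simp only: D_def)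
qed

text \<open>If \<open>F a c\<close> vanished for all \<open>c\<close>, additivity would make every
  \<open>F i j\<close> vanish, against \<open>sum_F_sq\<close>.\<close>

lemma F_not_all_0:
  assumes "0 < n" "a < n"
  obtains c where "c < n" "F a c \<noteq> 0"
proof (rule ccontr)
  assume "\<not> thesis"
  then have 0: "F a c = 0" if "c < n" for c using that assms(2) \<open>\<And>c. c < n \<Longrightarrow> F a c \<noteq> 0 \<Longrightarrow> thesis\<close> by blast
  have "F i j = 0" if "i < n" "j < n" for i j
    using F_add[OF assms(2) that] 0 that by simp
  then have "(\<Sum>b<n div 2. F (id (2 * b)) (id (2 * b + 1)) * F (id (2 * b)) (id (2 * b + 1))) = 0"
    by (intro sum.neutral) auto
  then have "one_cm n = 0" using sum_F_sq[of id] by simp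
  then have "ent (one_cm n) 0 0 = ent 0 0 0" by simp
  then show False using assms(1) by simp
qed

text \<open>Turning the plane of \<open>a\<close> and \<open>c\<close> by 45 degrees destroys every zero \<open>F i j\<close> that involves
  \<open>a\<close> or \<open>c\<close>, and creates no new one.\<close>

lemma zero_after_rotation:
  assumes lt: "a < n" "b < n" "c < n" "i < n" "j < n" and ne: "a \<noteq> b" "i \<noteq> j"
    and ab: "F a b = 0" and ac: "F a c \<noteq> 0"
    and ij: "\<phi> (cj (rotm n a c 1 1) (single i i 1 - single j j 1)) = 0"
  shows "i \<noteq> a \<and> i \<noteq> c \<and> j \<noteq> a \<and> j \<noteq> c \<and> F i j = 0"
proof -
  let ?V = "rotm n a c 1 1" and ?r = "1 / sqrt 2 :: real"
  have anec: "a \<noteq> c" using ac by auto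
  have bnec: "b \<noteq> c" using ab ac by auto
  note cr = cj_rotm[OF lt(1,3) anec, of 1 1, simplified]
  note cd = cj_rotm_diag[OF lt(1,3) anec, of 1 1, simplified]
  have V: "unit n ?V" by (rule unit_rotm) (use lt anec in auto)
  interpret R: pres n "\<lambda>A. \<phi> (cj ?V A)" by (rule pres_cj_right[OF _ V]) unfold_locales
  have blkc: "cj ?V (blk c x 0 1) = ?r *\<^sub>R (blk a x 0 1 + blk c x 0 1)"
    and blka: "cj ?V (blk a x 0 1) = ?r *\<^sub>R (blk a x 0 1 - blk c x 0 1)"
    if x: "x < n" "x \<noteq> a" "x \<noteq> c" for x
    unfolding blk_def using cr[OF x]
    by (simp_all add: algebra_simps)
  \<comment> \<open>Equal squares would force \<open>F a c = 0\<close>: for \<open>x = b\<close>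
    because \<open>F c b\<close> would vanish too, otherwise by \<open>F_sq_exchange\<close>, since
    \<open>F a b = 0\<close> makes \<open>F b x\<close> and \<open>F a x\<close> equal.\<close>
  have sqne: "F a x * F a x \<noteq> F c x * F c x" if x: "x < n" "x \<noteq> a" "x \<noteq> c" for x
  proof
    assume eq: "F a x * F a x = F c x * F c x"
    show False
    proof (cases "x = b")
      case True
      then have "F c b = 0" using eq ab lt by (intro herm_sq_eq_0[OF F_herm]) auto
      then have "F a c = 0" using F_add[OF lt(1,2,3)] F_swap[OF lt(2,3)] ab by simp
      then show False using ac by simp
    next
      case False
      have "F b x = F a x" using F_add[OF lt(1,2) x(1)] ab by simp
      moreover have "F a c * F a c + F b x * F b x = F a b * F a b + F c x * F c x"
        by (rule F_sq_exchange) (use lt ne x False anec bnec in auto)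
      ultimately have "F a c * F a c = 0" using eq ab by simp
      then show False using ac lt by (auto dest: herm_sq_eq_0[OF F_herm])
    qed
  qed
  \<comment> \<open>A zero in the rotated frame also kills the flip \<open>blk y x 0 1\<close>
    there. Then \<open>blk a x 0 1\<close> and \<open>blk c x 0 1\<close> have the same image up to
    sign, hence images with equal squares, against \<open>sqne\<close>.\<close>
  have nz: "\<phi> (cj ?V (single y y 1 - single x x 1)) \<noteq> 0"
    if x: "x < n" "x \<noteq> a" "x \<noteq> c" and y: "y = a \<or> y = c" for x y
  proof
    assume "\<phi> (cj ?V (single y y 1 - single x x 1)) = 0"
    then have "\<phi> (cj ?V (blk y x 0 1)) = 0" by (rule R.F_eq_0_blk[rotated -1]) (use x y lt in auto)
    then have "\<phi> (blk a x 0 1) = \<phi> (blk c x 0 1) \<or> \<phi> (blk a x 0 1) = - \<phi> (blk c x 0 1)"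
      using y x lt by (auto simp: blka blkc phi_scaleR phi_add phi_minus H0_intros blk_H0
          eq_neg_iff_add_eq_0)
    then have "\<phi> (blk a x 0 1) * \<phi> (blk a x 0 1) = \<phi> (blk c x 0 1) * \<phi> (blk c x 0 1)" by auto
    then show False using sqne[OF x] blk_sq[of a x 0 1] blk_sq[of c x 0 1] x lt by simp
  qed
  \<comment> \<open>The rotation turns \<open>E a - E c\<close> into \<open>- blk a c 0 1\<close>,
    whose image has the same square as \<open>F a c\<close>.\<close>
  have acne: "\<phi> (cj ?V (single a a 1 - single c c 1)) \<noteq> 0"
  proof
    assume *: "\<phi> (cj ?V (single a a 1 - single c c 1)) = 0"
    have "cj ?V (single a a 1 - single c c 1) = - blk a c 0 1"
      by (simp add: cd algebra_simps) (simp flip: scaleR_add_left)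
    then have "\<phi> (blk a c 0 1) = 0" using * lt anec by (simp add: phi_uminus blk_H0)
    then have "F a c * F a c = 0" using blk_sq[of a c 0 1] lt anec by simp
    then show False using ac lt by (auto dest: herm_sq_eq_0[OF F_herm])
  qed
  have swap: "\<phi> (cj ?V (single j j 1 - single i i 1)) = 0" using R.F_swap[OF lt(4,5)] ij by simp
  have d: "i \<noteq> a" "i \<noteq> c" "j \<noteq> a" "j \<noteq> c"
    using nz[of j i] nz[of i j] acne ij swap lt ne by auto
  have "cj ?V (single i i 1 - single j j 1) = single i i 1 - single j j 1"
    using d lt by (simp add: cr)
  then show ?thesis using d ij by simp
qed

end

text \<open>A unitary with the fewest zero pairs has none: a remaining zero pair would be removed by
  the rotation of \<open>zero_after_rotation\<close>, which adds no other, and the index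
  \<open>c\<close> it requires comes from \<open>F_not_all_0\<close>.\<close>

lemma ex_good_frame:
  assumes "pres n \<phi>"
  obtains V where "unit n V"
    "\<And>i j. i < n \<Longrightarrow> j < n \<Longrightarrow> i \<noteq> j \<Longrightarrow> \<phi> (cj V (single i i 1 - single j j 1)) \<noteq> 0"
proof -
  define Z where "Z V = {(i, j). i < n \<and> j < n \<and> i \<noteq> j \<and> \<phi> (cj V (single i i 1 - single j j 1)) = 0}" for V
  have finZ: "finite (Z V)" for V
    by (rule finite_subset[of _ "{..<n} \<times> {..<n}"]) (auto simp: Z_def)
  obtain V where V: "unit n V" and min: "\<And>W. unit n W \<Longrightarrow> card (Z V) \<le> card (Z W)"
    using ex_has_least_nat[of "unit n" "one_cm n" "\<lambda>V. card (Z V)"] unit_one by blast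
  interpret pres n "\<lambda>A. \<phi> (cj V A)" by (rule pres_cj_right[OF assms V])
  have "Z V = {}"
  proof (rule ccontr)
    assume "Z V \<noteq> {}"
    then obtain a b where ab: "a < n" "b < n" "a \<noteq> b" "F a b = 0" by (auto simp: Z_def)
    obtain c where c: "c < n" "F a c \<noteq> 0" using F_not_all_0[of a] ab by auto
    have "a \<noteq> c" using c(2) phi_zero by auto
    then have R: "unit n (rotm n a c 1 1)" using ab c by (intro unit_rotm) auto
    have "Z (V * rotm n a c 1 1) \<subseteq> Z V - {(a, b)}"
      using zero_after_rotation[OF ab(1,2) c(1) _ _ ab(3) _ ab(4) c(2)]
      by (auto simp: Z_def simp flip: cj_cj)
    moreover have "(a, b) \<in> Z V" using ab by (auto simp: Z_def)
    ultimately have "Z (V * rotm n a c 1 1) \<subset> Z V" by auto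
    then have "card (Z (V * rotm n a c 1 1)) < card (Z V)" by (rule psubset_card_mono[OF finZ])
    then show False using min[OF unit_mult[OF V R]] by simp
  qed
  then show thesis using that[OF V] by (auto simp: Z_def)
qed

text \<open>Pairing the values at \<open>2 * a\<close> and \<open>2 * a + 1\<close> gives a pairing
  of all indices whose first two pairs are prescribed.\<close>

lemma ex_perm:
  assumes "i < n" "j < n" "l < n" "m < n" "distinct [i, j, l, m]"
  obtains \<pi> where "bij_betw \<pi> {..<n} {..<n}" "\<pi> 0 = i" "\<pi> 1 = j" "\<pi> 2 = l" "\<pi> (3 :: nat) = (m :: nat)"
proof -
  define xs where "xs = [i, j, l, m] @ filter (\<lambda>x. x \<notin> {i, j, l, m}) [0..<n]"
  have d: "distinct xs" using assms by (auto simp: xs_def)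
  have s: "set xs = {..<n}" using assms by (auto simp: xs_def)
  then have "length xs = n" using distinct_card[OF d] by simp
  then have "bij_betw ((!) xs) {..<n} {..<n}" using s by (intro bij_betw_nth[OF d]) auto
  then show thesis by (rule that) (simp_all add: xs_def)
qed

section \<open>Relations between the images in a frame without zeros\<close>

locale good_pres = pres +
  assumes n4: "4 \<le> n" and F_ne_0: "i < n \<Longrightarrow> j < n \<Longrightarrow> i \<noteq> j \<Longrightarrow> F i j \<noteq> 0"
begin

text \<open>The pairing given by \<open>\<pi>\<close> starts with \<open>i, j\<close> and
  \<open>l, m\<close>. The images of the Pauli matrices of a pair anticommute and share their
  square, different pairs are disjoint blocks, and \<open>F_ne_0\<close> excludes vanishing squares,
  so \<open>anticommuting_triples\<close> applies.\<close>

lemma F_sq_props: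
  assumes "i < n" "j < n" "l < n" "m < n" "distinct [i, j, l, m]"
  shows "F i j * F i j * (F l m * F l m) = 0" "proj (F i j * F i j)" "tr (F i j * F i j) = 2"
proof -
  obtain \<pi> where bij: "bij_betw \<pi> {..<n} {..<n}" and \<pi>: "\<pi> 0 = i" "\<pi> 1 = j" "\<pi> 2 = l" "\<pi> 3 = m"
    using ex_perm[OF assms] .
  have inj: "inj_on \<pi> {..<n}" and sub: "\<pi> ` {..<n} \<subseteq> {..<n}" using bij by (auto simp: bij_betw_def)
  define k where "k = n div 2"
  have nk: "n = 2 * k" using even_n by (simp add: k_def)
  \<comment> \<open>The indices 0, 1, 2 select the Pauli matrices of a pair, up to sign, with
    diagonal part \<open>cd\<close> and off-diagonal entry \<open>cx\<close>.\<close>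
  define cd where "cd i = (if i = 0 then 1 else 0 :: real)" for i :: nat
  define cx where "cx i = (if i = 0 then 0 else if i = 1 then 1 else \<i>)" for i :: nat
  have nrm: "(cd i)\<^sup>2 + (cmod (cx i))\<^sup>2 = 1" for i by (simp add: cd_def cx_def)
  define \<gamma> where "\<gamma> a i = \<phi> (blk (\<pi> (2 * a)) (\<pi> (2 * a + 1)) (cd i) (cx i))" for a i
  define p where "p a = F (\<pi> (2 * a)) (\<pi> (2 * a + 1)) * F (\<pi> (2 * a)) (\<pi> (2 * a + 1))" for a
  have idx: "\<pi> (2 * a) < n" "\<pi> (2 * a + 1) < n" "\<pi> (2 * a) \<noteq> \<pi> (2 * a + 1)" if "a < k" for a
    using subsetD[OF sub, OF imageI, of "2 * a"] subsetD[OF sub, OF imageI, of "2 * a + 1"]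
      inj_on_eq_iff[OF inj, of "2 * a" "2 * a + 1"] that nk by auto
  have anti: "\<gamma> a i * \<gamma> b j = - (\<gamma> b j * \<gamma> a i)"
    if ab: "a < k" "i < 3" "b < k" "j < 3" "(a, i) \<noteq> (b, j)" for a i b j
  proof (cases "a = b")
    case False
    show ?thesis unfolding \<gamma>_def
    proof (rule disjoint_dg_blocks[of "{\<pi> (2 * a), \<pi> (2 * a + 1)}" "{\<pi> (2 * b), \<pi> (2 * b + 1)}"])
      show "{\<pi> (2 * a), \<pi> (2 * a + 1)} \<inter> {\<pi> (2 * b), \<pi> (2 * b + 1)} = {}"
        using nk ab False by (auto simp: inj_on_eq_iff[OF inj])
    qed (use idx ab nrm in \<open>auto intro!: symm_blk\<close>)
  next
    case True
    have "blk x y (cd i) (cx i) * blk x y (cd j) (cx j) = - (blk x y (cd j) (cx j) * blk x y (cd i) (cx i))"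
      if "x \<noteq> y" for x y
      using that ab True
      by (intro cmat_eqI) (auto simp: blk_mult cd_def cx_def less_Suc_eq numeral_3_eq_3)
    then show ?thesis unfolding \<gamma>_def True
      using idx ab nrm True
      by (intro same_dg_block(2)[of "{\<pi> (2 * b), \<pi> (2 * b + 1)}"]) (auto intro!: symm_blk)
  qed
  have herm: "adjm (\<gamma> a i) = \<gamma> a i" "inM (2 * k) (\<gamma> a i)" "\<gamma> a i * \<gamma> a i = p a" if "a < k" for a i
  proof -
    have "\<gamma> a i \<in> H0 n" unfolding \<gamma>_def by (intro closed blk_H0 idx[OF that])
    then show "adjm (\<gamma> a i) = \<gamma> a i" "inM (2 * k) (\<gamma> a i)" using nk by (simp_all add: H0D)
    show "\<gamma> a i * \<gamma> a i = p a" unfolding \<gamma>_def p_def by (rule blk_sq[OF idx[OF that] nrm])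
  qed
  have sum: "(\<Sum>a<k. p a) = one_cm (2 * k)"
    using sum_F_sq[OF inj sub] by (simp add: p_def nk)
  have p0: "p a \<noteq> 0" if "a < k" for a
    using herm_sq_eq_0[OF F_herm] F_ne_0 idx[OF that] unfolding p_def by blast
  have k: "0 < k" "1 < k" using n4 nk by auto
  have p01: "p 0 = F i j * F i j" "p 1 = F l m * F l m"
    using \<pi> by (simp_all add: p_def numeral_3_eq_3)
  note facts = herm anti sum p0
  have "p 0 * p 1 = 0"
    by (rule anticommuting_triples(1)[of k \<gamma> p]) (assumption | rule facts k zero_neq_one)+
  then show "F i j * F i j * (F l m * F l m) = 0" by (simp only: p01)
  have "proj (p 0)"
    by (rule anticommuting_triples(2)[of k \<gamma> p]) (assumption | rule facts k)+
  then show "proj (F i j * F i j)" by (simp only: p01)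
  have "tr (p 0) = 2"
    by (rule anticommuting_triples(3)[of k \<gamma> p]) (assumption | rule facts k)+
  then show "tr (F i j * F i j) = 2" by (simp only: p01)
qed

text \<open>By cyclicity the squared norm of the product is the trace of the product of the two
  squares.\<close>

lemma F_mult_disjoint:
  assumes "i < n" "j < n" "l < n" "m < n" "distinct [i, j, l, m]"
  shows "F i j * F l m = 0"
proof -
  have h: "adjm (F i j) = F i j" "adjm (F l m) = F l m" using assms F_herm by auto
  have "tr (F i j * F l m * adjm (F i j * F l m)) = tr (F i j * (F l m * F l m * F i j))"
    by (simp add: h mult.assoc)
  also have "\<dots> = tr (F l m * F l m * F i j * F i j)" by (rule tr_commute)
  also have "\<dots> = tr (F l m * F l m * (F i j * F i j))" by (simp add: mult.assoc)
  also have "\<dots> = tr (F i j * F i j * (F l m * F l m))" by (rule tr_commute)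
  also have "\<dots> = 0" using F_sq_props(1)[OF assms] by simp
  finally show ?thesis using tr_mult_adjm[of "F i j * F l m"] nsq_eq_0 by simp
qed

lemma ex_index: "\<exists>m<n. m \<notin> {i, j, l}"
proof -
  have "card {i, j, l} < card {..<n}" using n4 by (auto simp: card_insert_if)
  then have "\<not> {..<n} \<subseteq> {i, j, l}" using card_mono[of "{i, j, l}" "{..<n}"] by auto
  then show ?thesis by auto
qed

text \<open>With a fourth index \<open>m\<close>, each of the three pairings of
  \<open>i, j, l, m\<close> gives products that vanish. Written in \<open>F i j\<close>,
  \<open>F j l\<close> and \<open>F l m\<close>, they yield the commutation; the last relation comes
  from the cubes of \<open>F i j\<close>, \<open>F j l\<close> and their sum
  \<open>F i l\<close>.\<close>

lemma F_rel:
  assumes i: "i < n" "j < n" "l < n" "distinct [i, j, l]"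
  shows "F i j * F j l = F j l * F i j" "F i j * F i j * F i j = F i j" "tr (F i j * F i j) = 2"
    "F i j * F i j * F j l + F i j * F j l * F j l = 0"
proof -
  obtain m where m: "m < n" "m \<notin> {i, j, l}" using ex_index by blast
  let ?a = "F i j" and ?b = "F j l" and ?c = "F l m"
  have ab: "F i l = ?a + ?b" and bc: "F j m = ?b + ?c" and abc: "F i m = ?a + ?b + ?c"
    using F_add[of i j l] F_add[of j l m] F_add[of i l m] i m by auto
  have 1: "?a * ?c = 0" "?c * ?a = 0" using F_mult_disjoint i m by auto
  \<comment> \<open>The other two pairings of the four indices, each in both orders.\<close>
  have "F i l * F j m = 0" "F j m * F i l = 0" "F i m * F j l = 0" "F j l * F i m = 0"
    by (rule F_mult_disjoint; use i m in auto)+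
  then have 2: "?a * ?b + ?b * ?b + ?b * ?c = 0" "?a * ?b + ?b * ?b + ?c * ?b = 0"
    "?b * ?a + ?b * ?b + ?c * ?b = 0" "?b * ?a + ?b * ?b + ?b * ?c = 0"
    unfolding ab bc abc using 1 by (simp_all add: algebra_simps)
  have "?a * ?b + (?b * ?b + ?b * ?c) = ?b * ?a + (?b * ?b + ?b * ?c)"
    using 2(1,4) by (simp add: add.assoc)
  then show comm: "?a * ?b = ?b * ?a" by (simp only: add_right_cancel)
  have cube: "F x y * F x y * F x y = F x y"
    if "x < n" "y < n" "x \<noteq> y" "{x, y} \<subseteq> {i, j, l}" for x y
  proof -
    have "\<exists>z\<in>{i, j, l}. z \<noteq> x \<and> z \<noteq> y" using i that by auto
    then obtain z where z: "z < n" "z \<noteq> x" "z \<noteq> y" "z \<noteq> m" using i m by blast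
    have "proj (F x y * F x y)"
      by (rule F_sq_props(2)[of x y z m]) (use that z m in auto)
    then show ?thesis using that by (intro herm_cube F_herm) auto
  qed
  show ca: "?a * ?a * ?a = ?a" using cube i by auto
  have cb: "?b * ?b * ?b = ?b" using cube i by auto
  \<comment> \<open>\<open>?a + ?b\<close> is \<open>F i l\<close>, so its cube is known as well;
    expanding it isolates three copies of the mixed terms.\<close>
  have cab: "(?a + ?b) * (?a + ?b) * (?a + ?b) = ?a + ?b" using cube[of i l] i unfolding ab by auto
  show "tr (?a * ?a) = 2" by (rule F_sq_props(3)[of i j l m]) (use i m in auto)
  have comm': "?b * (?a * x) = ?a * (?b * x)" for x
    using comm by (simp flip: mult.assoc)
  have "?b * ?a * ?a = ?a * ?a * ?b" "?b * ?a * ?b = ?a * ?b * ?b" "?b * ?b * ?a = ?a * ?b * ?b"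
    "?a * ?b * ?a = ?a * ?a * ?b"
    by (simp_all add: mult.assoc comm' comm[symmetric])
  then have "(?a + ?b) * (?a + ?b) * (?a + ?b) = ?a * ?a * ?a + ?b * ?b * ?b
      + ((?a * ?a * ?b + ?a * ?b * ?b) + (?a * ?a * ?b + ?a * ?b * ?b) + (?a * ?a * ?b + ?a * ?b * ?b))"
    by (simp only: distrib_left distrib_right) (simp only: add_ac)
  then have "(?a * ?a * ?b + ?a * ?b * ?b) + (?a * ?a * ?b + ?a * ?b * ?b) + (?a * ?a * ?b + ?a * ?b * ?b) = 0"
    unfolding cab ca cb by simp
  then have "3 *\<^sub>R (?a * ?a * ?b + ?a * ?b * ?b) = 0"
    using scaleR_left_distrib[of 1 2 "?a * ?a * ?b + ?a * ?b * ?b"] by (simp add: scaleR_2 add_ac)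
  then show "?a * ?a * ?b + ?a * ?b * ?b = 0" by simp
qed

text \<open>If \<open>F i j = H i - H j\<close> for orthogonal projections, then \<open>H j = - (F i j * F j l)\<close>; this
  formula serves as the definition of \<open>H\<close>.\<close>

lemma ex_diagonal_projections:
  obtains H where "\<And>j. j < n \<Longrightarrow> proj (H j)" "\<And>j. j < n \<Longrightarrow> inM n (H j)" "\<And>j. j < n \<Longrightarrow> tr (H j) = 1"
    "\<And>i j. i < n \<Longrightarrow> j < n \<Longrightarrow> i \<noteq> j \<Longrightarrow> H i * H j = 0"
    "\<And>i j. i < n \<Longrightarrow> j < n \<Longrightarrow> i \<noteq> j \<Longrightarrow> F i j * F i j = H i + H j"
    "\<And>i j. i < n \<Longrightarrow> j < n \<Longrightarrow> i \<noteq> j \<Longrightarrow> F i j * H i = H i * F i j"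
proof -
  define K where "K i j l = - (F i j * F j l)" for i j l
  have Kl: "K i j l = K i j m" if "i < n" "j < n" "l < n" "m < n" "distinct [i, j, l, m]" for i j l m
    using F_mult_disjoint[of i j m l] F_add[of j m l] that
    by (simp add: K_def distrib_left flip: F_add[of j m l])
  have Ks: "K i j l = K l j i" if "i < n" "j < n" "l < n" "distinct [i, j, l]" for i j l
    using F_rel(1)[OF that] F_swap[of i j] F_swap[of j l] that by (simp add: K_def)
  \<comment> \<open>The outer indices are replaced one at a time, with \<open>Ks\<close>
    interchanging them in between; the case distinctions avoid a repeated index on the way.\<close>
  have K: "K i j l = K i' j l'" if "i < n" "j < n" "l < n" "i' < n" "l' < n"
    "distinct [i, j, l]" "distinct [i', j, l']" for i j l i' l'
  proof (cases "i' = l")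
    case True
    have "K i j l = K l j i" using Ks that by blast
    also have "\<dots> = K l j l'" using Kl[of l j i l'] that True by (cases "i = l'") auto
    finally show ?thesis using True by simp
  next
    case False
    have "K i j l = K l j i" using Ks that by blast
    also have "\<dots> = K l j i'" using Kl[of l j i i'] that False by (cases "i = i'") auto
    also have "\<dots> = K i' j l" using Ks[of l j i'] that False by auto
    also have "\<dots> = K i' j l'" using Kl[of i' j l l'] that False by (cases "l = l'") auto
    finally show ?thesis .
  qed
  have "\<exists>H. \<forall>j<n. \<forall>i<n. \<forall>l<n. distinct [i, j, l] \<longrightarrow> H j = K i j l"
  proof -
    have "\<forall>j. \<exists>h. j < n \<longrightarrow> (\<forall>i<n. \<forall>l<n. distinct [i, j, l] \<longrightarrow> h = K i j l)"
    proof
      fix j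
      obtain a where a: "a < n" "a \<notin> {j, j, j}" using ex_index by blast
      obtain b where b: "b < n" "b \<notin> {j, a, a}" using ex_index by blast
      show "\<exists>h. j < n \<longrightarrow> (\<forall>i<n. \<forall>l<n. distinct [i, j, l] \<longrightarrow> h = K i j l)"
      proof (intro exI[of _ "K a j b"] impI allI)
        fix i l assume "j < n" "i < n" "l < n" "distinct [i, j, l]"
        then show "K a j b = K i j l" by (intro K) (use a b in auto)
      qed
    qed
    from choice[OF this] show ?thesis by blast
  qed
  then obtain H where H: "\<And>i j l. i < n \<Longrightarrow> j < n \<Longrightarrow> l < n \<Longrightarrow> distinct [i, j, l] \<Longrightarrow> H j = - (F i j * F j l)"
    unfolding K_def by blast
  have core: "H j * H j = H j" "adjm (H j) = H j" "inM n (H j)" "F i j * F i j = H i + H j"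
    "H i * H j = 0" "F i j * H i = H i * F i j"
    if ijl: "i < n" "j < n" "l < n" "distinct [i, j, l]" for i j l
  proof -
    let ?a = "F i j" and ?b = "F j l"
    have il: "F i l = ?a + ?b" and ji: "F j i = - ?a"
      using F_add[OF ijl(1-3)] F_swap[OF ijl(1,2)] by simp_all
    have comm: "?a * ?b = ?b * ?a" and ca: "?a * ?a * ?a = ?a"
      and q: "?a * ?a * ?b + ?a * ?b * ?b = 0" using F_rel[OF ijl] by auto
    have cb: "?b * ?b * ?b = ?b" using F_rel(2)[of j l i] ijl by auto
    have Hj: "H j = - (?a * ?b)" using H[OF ijl] .
    \<comment> \<open>The defining formula with outer indices \<open>j\<close> and \<open>l\<close>,
      rewritten through \<open>F j i = - ?a\<close> and \<open>F i l = ?a + ?b\<close>. All that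
      follows is computed in the commuting pair \<open>?a\<close>, \<open>?b\<close>.\<close>
    have Hi: "H i = ?a * ?a + ?a * ?b" using H[of j i l] ijl unfolding il ji by (simp add: distrib_left)
    have q': "?a * ?a * ?b = - (?a * ?b * ?b)" using q by (simp add: eq_neg_iff_add_eq_0)
    have aabb: "?a * ?a * ?b * ?b = - (?a * ?b)"
    proof -
      have "?a * ?a * ?b * ?b = - (?a * (?b * ?b * ?b))" unfolding q' by (simp add: mult.assoc)
      then show ?thesis by (simp add: cb)
    qed
    have abab: "?a * ?b * (?a * ?b) = ?a * ?a * ?b * ?b" by (metis comm mult.assoc)
    show "H j * H j = H j" by (simp add: Hj abab aabb)
    show "adjm (H j) = H j" using F_herm ijl by (simp add: Hj comm)
    show "inM n (H j)" using F_inM ijl unfolding Hj by (metis inM_mult inM_minus inM_zero diff_0)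
    show "?a * ?a = H i + H j" by (simp add: Hi Hj)
    have "?a * ?a * (?a * ?b) = ?a * ?b" by (metis ca mult.assoc)
    then show "H i * H j = 0" by (simp add: Hi Hj distrib_right abab aabb)
    show "?a * H i = H i * ?a"
      unfolding Hi by (simp add: distrib_left distrib_right mult.assoc comm[symmetric])
  qed
  have ex_l: "\<exists>l<n. distinct [i, j, l]" if "i \<noteq> j" for i j
    using ex_index[of i j j] that by auto
  have ex_il: "\<exists>i<n. \<exists>l<n. distinct [i, j, l]" for j
  proof -
    obtain i where "i < n" "i \<noteq> j" using ex_index[of j j j] by auto
    then show ?thesis using ex_l[of i j] by blast
  qed
  have Htr: "tr (H i) + tr (H j) = 2" if ij: "i < n" "j < n" "i \<noteq> j" for i j
  proof -
    obtain l where l: "l < n" "distinct [i, j, l]" using ex_l[OF ij(3)] by blast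
    show ?thesis using core(4)[OF ij(1,2) l] F_rel(3)[OF ij(1,2) l] by simp
  qed
  show thesis
  proof (rule that)
    fix j assume j: "j < n"
    obtain i l where il: "i < n" "l < n" "distinct [i, j, l]" using ex_il by blast
    show "proj (H j)" "inM n (H j)" using core(1-3)[OF il(1) j il(2,3)] by (auto simp: proj_def)
    \<comment> \<open>Three numbers whose pairwise sums are all 2 are equal to 1.\<close>
    have "tr (H i) + tr (H j) = 2" "tr (H j) + tr (H l) = 2" "tr (H i) + tr (H l) = 2"
      using Htr il j by auto
    then show "tr (H j) = 1" by (simp add: complex_eq_iff)
  next
    fix i j assume ij: "i < n" "j < n" "i \<noteq> j"
    obtain l where l: "l < n" "distinct [i, j, l]" using ex_l[OF ij(3)] by blast
    show "H i * H j = 0" "F i j * F i j = H i + H j" "F i j * H i = H i * F i j"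
      using core(4-6)[OF ij(1,2) l] by auto
  qed
qed

end

text \<open>By \<open>proj_rank_one\<close> a projection of trace 1 is a normalised column of itself
  times its adjoint. These unit vectors are the columns of \<open>V\<close>; they are orthonormal
  since the projections are orthogonal, and complete by the trace.\<close>

lemma ex_frame_of_projections:
  assumes pr: "\<And>j. j < n \<Longrightarrow> proj (H j)" "\<And>j. j < n \<Longrightarrow> inM n (H j)" "\<And>j. j < n \<Longrightarrow> tr (H j) = 1"
    and orth: "\<And>i j. i < n \<Longrightarrow> j < n \<Longrightarrow> i \<noteq> j \<Longrightarrow> H i * H j = 0"
  obtains V where "unit n V" "\<And>j. j < n \<Longrightarrow> cj V (single j j 1) = H j"
proof -
  have "\<exists>c r. 0 < r \<and> ent (H j) c c = of_real r \<and> H j = (1 / r) *\<^sub>R (H j * single c c 1 * H j)"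
    if j: "j < n" for j
  proof -
    have "H j \<noteq> 0" using pr(3)[OF j] by auto
    from proj_rank_one[OF pr(1)[OF j] this] pr(3)[OF j] show ?thesis by metis
  qed
  then obtain c r where cr: "\<And>j. j < n \<Longrightarrow> 0 < r j" "\<And>j. j < n \<Longrightarrow> ent (H j) (c j) (c j) = of_real (r j)"
    "\<And>j. j < n \<Longrightarrow> H j = (1 / r j) *\<^sub>R (H j * single (c j) (c j) 1 * H j)" by metis
  have cn: "c j < n" if "j < n" for j
  proof -
    have "ent (H j) (c j) (c j) \<noteq> 0" using cr(1,2)[OF that] by simp
    then show ?thesis using pr(2)[OF that] unfolding inM_def by blast
  qed
  \<comment> \<open>Column \<open>c j\<close> of the projection \<open>H j\<close> has squared
    length \<open>r j\<close>, so this factor normalises it.\<close>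
  define x where "x j = complex_of_real (1 / sqrt (r j))" for j
  have xx: "x j * x j = of_real (1 / r j)" "cnj (x j) = x j" if "j < n" for j
    using cr(1)[OF that] by (simp_all add: x_def flip: of_real_mult)
  have HH: "H j * H j = H j" "adjm (H j) = H j" if "j < n" for j using pr(1)[OF that] by (auto simp: proj_def)
  define V where "V = (\<Sum>j<n. H j * single (c j) j (x j))"
  have VM: "inM n V" unfolding V_def by (intro inM_sum inM_mult pr inM_single cn) auto
  have Vs: "V * single j b y = H j * single (c j) b (x j * y)" if "j < n" for j b y
  proof -
    have "V * single j b y = (\<Sum>l<n. if l = j then H j * single (c j) b (x j * y) else 0)"
      unfolding V_def sum_distrib_right by (intro sum.cong refl) (simp add: mult.assoc)
    then show ?thesis using that by simp
  qed
  have cjV: "cj V (single j j 1) = H j" if j: "j < n" for j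
  proof -
    have "cj V (single j j 1) = V * single j j 1 * adjm (V * single j j 1)"
      by (simp add: cj_def mult.assoc single_mult_assoc)
    also have "\<dots> = H j * single (c j) (c j) (x j * x j) * H j"
      using HH[OF j] xx[OF j] by (simp add: Vs[OF j] mult.assoc single_mult_assoc)
    also have "single (c j) (c j) (x j * x j) = (1 / r j) *\<^sub>R single (c j) (c j) 1"
      unfolding xx(1)[OF j] by simp
    also have "H j * ((1 / r j) *\<^sub>R single (c j) (c j) 1) * H j = H j" 
      using cr(3)[OF j] by (simp only: mult_scaleR_left mult_scaleR_right)
    finally show ?thesis .
  qed
  note one = one_cm_eq_sum[of n]
  \<comment> \<open>The identity minus the sum is a projection of trace \<open>n - n\<close>, hence
    zero.\<close>
  have sumH: "(\<Sum>j<n. H j) = one_cm n"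
  proof -
    let ?S = "\<Sum>j<n. H j"
    have HS: "H i * ?S = H i" if "i < n" for i
    proof -
      have "H i * ?S = (\<Sum>j<n. if j = i then H i else 0)"
        unfolding sum_distrib_left using orth HH that by (intro sum.cong refl) auto
      then show ?thesis using that by simp
    qed
    have "?S * ?S = ?S" by (simp add: sum_distrib_right HS)
    moreover have "adjm ?S = ?S" by (simp add: adjm_sum HH)
    ultimately have S: "proj ?S" by (simp add: proj_def)
    have SM: "inM n ?S" by (intro inM_sum pr) auto
    have "proj (one_cm n - ?S)"
      by (rule proj_diff[OF proj_dg S]) (use SM in \<open>auto simp: one_mult mult_one\<close>)
    moreover have "tr (one_cm n - ?S) = 0" by (simp add: tr_dg pr)
    ultimately have "nsq (one_cm n - ?S) = 0" using proj_tr by force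
    then show ?thesis by (simp add: nsq_eq_0)
  qed
  have "V * adjm V = cj V (one_cm n)" using VM by (simp add: cj_def mult_one)
  also have "\<dots> = (\<Sum>j<n. cj V (single j j 1))" unfolding one by (simp add: cj_def sum_distrib_left sum_distrib_right)
  also have "\<dots> = one_cm n" using cjV sumH by simp
  finally have 1: "V * adjm V = one_cm n" .
  have "adjm V * V = (\<Sum>j<n. adjm V * (H j * single (c j) j (x j)))" by (simp add: V_def sum_distrib_left)
  also have "\<dots> = (\<Sum>j<n. single j j 1)"
  proof (intro sum.cong refl)
    fix j assume "j \<in> {..<n}"
    then have j: "j < n" by simp
    have "adjm V * (H j * single (c j) j (x j)) = (\<Sum>l<n. single l (c l) (cnj (x l)) * H l * (H j * single (c j) j (x j)))"
      by (simp add: V_def adjm_sum sum_distrib_right HH)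
    also have "\<dots> = (\<Sum>l<n. if l = j then single j (c j) (x j) * H j * single (c j) j (x j) else 0)"
    proof (intro sum.cong refl)
      fix l assume "l \<in> {..<n}"
      then have l: "l < n" by simp
      have "H l * (H j * single (c j) j (x j)) = (if l = j then H j * single (c j) j (x j) else 0)"
        using orth[OF l j] HH[OF j] by (auto simp flip: mult.assoc)
      then show "single l (c l) (cnj (x l)) * H l * (H j * single (c j) j (x j))
        = (if l = j then single j (c j) (x j) * H j * single (c j) j (x j) else 0)"
        using xx[OF j] by (auto simp: mult.assoc)
    qed
    also have "\<dots> = single j (c j) (x j) * H j * single (c j) j (x j)" using j by simp
    also have "\<dots> = single j j (x j * x j * of_real (r j))"
      unfolding ent_single_mult_single cr(2)[OF j] by (simp add: mult_ac)
    also have "x j * x j * of_real (r j) = 1"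
      unfolding xx(1)[OF j] using cr(1)[OF j] by (simp flip: of_real_mult)
    finally show "adjm V * (H j * single (c j) j (x j)) = single j j 1" .
  qed
  finally have "adjm V * V = one_cm n" unfolding one .
  then have "unit n V" using 1 VM by (simp add: unit_def)
  then show thesis using cjV by (rule that)
qed

section \<open>The off-diagonal part\<close>

lemma two_by_two:
  assumes ij: "i \<noteq> j" and row: "\<And>a b. a \<noteq> i \<Longrightarrow> a \<noteq> j \<Longrightarrow> ent G a b = 0"
    and col: "\<And>a b. b \<noteq> i \<Longrightarrow> b \<noteq> j \<Longrightarrow> ent G a b = 0"
  shows "G = single i i (ent G i i) + single i j (ent G i j) + single j i (ent G j i) + single j j (ent G j j)"
proof (rule cmat_eqI)
  fix a b
  show "ent G a b = ent (single i i (ent G i i) + single i j (ent G i j) + single j i (ent G j i) + single j j (ent G j j)) a b"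
    using ij by (cases "a = i"; cases "a = j"; cases "b = i"; cases "b = j") (simp_all add: row col)
qed

text \<open>\<open>G\<close> equals its cube and so is supported where its square is. Commuting with
  one diagonal unit removes the off-diagonal entries, the square leaves signs on the diagonal, and
  the trace makes them opposite.\<close>

lemma signed_diagonal:
  assumes ij: "i \<noteq> j" and sq: "G * G = single i i 1 + single j j 1" and h: "adjm G = G"
    and comm: "G * single i i 1 = single i i 1 * G" and tr: "tr G = 0"
  shows "\<exists>x. (x = 1 \<or> x = - 1) \<and> G = x *\<^sub>R (single i i 1 - single j j 1)"
proof -
  have E: "G * G = dg {i, j}" using sq ij by (simp add: dg_pair)
  have cube: "G * G * G = G" by (rule herm_cube[OF h]) (simp add: E proj_dg)
  have row: "ent G a b = 0" if "a \<noteq> i" "a \<noteq> j" for a b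
    using arg_cong[OF cube, of "\<lambda>A. ent A a b"] that unfolding E by simp
  have herm: "ent G a b = cnj (ent G b a)" for a b by (metis h ent_adjm)
  have col: "ent G a b = 0" if "b \<noteq> i" "b \<noteq> j" for a b
    using row[OF that, of a] herm[of a b] by simp
  have "ent (G * dg {i}) j i = ent (dg {i} * G) j i" using comm by (simp add: dg_singleton)
  then have "ent G j i = 0" using ij by simp
  moreover from this have "ent G i j = 0" using herm[of i j] by simp
  ultimately have G: "G = single i i (ent G i i) + single j j (ent G j j)"
    using two_by_two[OF ij row col] by simp
  have "ent (G * G) i i = ent G i i * ent G i i"
    by (subst (1 2) G) (use ij in \<open>simp add: distrib_left distrib_right\<close>)
  then have "(ent G i i)\<^sup>2 = 1" unfolding E by (simp add: power2_eq_square)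
  then have x: "ent G i i = 1 \<or> ent G i i = - 1" by (simp add: power2_eq_1_iff)
  have "tr G = ent G i i + ent G j j" by (subst G) simp
  then have y: "ent G j j = - ent G i i" using tr by (simp add: add_eq_0_iff)
  from x show ?thesis
  proof
    assume "ent G i i = 1"
    then have "G = 1 *\<^sub>R (single i i 1 - single j j 1)"
      using G y by (simp add: single_uminus)
    then show ?thesis by blast
  next
    assume "ent G i i = - 1"
    then have "G = (- 1) *\<^sub>R (single i i 1 - single j j 1)"
      using G y by (simp add: single_uminus)
    then show ?thesis by blast
  qed
qed

text \<open>A unitary that diagonalises the projections from \<open>ex_diagonal_projections\<close>
  turns each image into \<open>E i - E j\<close> up to a sign, and additivity makes that sign
  independent of \<open>i\<close> and \<open>j\<close>.\<close>

lemma ex_diagonal_normal_form: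
  assumes "pres n \<phi>"
  shows "\<exists>V W s. unit n V \<and> unit n W \<and> (s = 1 \<or> s = - 1) \<and>
    (\<forall>i<n. \<forall>j<n. s *\<^sub>R cj W (\<phi> (cj V (single i i 1 - single j j 1))) = single i i 1 - single j j 1)"
proof -
  have "even n" using assms by (simp add: pres_def)
  then have "n = 0 \<or> n = 2 \<or> 4 \<le> n" by presburger
  then consider "n = 0" | "n = 2" | "4 \<le> n" by blast
  then show ?thesis
  proof cases
    case 1
    then show ?thesis using unit_one by blast
  next
    case 2
    interpret pres n \<phi> by fact
    let ?F = "F 0 1"
    have 01: "0 < n" "1 < n" using 2 by auto
    have one: "one_cm n = dg {0, 1}" using 2 by (intro cmat_eqI) (auto simp: less_2_cases_iff)
    have FF: "?F * ?F = one_cm n"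
      using symm_sq_one symm_D[OF 01] one by simp
    have oF: "one_cm n * ?F = ?F" "?F * one_cm n = ?F"
      using F_inM[OF 01] by (simp_all only: one_mult mult_one)
    have oo: "one_cm n * one_cm n = one_cm n" by (simp add: dg_mult_dg)
    \<comment> \<open>In two dimensions the image of \<open>E 0 - E 1\<close> is itself a symmetry
      of the whole space, and its eigenprojections are the frame.\<close>
    define H where "H j = (if j = 0 then (1/2) *\<^sub>R (one_cm n + ?F) else (1/2) *\<^sub>R (one_cm n - ?F))" for j :: nat
    obtain W where W: "unit n W" "\<And>j. j < n \<Longrightarrow> cj W (single j j 1) = H j"
    proof (rule ex_frame_of_projections)
      fix j
      have "proj ((1/2) *\<^sub>R (one_cm n + ?F))" "proj ((1/2) *\<^sub>R (one_cm n - ?F))"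
        unfolding proj_def adjm_scaleR adjm_add adjm_minus adjm_dg F_herm[OF 01]
        by (simp_all only: mult_scaleR_left mult_scaleR_right distrib_left distrib_right
            left_diff_distrib right_diff_distrib oF FF oo scaleR_scaleR)
          (simp_all add: algebra_simps flip: scaleR_add_left)
      then show "proj (H j)" by (simp add: H_def)
      show "inM n (H j)"
        unfolding H_def using F_inM[OF 01] by (auto intro!: inM_scaleR inM_add inM_minus)
      show "tr (H j) = 1" using F_trace[OF 01] 2 by (simp add: H_def tr_dg)
    next
      fix i j assume "i < n" "j < n" "i \<noteq> j"
      moreover have "(one_cm n + ?F) * (one_cm n - ?F) = 0" "(one_cm n - ?F) * (one_cm n + ?F) = 0"
        by (simp_all only: distrib_left distrib_right left_diff_distrib right_diff_distrib oF FF oo)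
          simp_all
      ultimately show "H i * H j = 0" by (auto simp: H_def 2 less_2_cases_iff)
    qed blast
    have "?F = H 0 - H 1" by (simp add: H_def flip: scaleR_diff_right)
    also have "\<dots> = cj W (single 0 0 1 - single 1 1 1)" using W(2)[OF 01(1)] W(2)[OF 01(2)] by simp
    finally have F01: "cj (adjm W) ?F = single 0 0 1 - single 1 1 1"
      using cj_inverse(2)[OF W(1), of "single 0 0 1 - single 1 1 1"] 01 by (simp add: inM_minus)
    then have F10: "cj (adjm W) (F 1 0) = single 1 1 1 - single 0 0 1"
      using F_swap[OF 01] cj_scaleR[of "adjm W" "- 1" ?F] by simp
    have "1 *\<^sub>R cj (adjm W) (\<phi> (cj (one_cm n) (single i i 1 - single j j 1))) = single i i 1 - single j j 1"
      if "i < n" "j < n" for i j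
    proof -
      have "cj (one_cm n) (single i i 1 - single j j 1) = single i i 1 - single j j 1"
        using that by (simp add: cj_def algebra_simps)
      then show ?thesis using F01 F10 that 2 by (auto simp: less_2_cases_iff)
    qed
    then show ?thesis using unit_one unit_adjm[OF W(1)] by blast
  next
    case 3
    obtain V where V: "unit n V"
      and ne: "\<And>i j. i < n \<Longrightarrow> j < n \<Longrightarrow> i \<noteq> j \<Longrightarrow> \<phi> (cj V (single i i 1 - single j j 1)) \<noteq> 0"
      using ex_good_frame[OF assms] by blast
    interpret pres n "\<lambda>A. \<phi> (cj V A)" by (rule pres_cj_right[OF assms V])
    interpret good_pres n "\<lambda>A. \<phi> (cj V A)" by unfold_locales (use 3 ne in auto)
    obtain H where H: "\<And>j. j < n \<Longrightarrow> proj (H j)" "\<And>j. j < n \<Longrightarrow> inM n (H j)" "\<And>j. j < n \<Longrightarrow> tr (H j) = 1"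
      "\<And>i j. i < n \<Longrightarrow> j < n \<Longrightarrow> i \<noteq> j \<Longrightarrow> H i * H j = 0"
      and HF: "\<And>i j. i < n \<Longrightarrow> j < n \<Longrightarrow> i \<noteq> j \<Longrightarrow> F i j * F i j = H i + H j"
      "\<And>i j. i < n \<Longrightarrow> j < n \<Longrightarrow> i \<noteq> j \<Longrightarrow> F i j * H i = H i * F i j"
      using ex_diagonal_projections by blast
    obtain U where U: "unit n U" "\<And>j. j < n \<Longrightarrow> cj U (single j j 1) = H j"
      using ex_frame_of_projections[of n H] H by blast
    let ?W = "adjm U"
    have W: "unit n ?W" by (rule unit_adjm[OF U(1)])
    have WH: "cj ?W (H j) = single j j 1" if "j < n" for j
      using cj_inverse(2)[OF U(1), of "single j j 1"] U(2)[OF that] that by simp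
    define G where "G i j = cj ?W (F i j)" for i j
    have "\<exists>x. (x = 1 \<or> x = - 1) \<and> G i j = x *\<^sub>R (single i i 1 - single j j 1)"
      if ij: "i < n" "j < n" "i \<noteq> j" for i j
    proof (rule signed_diagonal[OF ij(3)])
      show "G i j * G i j = single i i 1 + single j j 1"
        using HF(1)[OF ij] F_inM[OF ij(1,2)] WH ij by (simp add: G_def cj_mult[OF W])
      show "adjm (G i j) = G i j" using F_herm[OF ij(1,2)] by (simp add: G_def)
      show "G i j * single i i 1 = single i i 1 * G i j"
        using HF(2)[OF ij] F_inM[OF ij(1,2)] H(2)[OF ij(1)] ij
        by (simp add: G_def cj_mult[OF W] flip: WH)
      show "tr (G i j) = 0" using F_trace[OF ij(1,2)] F_inM[OF ij(1,2)] by (simp add: G_def cj_tr[OF W])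
    qed
    then obtain x where x: "\<And>i j. i < n \<Longrightarrow> j < n \<Longrightarrow> i \<noteq> j \<Longrightarrow> x i j = 1 \<or> x i j = (- 1 :: real)"
      "\<And>i j. i < n \<Longrightarrow> j < n \<Longrightarrow> i \<noteq> j \<Longrightarrow> G i j = x i j *\<^sub>R (single i i 1 - single j j 1)" by metis
    \<comment> \<open>In the entry at \<open>i, i\<close> of \<open>G i j + G j l = G i l\<close>
      the summand \<open>G j l\<close> does not contribute.\<close>
    have row: "x i j = x i l" if "i < n" "j < n" "l < n" "distinct [i, j, l]" for i j l
    proof -
      have "G i j + G j l = G i l" using F_add[of i j l] that by (simp add: G_def flip: cj_add)
      then have "ent (G i j + G j l) i i = ent (G i l) i i" by simp
      then show ?thesis using that by (simp add: x(2))
    qed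
    have sym: "x j i = x i j" if "i < n" "j < n" "i \<noteq> j" for i j
    proof -
      have "G j i = - G i j" using F_swap[of i j] cj_scaleR[of ?W "- 1" "F i j"] that by (simp add: G_def)
      then have "ent (G j i) i i = ent (- G i j) i i" by simp
      then show ?thesis using that by (simp add: x(2))
    qed
    have n01: "0 < n" "1 < n" using 3 by auto
    have const: "x i j = x 0 1" if ij: "i < n" "j < n" "i \<noteq> j" for i j
    proof -
      have 0: "x 0 l = x 0 1" if "l < n" "l \<noteq> 0" for l
        using row[of 0 l 1] that n01 by (cases "l = 1") auto
      show ?thesis
      proof (cases "i = 0")
        case True
        then show ?thesis using 0[of j] ij by simp
      next
        case False
        have "x i j = x i 0" using row[of i j 0] ij n01 False by (cases "j = 0") auto
        also have "\<dots> = x 0 i" using sym[of 0 i] ij n01 False by simp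
        finally show ?thesis using 0[of i] ij False by simp
      qed
    qed
    have s: "x 0 1 = 1 \<or> x 0 1 = - 1" using x(1) n01 by simp
    have "x 0 1 *\<^sub>R cj ?W (F i j) = single i i 1 - single j j 1" if "i < n" "j < n" for i j
    proof (cases "i = j")
      case True
      then show ?thesis using phi_zero by simp
    next
      case False
      then have "cj ?W (F i j) = x 0 1 *\<^sub>R (single i i 1 - single j j 1)"
        using x(2)[OF that] const[OF that] by (simp add: G_def)
      then show ?thesis using s by auto
    qed
    then show ?thesis using V W s by blast
  qed
qed

section \<open>Action on the off-diagonal entries\<close>

locale normal_pres = pres +
  assumes F_eq: "i < n \<Longrightarrow> j < n \<Longrightarrow> F i j = single i i 1 - single j j 1"
begin

text \<open>One entry suffices: \<open>f_polar\<close> shows that the image of a flip of the plane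
  of \<open>i\<close> and \<open>j\<close> is a flip of the same plane.\<close>

definition f :: "nat \<Rightarrow> nat \<Rightarrow> complex \<Rightarrow> complex" where
  "f i j x = ent (\<phi> (blk i j 0 x)) i j"

lemma f_add: "i < n \<Longrightarrow> j < n \<Longrightarrow> i \<noteq> j \<Longrightarrow> f i j (x + y) = f i j x + f i j y"
  using blk_add[of i j 0 x 0 y] phi_add[OF blk_H0 blk_H0, of i j i j 0 x 0 y] by (simp add: f_def)

lemma f_scaleR: "i < n \<Longrightarrow> j < n \<Longrightarrow> i \<noteq> j \<Longrightarrow> f i j (of_real r * x) = of_real r * f i j x"
  using blk_scaleR[of r i j 0 x] phi_scaleR[OF blk_H0, of i j r 0 x] by (simp add: f_def)

lemma blk_swap: "blk j i 0 (cnj x) = blk i j 0 x" by (simp add: blk_def)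

text \<open>The square of the image is that of \<open>E i - E j\<close>, which confines the image to
  the plane; anticommuting with \<open>E i - E j\<close> clears its diagonal, and the square then
  gives the modulus 1.\<close>

lemma f_unit:
  assumes ij: "i < n" "j < n" "i \<noteq> j" and x: "cmod x = 1"
  shows "\<phi> (blk i j 0 x) = blk i j 0 (f i j x)" "cmod (f i j x) = 1"
proof -
  let ?X = "\<phi> (blk i j 0 x)" and ?D = "single i i 1 - single j j 1"
  have XX: "?X * ?X = dg {i, j}"
  proof -
    have "?X * ?X = F i j * F i j" by (rule blk_sq[OF ij]) (use x in simp)
    then show ?thesis using symm_D[OF ij] F_eq[OF ij(1,2)] by (simp add: symm_def)
  qed
  have h: "adjm ?X = ?X" by (rule phi_herm[OF blk_H0[OF ij]])
  have cube: "?X * ?X * ?X = ?X" by (rule herm_cube[OF h]) (simp add: XX proj_dg)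
  have row: "ent ?X a b = 0" if "a \<noteq> i" "a \<noteq> j" for a b
    using arg_cong[OF cube, of "\<lambda>A. ent A a b"] that unfolding XX by simp
  have herm: "ent ?X a b = cnj (ent ?X b a)" for a b by (metis h ent_adjm)
  have col: "ent ?X a b = 0" if "b \<noteq> i" "b \<noteq> j" for a b
    using row[OF that, of a] herm[of a b] by simp
  have "?X * F i j = - (F i j * ?X)"
  proof (rule same_dg_block(2)[of "{i, j}"])
    have "blk i j 0 x * blk i j 1 0 = - (blk i j 1 0 * blk i j 0 x)"
      using ij by (simp add: blk_mult single_uminus)
    then show "blk i j 0 x * ?D = - (?D * blk i j 0 x)" by (simp add: blk_def)
  qed (use ij x in \<open>auto intro!: symm_blk symm_D\<close>)
  then have anti: "?X * (dg {i} - dg {j}) = - ((dg {i} - dg {j}) * ?X)"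
    using F_eq[OF ij(1,2)] by (simp add: dg_singleton)
  have "ent (?X * (dg {i} - dg {j})) a a = ent (- ((dg {i} - dg {j}) * ?X)) a a" for a
    by (simp only: anti)
  from this[of i] this[of j] have diag: "ent ?X i i = 0" "ent ?X j j = 0"
    using ij(3) by (simp_all add: left_diff_distrib right_diff_distrib eq_neg_iff_add_eq_0)
  show X: "?X = blk i j 0 (f i j x)"
    using two_by_two[OF ij(3) row col] diag herm[of j i] unfolding f_def by (simp add: blk_def)
  have "ent (blk i j 0 (f i j x) * blk i j 0 (f i j x)) i i = 1" using XX ij(3) by (simp flip: X)
  then have "f i j x * cnj (f i j x) = 1" using ij(3) by (simp add: blk_mult)
  then have "complex_of_real ((cmod (f i j x))\<^sup>2) = of_real 1"
    by (simp add: complex_norm_square del: of_real_power)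
  then have "(cmod (f i j x))\<^sup>2 = 1" by (simp only: of_real_eq_iff)
  then show "cmod (f i j x) = 1" using norm_ge_zero[of "f i j x"] by (auto simp: power2_eq_1_iff)
qed

lemma f_polar:
  assumes ij: "i < n" "j < n" "i \<noteq> j"
  shows "\<phi> (blk i j 0 x) = blk i j 0 (f i j x)" "cmod (f i j x) = cmod x"
proof -
  \<comment> \<open>The value 1 at \<open>x = 0\<close> keeps \<open>u\<close> unimodular, where
    \<open>sgn\<close> would be 0.\<close>
  define u where "u = (if x = 0 then 1 else sgn x)"
  have u: "cmod u = 1" "x = of_real (cmod x) * u"
    by (simp add: u_def norm_sgn) (simp add: u_def sgn_eq)
  have "blk i j 0 x = cmod x *\<^sub>R blk i j 0 u" using u(2) by (simp add: blk_scaleR)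
  then have "\<phi> (blk i j 0 x) = cmod x *\<^sub>R blk i j 0 (f i j u)"
    using phi_scaleR[OF blk_H0[OF ij]] f_unit(1)[OF ij u(1)] by simp
  moreover have fx: "f i j x = of_real (cmod x) * f i j u"
    using f_scaleR[OF ij, of "cmod x" u] u(2) by simp
  ultimately show "\<phi> (blk i j 0 x) = blk i j 0 (f i j x)" by (simp add: blk_scaleR)
  show "cmod (f i j x) = cmod x" using f_unit(2)[OF ij u(1)] by (simp add: fx norm_mult)
qed

lemma f_swap: "i < n \<Longrightarrow> j < n \<Longrightarrow> i \<noteq> j \<Longrightarrow> f j i (cnj x) = cnj (f i j x)"
  unfolding f_def[of j i] blk_swap by (simp add: f_polar(1)) (simp add: blk_def)

text \<open>After a turn in the plane of \<open>j\<close> and \<open>l\<close>, the symmetries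
  \<open>E i - E l\<close> and \<open>blk i l 0 1\<close> still anticommute, and so do their images.
  Both turned matrices are combinations of ones with known images, and the entry at
  \<open>i, j\<close> of the anticommutation is the identity.\<close>

lemma f_cocycle:
  assumes ijl: "i < n" "j < n" "l < n" "distinct [i, j, l]" and ab: "cmod a = 1" "cmod b = 1"
  shows "f i j (a * b) = f i l a * f l j b"
proof -
  \<comment> \<open>The turned flip has the entries \<open>cnj \<beta>\<close> at
    \<open>i, j\<close> and \<open>cnj \<alpha>\<close> at \<open>i, l\<close>. The phases are
    chosen to make these \<open>a * b\<close> and \<open>a\<close>, and then
    \<open>\<beta> * cnj \<alpha>\<close> is \<open>cnj b\<close>.\<close>
  define \<alpha> where "\<alpha> = cnj a"
  define \<beta> where "\<beta> = cnj (a * b)"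
  have norm: "cmod \<alpha> = 1" "cmod \<beta> = 1" using ab by (simp_all add: \<alpha>_def \<beta>_def norm_mult)
  have d: "i \<noteq> j" "i \<noteq> l" "j \<noteq> l" "j \<noteq> i" "l \<noteq> i" "l \<noteq> j" using ijl by auto
  let ?R = "rotm n j l \<alpha> \<beta>" and ?r = "1 / sqrt 2 :: real"
  have R: "unit n ?R" by (rule unit_rotm) (use ijl norm in auto)
  note cr = cj_rotm[OF ijl(2,3) d(3) norm ijl(1) d(1,2)] and cd = cj_rotm_diag[OF ijl(2,3) d(3) norm]
  interpret R: pres n "\<lambda>A. \<phi> (cj ?R A)" by (rule pres_cj_right[OF _ R]) unfold_locales
  have "\<beta> * cnj \<alpha> = cnj b"
    using ab(1) by (simp add: \<alpha>_def \<beta>_def complex_norm_square[symmetric] mult.commute)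
  then have "cj ?R (single i i 1 - single l l 1)
      = (1 / 2) *\<^sub>R (single i i 1 - single j j 1) + (1 / 2) *\<^sub>R (single i i 1 - single l l 1) - (1 / 2) *\<^sub>R blk j l 0 (cnj b)"
    using cr(5)[OF ijl(1) d(1,2), of 1] cd
    by (simp add: algebra_simps del: scaleR_single) (simp flip: scaleR_add_left add: add.assoc[symmetric] del: scaleR_single)
  then have Z: "\<phi> (cj ?R (single i i 1 - single l l 1))
      = (1 / 2) *\<^sub>R (single i i 1 - single j j 1) + (1 / 2) *\<^sub>R (single i i 1 - single l l 1) - (1 / 2) *\<^sub>R blk j l 0 (f j l (cnj b))"
    using F_eq f_polar(1)[OF ijl(2,3) d(3)] ijl
    by (simp add: phi_minus phi_add phi_scaleR H0_intros D_H0 blk_H0 del: scaleR_single)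
  have "cj ?R (blk i l 0 1) = ?r *\<^sub>R (blk i j 0 (cnj \<beta>) + blk i l 0 (cnj \<alpha>))"
    unfolding blk_def using cr by (simp add: algebra_simps)
  then have X: "\<phi> (cj ?R (blk i l 0 1)) = ?r *\<^sub>R (blk i j 0 (f i j (a * b)) + blk i l 0 (f i l a))"
    using f_polar(1)[OF ijl(1,2) d(1)] f_polar(1)[OF ijl(1,3) d(2)] ijl
    by (simp add: phi_scaleR phi_add H0_intros blk_H0 \<alpha>_def \<beta>_def)
  let ?Z = "(1 / 2) *\<^sub>R (single i i 1 - single j j 1) + (1 / 2) *\<^sub>R (single i i 1 - single l l 1) - (1 / 2) *\<^sub>R blk j l 0 (f j l (cnj b))"
  let ?X = "blk i j 0 (f i j (a * b)) + blk i l 0 (f i l a)"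
  have "\<phi> (cj ?R (single i i 1 - single l l 1)) * \<phi> (cj ?R (blk i l 0 1))
      = - (\<phi> (cj ?R (blk i l 0 1)) * \<phi> (cj ?R (single i i 1 - single l l 1)))"
  proof (rule R.same_dg_block(2)[of "{i, l}"])
    have "blk i l 1 0 * blk i l 0 1 = - (blk i l 0 1 * blk i l 1 0)"
      using d by (simp add: blk_mult single_uminus)
    then show "(single i i 1 - single l l 1) * blk i l 0 1 = - (blk i l 0 1 * (single i i 1 - single l l 1))"
      by (simp add: blk_def)
  qed (use ijl in \<open>auto intro!: symm_blk symm_D\<close>)
  then have "?r *\<^sub>R (?Z * ?X) = ?r *\<^sub>R (- (?X * ?Z))" unfolding Z X by simp
  then have "?Z * ?X = - (?X * ?Z)" unfolding scaleR_cancel_left by simp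
  then have "ent (?Z * ?X) i j = ent (- (?X * ?Z)) i j" by simp
  moreover have 1: "ent (?Z * ?X) i j = f i j (a * b)"
    using d by (simp add: blk_def algebra_simps)
  moreover have 2: "ent (?X * ?Z) i j = - f i j (a * b) / 2 - f i l a * cnj (f j l (cnj b)) / 2"
    using d by (simp add: blk_def algebra_simps)
  ultimately have "f i j (a * b) = - (- f i j (a * b) / 2 - f i l a * cnj (f j l (cnj b)) / 2)"
    unfolding ent_uminus 1 2 by blast
  then have "f i j (a * b) = f i l a * cnj (f j l (cnj b))" by (simp add: field_simps)
  then show ?thesis using f_swap[OF ijl(2,3) d(3), of "cnj b"] by simp
qed

text \<open>Dividing by the phases \<open>d i * cnj (d j)\<close> leaves real linear isometries
  \<open>h i j\<close> that fix 1. Each is the identity or the conjugation, according to its value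
  at \<open>\<i>\<close>, and the cocycle identity makes the choice the same for all pairs.\<close>

lemma ex_phases:
  obtains d :: "nat \<Rightarrow> complex" and g where "\<And>i. cmod (d i) = 1" "g = (\<lambda>x. x) \<or> g = cnj"
    "\<And>i j x. i < n \<Longrightarrow> j < n \<Longrightarrow> i \<noteq> j \<Longrightarrow> f i j x = d i * g x * cnj (d j)"
proof -
  \<comment> \<open>Index 0 is the base point; there, and outside the range, the value 1 keeps
    \<open>d\<close> unimodular.\<close>
  define d where "d i = (if i = 0 \<or> n \<le> i then 1 else f i 0 1)" for i
  have nd: "cmod (d i) = 1" for i
    using f_unit(2)[of i 0 1] by (auto simp: d_def)
  have dd: "d i * cnj (d i) = 1" "cnj (d i) * d i = 1" for i
    using nd[of i] by (simp_all add: complex_norm_square[symmetric] mult.commute[of "cnj _"] flip: of_real_power)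
  have f1: "f i j 1 = d i * cnj (d j)" if ij: "i < n" "j < n" "i \<noteq> j" for i j
  proof (cases "i = 0 \<or> j = 0")
    case True
    then show ?thesis using ij f_swap[of j 0 1] by (auto simp: d_def)
  next
    case False
    then show ?thesis using ij f_cocycle[of i j 0 1 1] f_swap[of j 0 1] by (simp add: d_def)
  qed
  define h where "h i j x = cnj (d i) * f i j x * d j" for i j x
  have fh: "f i j x = d i * h i j x * cnj (d j)" for i j x
  proof -
    have "d i * h i j x * cnj (d j) = (d i * cnj (d i)) * f i j x * (d j * cnj (d j))"
      by (simp add: h_def)
    then show ?thesis by (simp add: dd)
  qed
  have h1: "h i j 1 = 1" if "i < n" "j < n" "i \<noteq> j" for i j
  proof -
    have "h i j 1 = (cnj (d i) * d i) * (cnj (d j) * d j)" by (simp add: h_def f1[OF that])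
    then show ?thesis by (simp add: dd)
  qed
  \<comment> \<open>The moduli of \<open>h i j \<i>\<close> and \<open>1 + h i j \<i>\<close> are
    those of \<open>\<i>\<close> and \<open>1 + \<i>\<close>, which forces real part 0.\<close>
  have hi: "h i j \<i> = \<i> \<or> h i j \<i> = - \<i>" if ij: "i < n" "j < n" "i \<noteq> j" for i j
  proof -
    have n1: "cmod (h i j \<i>) = 1" using f_unit(2)[OF ij, of \<i>] nd by (simp add: h_def norm_mult)
    have "h i j (1 + \<i>) = h i j 1 + h i j \<i>" by (simp add: h_def f_add[OF ij] algebra_simps)
    moreover have "cmod (h i j (1 + \<i>)) = cmod (1 + \<i>)"
      using f_polar(2)[OF ij, of "1 + \<i>"] nd by (simp add: h_def norm_mult)
    ultimately have "cmod (1 + h i j \<i>) = cmod (1 + \<i>)" by (simp add: h1[OF ij])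
    then have "(1 + Re (h i j \<i>))\<^sup>2 + (Im (h i j \<i>))\<^sup>2 = 2"
      by (simp add: cmod_def power2_eq_square)
    moreover have "(Re (h i j \<i>))\<^sup>2 + (Im (h i j \<i>))\<^sup>2 = 1"
      using n1 by (simp add: cmod_def)
    ultimately have "Re (h i j \<i>) = 0" by (simp add: power2_eq_square algebra_simps)
    moreover from this have "Im (h i j \<i>) = 1 \<or> Im (h i j \<i>) = - 1"
      using \<open>(Re (h i j \<i>))\<^sup>2 + (Im (h i j \<i>))\<^sup>2 = 1\<close> by (simp add: power2_eq_1_iff)
    ultimately show ?thesis by (auto simp: complex_eq_iff)
  qed
  have hx: "h i j x = of_real (Re x) + of_real (Im x) * h i j \<i>" if ij: "i < n" "j < n" "i \<noteq> j" for i j x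
  proof -
    have "f i j x = f i j (of_real (Re x) * 1 + of_real (Im x) * \<i>)"
      by (simp add: complex_eq[of x, symmetric] mult.commute)
    also have "\<dots> = of_real (Re x) * f i j 1 + of_real (Im x) * f i j \<i>"
      by (simp only: f_add[OF ij] f_scaleR[OF ij])
    finally have "h i j x = of_real (Re x) * h i j 1 + of_real (Im x) * h i j \<i>"
      by (simp add: h_def algebra_simps)
    then show ?thesis by (simp add: h1[OF ij])
  qed
  \<comment> \<open>The cocycle identity at \<open>\<i>\<close> and 1: the second factor is a pure
    phase, which the normalisation removes.\<close>
  have row: "h i j \<i> = h i l \<i>" if "i < n" "j < n" "l < n" "distinct [i, j, l]" for i j l
  proof -
    have "f i j \<i> = f i l \<i> * f l j 1" using f_cocycle[OF that, of \<i> 1] by simp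
    then have "h i j \<i> = cnj (d i) * f i l \<i> * d l * (cnj (d j) * d j)"
      using f1[of l j] that by (simp add: h_def)
    then show ?thesis by (simp add: dd h_def)
  qed
  have sym: "h j i \<i> = h i j \<i>" if ij: "i < n" "j < n" "i \<noteq> j" for i j
  proof -
    have "f i j (- \<i>) = - f i j \<i>" using f_scaleR[OF ij, of "- 1" \<i>] by simp
    then have "h j i \<i> = - cnj (h i j \<i>)" using f_swap[OF ij, of "- \<i>"] by (simp add: h_def)
    then show ?thesis using hi[OF ij] by auto
  qed
  have const: "h i j \<i> = h 0 1 \<i>" if ij: "i < n" "j < n" "i \<noteq> j" for i j
  proof -
    have n01: "0 < n" "1 < n" using ij by auto
    have 0: "h 0 l \<i> = h 0 1 \<i>" if "l < n" "l \<noteq> 0" for l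
      using row[of 0 l 1] that n01 by (cases "l = 1") auto
    show ?thesis
    proof (cases "i = 0")
      case True
      then show ?thesis using 0[of j] ij by simp
    next
      case False
      have "h i j \<i> = h i 0 \<i>" using row[of i j 0] ij n01 False by (cases "j = 0") auto
      also have "\<dots> = h 0 i \<i>" using sym[of 0 i] ij n01 False by simp
      finally show ?thesis using 0[of i] ij False by simp
    qed
  qed
  define g where "g = (if h 0 1 \<i> = \<i> then (\<lambda>x. x) else cnj)"
  have hg: "h i j x = g x" if ij: "i < n" "j < n" "i \<noteq> j" for i j x
    using hx[OF ij, of x] hi[OF ij] const[OF ij] by (auto simp: g_def complex_eq_iff)
  show thesis
  proof (rule that[of d g])
    show "g = (\<lambda>x. x) \<or> g = cnj" by (auto simp: g_def)
    show "f i j x = d i * g x * cnj (d j)" if "i < n" "j < n" "i \<noteq> j" for i j x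
      using fh[of i j x] hg[OF that, of x] by simp
  qed (rule nd)
qed

end

section \<open>Reconstruction of the map from diagonal differences and flips\<close>

lemma cj_sum: "cj U (sum f S) = (\<Sum>x\<in>S. cj U (f x))"
  by (induction S rule: infinite_finite_induct) auto

lemma conjm_sum: "conjm (sum f S) = (\<Sum>x\<in>S. conjm (f x))"
  by (rule cmat_eqI) simp

lemma inM_eq_sum_single:
  assumes "inM n A"
  shows "A = (\<Sum>i<n. \<Sum>j<n. single i j (ent A i j))"
proof (rule cmat_eqI)
  fix a b
  have "ent (\<Sum>i<n. \<Sum>j<n. single i j (ent A i j)) a b
      = (\<Sum>i<n. if i = a then \<Sum>j<n. if j = b then ent A a b else 0 else 0)"
    unfolding ent_sum by (intro sum.cong refl) auto
  also have "\<dots> = ent A a b" using assms by (auto simp: inM_def)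
  finally show "ent A a b = ent (\<Sum>i<n. \<Sum>j<n. single i j (ent A i j)) a b" by simp
qed

text \<open>The subtracted multiples of \<open>single 0 0 1\<close> add up to the trace, which is 0.
  Each off-diagonal pair occurs in both orders, whence the factor 1/2.\<close>

lemma H0_eq_sum:
  assumes A: "A \<in> H0 n"
  shows "A = (\<Sum>i<n. \<Sum>j<n. if i = j then Re (ent A i i) *\<^sub>R (single i i 1 - single 0 0 1)
    else (1 / 2) *\<^sub>R blk i j 0 (ent A i j))" (is "A = ?S")
proof -
  have herm: "ent A j i = cnj (ent A i j)" for i j using H0D(2)[OF A] by (metis ent_adjm)
  have re: "ent A i i = of_real (Re (ent A i i))" for i
    using herm[of i i] by (simp add: complex_eq_iff)
  have "(if i = j then Re (ent A i i) *\<^sub>R (single i i 1 - single 0 0 1) else (1 / 2) *\<^sub>R blk i j 0 (ent A i j))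
      = (1 / 2) *\<^sub>R (single i j (ent A i j) + adjm (single i j (ent A i j)))
        - (if i = j then Re (ent A i i) *\<^sub>R single 0 0 1 else 0)" for i j
  proof (cases "i = j")
    case True
    have "(1 / 2) *\<^sub>R (single i i (ent A i i) + adjm (single i i (ent A i i))) = Re (ent A i i) *\<^sub>R single i i 1"
      using herm[of i i] re[of i] by (simp flip: single_add)
    then show ?thesis using True by (simp add: scaleR_diff_right del: scaleR_single adjm_single)
  qed (simp add: blk_def)
  then have "?S = (\<Sum>i<n. \<Sum>j<n. (1 / 2) *\<^sub>R (single i j (ent A i j) + adjm (single i j (ent A i j)))
        - (if i = j then Re (ent A i i) *\<^sub>R single 0 0 1 else 0))" by simp
  also have "\<dots> = (1 / 2) *\<^sub>R ((\<Sum>i<n. \<Sum>j<n. single i j (ent A i j)) + adjm (\<Sum>i<n. \<Sum>j<n. single i j (ent A i j)))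
      - (\<Sum>i<n. Re (ent A i i) *\<^sub>R single 0 0 1)"
    unfolding sum_subtractf by (simp add: sum.distrib adjm_sum scaleR_right.sum scaleR_add_right
        del: scaleR_single adjm_single)
  also have "\<dots> = (1 / 2) *\<^sub>R (A + A) - (\<Sum>i<n. Re (ent A i i)) *\<^sub>R single 0 0 1"
    unfolding inM_eq_sum_single[OF H0D(1)[OF A], symmetric] H0D(2)[OF A]
    by (simp add: scaleR_left.sum del: scaleR_single)
  also have "(\<Sum>i<n. Re (ent A i i)) = Re (tr A)"
  proof -
    have "tr A = (\<Sum>i<n. ent A i i)"
      by (rule tr_eq_sum) (use H0D(1)[OF A] in \<open>auto simp: inM_def\<close>)
    then show ?thesis by simp
  qed
  finally show ?thesis using H0D(3)[OF A] by (simp flip: scaleR_2)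
qed

context normal_pres
begin

text \<open>The diagonal of \<open>U\<close> consists of the phases \<open>d i\<close>. The
  candidate selected by \<open>g\<close> is real linear and agrees with \<open>\<phi>\<close> on the
  matrices occurring in \<open>H0_eq_sum\<close>.\<close>

lemma ex_diagonal_unitary:
  "\<exists>U. unit n U \<and> ((\<forall>A\<in>H0 n. \<phi> A = cj U A) \<or> (\<forall>A\<in>H0 n. \<phi> A = cj U (conjm A)))"
proof -
  obtain d g where d: "\<And>i. cmod (d i) = 1" and g: "g = (\<lambda>x. x) \<or> g = cnj"
    and f: "\<And>i j x. i < n \<Longrightarrow> j < n \<Longrightarrow> i \<noteq> j \<Longrightarrow> f i j x = d i * g x * cnj (d j)"
    using ex_phases by blast
  define U where "U = (\<Sum>i<n. single i i (d i))"
  have dd: "d i * cnj (d i) = 1" for i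
    using d[of i] by (simp add: complex_norm_square[symmetric])
  have Us: "U * single i j x = single i j (d i * x)" if "i < n" for i j x
  proof -
    have "U * single i j x = (\<Sum>l<n. if l = i then single i j (d i * x) else 0)"
      unfolding U_def sum_distrib_right by (intro sum.cong refl) simp
    then show ?thesis using that by simp
  qed
  have cjs: "cj U (single i j x) = single i j (d i * x * cnj (d j))" if "i < n" "j < n" for i j x
  proof -
    have "cj U (single i j x) = single i j (d i * x) * adjm U" using Us[OF that(1)] by (simp add: cj_def)
    also have "\<dots> = adjm (U * single j i (cnj (d i * x)))" by simp
    also have "\<dots> = single i j (d i * x * cnj (d j))" unfolding Us[OF that(2)] by (simp add: mult_ac)
    finally show ?thesis .
  qed
  note one = one_cm_eq_sum[of n]
  have UM: "inM n U" unfolding U_def by (intro inM_sum) auto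
  have aU: "adjm U = (\<Sum>i<n. single i i (cnj (d i)))" by (simp add: U_def adjm_sum)
  have "U * adjm U = (\<Sum>i<n. single i i 1)"
    unfolding aU sum_distrib_left by (intro sum.cong refl) (simp add: Us dd)
  moreover have "adjm U * U = (\<Sum>i<n. single i i 1)"
  proof -
    have "adjm U * single i i (d i) = single i i 1" if "i < n" for i
    proof -
      have "adjm U * single i i (d i) = (\<Sum>l<n. if l = i then single i i 1 else 0)"
        unfolding aU sum_distrib_right by (intro sum.cong refl) (simp add: dd mult.commute[of "cnj _"])
      then show ?thesis using that by simp
    qed
    then show ?thesis by (subst (2) U_def) (simp add: sum_distrib_left)
  qed
  ultimately have U: "unit n U" using UM by (simp add: unit_def one)
  \<comment> \<open>Stated for any \<open>\<theta>\<close> so that it covers both candidates; only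
    real scalars are pulled out, as conjugation demands.\<close>
  have lin: "\<phi> A = \<theta> A"
    if D: "\<And>i j. i < n \<Longrightarrow> j < n \<Longrightarrow> \<theta> (single i i 1 - single j j 1) = single i i 1 - single j j 1"
      and B: "\<And>i j x. i < n \<Longrightarrow> j < n \<Longrightarrow> i \<noteq> j \<Longrightarrow> \<theta> (blk i j 0 x) = blk i j 0 (f i j x)"
      and sc: "\<And>r X. \<theta> (r *\<^sub>R X) = r *\<^sub>R \<theta> X"
      and sm: "\<And>S (h :: nat \<Rightarrow> cmat). \<theta> (sum h S) = (\<Sum>x\<in>S. \<theta> (h x))"
      and A: "A \<in> H0 n" for \<theta> A
  proof -
    let ?T = "\<lambda>i j. if i = j then Re (ent A i i) *\<^sub>R (single i i 1 - single 0 0 1)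
      else (1 / 2) *\<^sub>R blk i j 0 (ent A i j)"
    have T: "?T i j \<in> H0 n" if "i < n" "j < n" for i j
      using that by (auto intro!: H0_scaleR D_H0 blk_H0)
    have "\<phi> (?T i j) = \<theta> (?T i j)" if "i < n" "j < n" for i j
    proof (cases "i = j")
      case True
      then show ?thesis
        using that D[of i 0] F_eq[of i 0] phi_scaleR[OF D_H0, of i 0] by (simp add: sc del: scaleR_single)
    next
      case False
      then show ?thesis
        using that B[of i j] f_polar(1)[of i j] phi_scaleR[OF blk_H0, of i j] by (simp add: sc)
    qed
    then have "(\<Sum>i<n. \<Sum>j<n. \<phi> (?T i j)) = (\<Sum>i<n. \<Sum>j<n. \<theta> (?T i j))"
      by (intro sum.cong refl) auto
    moreover have "\<phi> (\<Sum>i<n. \<Sum>j<n. ?T i j) = (\<Sum>i<n. \<Sum>j<n. \<phi> (?T i j))"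
      using T by (subst phi_sum) (auto intro!: H0_sum sum.cong phi_sum)
    ultimately have "\<phi> (\<Sum>i<n. \<Sum>j<n. ?T i j) = \<theta> (\<Sum>i<n. \<Sum>j<n. ?T i j)"
      by (simp only: sm)
    then show ?thesis unfolding H0_eq_sum[OF A, symmetric] .
  qed
  from g show ?thesis
  proof
    assume g: "g = (\<lambda>x. x)"
    have "\<phi> A = cj U A" if "A \<in> H0 n" for A
    proof (rule lin[OF _ _ _ _ that])
      fix i j x assume ij: "i < n" "j < n"
      show "cj U (single i i 1 - single j j 1) = single i i 1 - single j j 1"
        using ij by (simp add: cjs dd)
      show "cj U (blk i j 0 x) = blk i j 0 (f i j x)" if "i \<noteq> j"
        using ij that by (simp add: blk_def cjs f g mult_ac)
    qed (simp_all add: cj_sum)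
    then show ?thesis using U by blast
  next
    assume g: "g = cnj"
    have "\<phi> A = cj U (conjm A)" if "A \<in> H0 n" for A
    proof (rule lin[OF _ _ _ _ that])
      fix i j x assume ij: "i < n" "j < n"
      show "cj U (conjm (single i i 1 - single j j 1)) = single i i 1 - single j j 1"
        using ij by (simp add: cjs dd)
      show "cj U (conjm (blk i j 0 x)) = blk i j 0 (f i j x)" if "i \<noteq> j"
        using ij that by (simp add: blk_def cjs f g mult_ac)
    qed (simp_all add: cj_sum conjm_sum)
    then show ?thesis using U by blast
  qed
qed

end

text \<open>Entrywise conjugation negates the imaginary Pauli matrix and fixes the other two;
  conjugating by that Pauli matrix, which up to the factor \<open>\<i>\<close> is the one used here,
  does the opposite.\<close>

lemma conjm_two:
  assumes "A \<in> H0 2"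
  shows "conjm A = - cj (single 0 1 1 - single 1 0 1) A"
proof -
  have A: "inM 2 A" "adjm A = A" "tr A = 0" using H0D[OF assms] by auto
  have herm: "ent A i j = cnj (ent A j i)" for i j using A(2) by (metis ent_adjm)
  have "tr A = (\<Sum>i<2. ent A i i)"
    by (rule tr_eq_sum) (use A(1) in \<open>auto simp: inM_def\<close>)
  then have t: "ent A 1 1 = - ent A 0 0" using A(3) by (simp add: numeral_2_eq_2 add_eq_0_iff)
  have out: "ent A a b = 0" if "a \<noteq> 0 \<and> a \<noteq> 1 \<or> b \<noteq> 0 \<and> b \<noteq> 1" for a b
    using A(1) that by (force simp: inM_def less_2_cases_iff)
  have "A = single 0 0 (ent A 0 0) + single 0 1 (ent A 0 1) + single 1 0 (ent A 1 0) + single 1 1 (ent A 1 1)"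
    by (rule two_by_two) (use out in auto)
  then have A': "A = single 0 0 (ent A 0 0) + single 0 1 (ent A 0 1) + single 1 0 (cnj (ent A 0 1)) + single 1 1 (- ent A 0 0)"
    using t herm[of 1 0] by simp
  have r: "cnj (ent A 0 0) = ent A 0 0" using herm[of 0 0] by simp
  show "conjm A = - cj (single 0 1 1 - single 1 0 1) A"
    by (subst (1 2) A')
      (simp add: cj_def r distrib_left distrib_right left_diff_distrib right_diff_distrib single_uminus)
qed

lemma unit_two: "unit 2 (single 0 1 1 - single 1 0 1)"
proof -
  have "one_cm 2 = single 0 0 1 + single 1 1 1"
    by (rule cmat_eqI) (auto simp: less_2_cases_iff)
  then show ?thesis
    by (simp add: unit_def inM_minus left_diff_distrib right_diff_distrib add.commute)
qed

text \<open>Undoing the frame changes multiplies unitaries and, in the conjugate form, conjugates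
  the right-hand one. For \<open>n\<close> below 4 the conjugate form is rewritten as the first: at
  \<open>n = 2\<close> by \<open>conjm_two\<close>, which costs a sign, at \<open>n = 0\<close>
  because \<open>H0 n\<close> is trivial.\<close>

theorem pres_classification:
  assumes "pres n \<phi>"
  shows "\<exists>U s. unit n U \<and> (s = 1 \<or> s = - 1) \<and> ((\<forall>A\<in>H0 n. \<phi> A = s *\<^sub>R cj U A)
    \<or> 4 \<le> n \<and> (\<forall>A\<in>H0 n. \<phi> A = s *\<^sub>R cj U (conjm A)))"
proof -
  obtain V W s where V: "unit n V" and W: "unit n W" and s: "s = 1 \<or> s = (- 1 :: real)"
    and F: "\<forall>i<n. \<forall>j<n. s *\<^sub>R cj W (\<phi> (cj V (single i i 1 - single j j 1))) = single i i 1 - single j j 1"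
    using ex_diagonal_normal_form[OF assms] by blast
  interpret P: pres n \<phi> by fact
  interpret Q: pres n "\<lambda>A. s *\<^sub>R cj W (\<phi> (cj V A))"
    by (rule pres_cj_left[OF pres_cj_right[OF assms V] W s])
  interpret N: normal_pres n "\<lambda>A. s *\<^sub>R cj W (\<phi> (cj V A))"
    by unfold_locales (use F in auto)
  obtain D where D: "unit n D" and alt: "(\<forall>A\<in>H0 n. s *\<^sub>R cj W (\<phi> (cj V A)) = cj D A)
      \<or> (\<forall>A\<in>H0 n. s *\<^sub>R cj W (\<phi> (cj V A)) = cj D (conjm A))"
    using N.ex_diagonal_unitary by blast
  have ss: "s * s = 1" using s by auto
  have undo: "\<phi> A = s *\<^sub>R cj (adjm W) (s *\<^sub>R cj W (\<phi> (cj V (cj (adjm V) A))))"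
    and VA: "cj (adjm V) A \<in> H0 n" if A: "A \<in> H0 n" for A
    using A W V cj_inverse[OF V H0D(1)[OF A]] cj_inverse[OF W H0D(1)[OF P.closed[OF A]]]
    by (simp_all add: ss cj_H0 unit_adjm)
  from alt show ?thesis
  proof
    assume *: "\<forall>A\<in>H0 n. s *\<^sub>R cj W (\<phi> (cj V A)) = cj D A"
    have "\<phi> A = s *\<^sub>R cj (adjm W * D * adjm V) A" if A: "A \<in> H0 n" for A
      using undo[OF A, unfolded bspec[OF * VA[OF A]]] by (simp add: cj_cj mult.assoc)
    moreover have "unit n (adjm W * D * adjm V)" by (intro unit_mult unit_adjm V W D)
    ultimately show ?thesis using s by blast
  next
    assume *: "\<forall>A\<in>H0 n. s *\<^sub>R cj W (\<phi> (cj V A)) = cj D (conjm A)"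
    let ?U = "adjm W * D * conjm (adjm V)"
    have eq: "\<phi> A = s *\<^sub>R cj ?U (conjm A)" if A: "A \<in> H0 n" for A
      using undo[OF A, unfolded bspec[OF * VA[OF A]]] by (simp add: cj_cj cj_conjm mult.assoc)
    have U: "unit n ?U" by (intro unit_mult unit_conjm unit_adjm V W D)
    have "n = 0 \<or> n = 2 \<or> 4 \<le> n" using P.even_n by presburger
    then consider "n = 0" | "n = 2" | "4 \<le> n" by blast
    then show ?thesis
    proof cases
      case 1
      have "A = 0" if "A \<in> H0 n" for A
        using H0D(1)[OF that] 1 by (intro cmat_eqI) (auto simp: inM_def)
      then have "\<phi> A = s *\<^sub>R cj ?U A" if "A \<in> H0 n" for A
        using that P.phi_zero by (metis cj_zero scaleR_zero_right)
      then show ?thesis using U s by blast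
    next
      case 2
      let ?Y = "single 0 1 1 - single 1 0 1"
      have "\<phi> A = (- s) *\<^sub>R cj (?U * ?Y) A" if A: "A \<in> H0 n" for A
      proof -
        have "conjm A = - cj ?Y A" using A 2 conjm_two by simp
        then have "cj ?U (conjm A) = - cj ?U (cj ?Y A)" using cj_scaleR[of ?U "- 1" "cj ?Y A"] by simp
        then show ?thesis using eq[OF A] by (simp add: cj_cj)
      qed
      moreover have "unit n (?U * ?Y)" by (rule unit_mult[OF U]) (use unit_two 2 in simp)
      moreover have "- s = 1 \<or> - s = - 1" using s by auto
      ultimately show ?thesis by blast
    next
      case 3
      then show ?thesis using U s eq by blast
    qed
  qed
qed

section \<open>Transfer to matrices of fixed dimension\<close>

lift_definition of_mat :: "complex mat \<Rightarrow> cmat"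
  is "\<lambda>M i j. if i < dim_row M \<and> j < dim_col M then M $$ (i, j) else 0"
proof -
  fix M :: "complex mat"
  show "finite {(i, j). (if i < dim_row M \<and> j < dim_col M then M $$ (i, j) else 0) \<noteq> 0}"
    by (rule finite_subset[of _ "{..<dim_row M} \<times> {..<dim_col M}"]) (auto split: if_splits)
qed

definition to_mat :: "nat \<Rightarrow> cmat \<Rightarrow> complex mat" where
  "to_mat n A = mat n n (\<lambda>(i, j). ent A i j)"

lemma ent_of_mat [simp]:
  "ent (of_mat M) i j = (if i < dim_row M \<and> j < dim_col M then M $$ (i, j) else 0)"
  by transfer simp

lemma to_mat_carrier [simp]: "to_mat n A \<in> carrier_mat n n" by (simp add: to_mat_def)

lemma of_to_mat: "inM n A \<Longrightarrow> of_mat (to_mat n A) = A"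
  by (rule cmat_eqI) (auto simp: to_mat_def inM_def)

lemma to_of_mat: "M \<in> carrier_mat n n \<Longrightarrow> to_mat n (of_mat M) = M"
  by (rule eq_matI) (auto simp: to_mat_def)

lemma of_mat_eq_iff: "A \<in> carrier_mat n n \<Longrightarrow> B \<in> carrier_mat n n \<Longrightarrow> of_mat A = of_mat B \<longleftrightarrow> A = B"
  by (metis to_of_mat)

lemma inM_of_mat: "M \<in> carrier_mat n n \<Longrightarrow> inM n (of_mat M)" by (auto simp: inM_def)

lemma of_mat_add: "A \<in> carrier_mat n n \<Longrightarrow> B \<in> carrier_mat n n \<Longrightarrow> of_mat (A + B) = of_mat A + of_mat B"
  by (rule cmat_eqI) auto

lemma of_mat_smult: "of_mat (complex_of_real r \<cdot>\<^sub>m A) = r *\<^sub>R of_mat A"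
  by (rule cmat_eqI) auto

lemma of_mat_mult:
  assumes "A \<in> carrier_mat n n" "B \<in> carrier_mat n n"
  shows "of_mat (A * B) = of_mat A * of_mat B"
proof (rule cmat_eqI)
  fix i j
  have "ent (of_mat A * of_mat B) i j = (\<Sum>k<n. ent (of_mat A) i k * ent (of_mat B) k j)"
    by (rule ent_mult) (use assms in auto)
  also have "\<dots> = ent (of_mat (A * B)) i j"
    using assms by (auto simp: scalar_prod_def atLeast0LessThan)
  finally show "ent (of_mat (A * B)) i j = ent (of_mat A * of_mat B) i j" by simp
qed

lemma of_mat_adj: "of_mat (adj A) = adjm (of_mat A)"
  by (rule cmat_eqI) (auto simp: adj_def)

lemma of_mat_conj: "of_mat (conj_mat A) = conjm (of_mat A)"
  by (rule cmat_eqI) (auto simp: conj_mat_def)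

lemma of_mat_one: "of_mat (1\<^sub>m n) = one_cm n"
  by (rule cmat_eqI) auto

lemma tr_of_mat:
  assumes "A \<in> carrier_mat n n"
  shows "tr (of_mat A) = mtrace A"
proof -
  have "tr (of_mat A) = (\<Sum>i<n. ent (of_mat A) i i)" by (rule tr_eq_sum) (use assms in auto)
  then show ?thesis using assms by (auto simp: mtrace_def)
qed

lemma adj_carrier: "A \<in> carrier_mat n n \<Longrightarrow> adj A \<in> carrier_mat n n" by (auto simp: adj_def)
lemma conj_mat_carrier: "A \<in> carrier_mat n n \<Longrightarrow> conj_mat A \<in> carrier_mat n n"
  by (auto simp: conj_mat_def)

lemma herm0_iff: "A \<in> herm0 n \<longleftrightarrow> A \<in> carrier_mat n n \<and> of_mat A \<in> H0 n"
  by (auto simp: herm0_def herm_def H0_def inM_of_mat tr_of_mat adj_carrier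
      simp flip: of_mat_adj of_mat_eq_iff[of _ n])

lemma unitary_mats_iff: "U \<in> unitary_mats n \<longleftrightarrow> U \<in> carrier_mat n n \<and> unit n (of_mat U)"
proof (cases "U \<in> carrier_mat n n")
  case True
  have "U * adj U = 1\<^sub>m n \<longleftrightarrow> of_mat (U * adj U) = of_mat (1\<^sub>m n)"
    using True adj_carrier[OF True] by (intro of_mat_eq_iff[symmetric]) auto
  moreover have "adj U * U = 1\<^sub>m n \<longleftrightarrow> of_mat (adj U * U) = of_mat (1\<^sub>m n)"
    using True adj_carrier[OF True] by (intro of_mat_eq_iff[symmetric]) auto
  ultimately show ?thesis
    using True by (simp add: unitary_mats_def unit_def inM_of_mat of_mat_one of_mat_adj
        of_mat_mult[OF True adj_carrier[OF True]] of_mat_mult[OF adj_carrier[OF True] True])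
qed (auto simp: unitary_mats_def)

text \<open>For hermitian matrices both unitarity equations say that the square is the
  identity.\<close>

lemma IH0_iff: "A \<in> IH0 n \<longleftrightarrow> A \<in> carrier_mat n n \<and> of_mat A \<in> H0 n \<and> of_mat A * of_mat A = one_cm n"
  by (auto simp: IH0_def herm0_iff unitary_mats_iff unit_def H0D)

lemma of_mat_conjugate:
  assumes "U \<in> carrier_mat n n" "A \<in> carrier_mat n n"
  shows "of_mat (U * A * adj U) = cj (of_mat U) (of_mat A)"
  using assms adj_carrier[OF assms(1)]
  by (simp add: cj_def of_mat_mult[of _ n] of_mat_adj mult.assoc)

lemma conjugate_carrier:
  assumes "U \<in> carrier_mat n n" "A \<in> carrier_mat n n"
  shows "c \<cdot>\<^sub>m (U * A * adj U) \<in> carrier_mat n n"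
  using assms adj_carrier[OF assms(1)] by auto

theorem theorem3p13:
  fixes k :: nat and \<phi> :: "complex mat \<Rightarrow> complex mat"
  assumes maps: "\<forall>A \<in> herm0 (2*k). \<phi> A \<in> herm0 (2*k)"
  shows "(real_linear_on (herm0 (2*k)) \<phi> \<and> (\<forall>A \<in> IH0 (2*k). \<phi> A \<in> IH0 (2*k)))
     \<longleftrightarrow>
     (\<exists>U \<in> unitary_mats (2*k). \<exists>s :: real. s \<in> {-1, 1} \<and>
        ((\<forall>A \<in> herm0 (2*k). \<phi> A = complex_of_real s \<cdot>\<^sub>m (U * A * adj U))
         \<or> (k \<ge> 2 \<and> (\<forall>A \<in> herm0 (2*k). \<phi> A = complex_of_real s \<cdot>\<^sub>m (U * conj_mat A * adj U)))))"
    (is "?L \<longleftrightarrow> ?R")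
proof -
  define n where "n = 2 * k"
  have hc: "A \<in> carrier_mat n n" if "A \<in> herm0 n" for A using that by (simp add: herm0_iff)
  have mapsn: "\<phi> A \<in> herm0 n" if "A \<in> herm0 n" for A using maps that by (simp add: n_def)
  have comb: "complex_of_real a \<cdot>\<^sub>m A + complex_of_real b \<cdot>\<^sub>m B \<in> herm0 n"
    and of_comb: "of_mat (complex_of_real a \<cdot>\<^sub>m A + complex_of_real b \<cdot>\<^sub>m B) = a *\<^sub>R of_mat A + b *\<^sub>R of_mat B"
    if "A \<in> herm0 n" "B \<in> herm0 n" for A B and a b :: real
    using that by (auto simp: herm0_iff of_mat_add[of _ n] of_mat_smult H0_intros)
  have R: ?R if L: ?L
  proof -
    from L have lin: "real_linear_on (herm0 n) \<phi>" and IH: "\<And>A. A \<in> IH0 n \<Longrightarrow> \<phi> A \<in> IH0 n"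
      by (auto simp: n_def)
    have toH: "to_mat n A \<in> herm0 n" if "A \<in> H0 n" for A
      using that by (simp add: herm0_iff of_to_mat H0D)
    \<comment> \<open>\<open>of_mat\<close> and \<open>to_mat n\<close> are mutually inverse between
      \<open>herm0 n\<close> and \<open>H0 n\<close>; the map is transported along them.\<close>
    have "pres n (\<lambda>A. of_mat (\<phi> (to_mat n A)))"
    proof
      show "even n" by (simp add: n_def)
      show "of_mat (\<phi> (to_mat n A)) \<in> H0 n" if "A \<in> H0 n" for A
        using mapsn[OF toH[OF that]] by (simp add: herm0_iff)
      fix A assume A: "A \<in> H0 n"
      {
        fix B and a b :: real
        assume B: "B \<in> H0 n"
        have "to_mat n (a *\<^sub>R A + b *\<^sub>R B)
            = to_mat n (of_mat (complex_of_real a \<cdot>\<^sub>m to_mat n A + complex_of_real b \<cdot>\<^sub>m to_mat n B))"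
          using of_comb[OF toH[OF A] toH[OF B]] A B by (simp add: of_to_mat H0D)
        also have "\<dots> = complex_of_real a \<cdot>\<^sub>m to_mat n A + complex_of_real b \<cdot>\<^sub>m to_mat n B"
          by (rule to_of_mat) auto
        finally have "\<phi> (to_mat n (a *\<^sub>R A + b *\<^sub>R B))
            = complex_of_real a \<cdot>\<^sub>m \<phi> (to_mat n A) + complex_of_real b \<cdot>\<^sub>m \<phi> (to_mat n B)"
          using lin toH[OF A] toH[OF B] by (simp add: real_linear_on_def)
        then show "of_mat (\<phi> (to_mat n (a *\<^sub>R A + b *\<^sub>R B)))
            = a *\<^sub>R of_mat (\<phi> (to_mat n A)) + b *\<^sub>R of_mat (\<phi> (to_mat n B))"
          using of_comb[OF mapsn[OF toH[OF A]] mapsn[OF toH[OF B]]] by simp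
      }
      assume "A * A = one_cm n"
      then have "to_mat n A \<in> IH0 n" using A by (simp add: IH0_iff of_to_mat H0D)
      then show "of_mat (\<phi> (to_mat n A)) * of_mat (\<phi> (to_mat n A)) = one_cm n"
        using IH by (auto simp: IH0_iff)
    qed
    from pres_classification[OF this] obtain U s where U: "unit n U" and s: "s = 1 \<or> s = (- 1 :: real)"
      and alt: "(\<forall>A\<in>H0 n. of_mat (\<phi> (to_mat n A)) = s *\<^sub>R cj U A)
        \<or> 4 \<le> n \<and> (\<forall>A\<in>H0 n. of_mat (\<phi> (to_mat n A)) = s *\<^sub>R cj U (conjm A))" by blast
    let ?U = "to_mat n U"
    have UU: "of_mat ?U = U" using U by (simp add: of_to_mat unitD)
    have "?U \<in> unitary_mats n" using U UU by (simp add: unitary_mats_iff)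
    moreover have "s \<in> {-1, 1}" using s by auto
    moreover have "(\<forall>A\<in>herm0 n. \<phi> A = complex_of_real s \<cdot>\<^sub>m (?U * A * adj ?U))
         \<or> (k \<ge> 2 \<and> (\<forall>A\<in>herm0 n. \<phi> A = complex_of_real s \<cdot>\<^sub>m (?U * conj_mat A * adj ?U)))"
      using alt
    proof
      assume *: "\<forall>A\<in>H0 n. of_mat (\<phi> (to_mat n A)) = s *\<^sub>R cj U A"
      have "\<phi> A = complex_of_real s \<cdot>\<^sub>m (?U * A * adj ?U)" if A: "A \<in> herm0 n" for A
      proof -
        have "of_mat (\<phi> A) = s *\<^sub>R cj U (of_mat A)"
          using * A by (auto simp: herm0_iff to_of_mat dest!: bspec[of _ _ "of_mat A"])
        also have "\<dots> = of_mat (complex_of_real s \<cdot>\<^sub>m (?U * A * adj ?U))"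
          by (simp add: of_mat_smult of_mat_conjugate[OF to_mat_carrier hc[OF A]] UU)
        finally show ?thesis
          using of_mat_eq_iff[OF hc[OF mapsn[OF A]] conjugate_carrier[OF to_mat_carrier hc[OF A]]] by blast
      qed
      then show ?thesis by blast
    next
      assume *: "4 \<le> n \<and> (\<forall>A\<in>H0 n. of_mat (\<phi> (to_mat n A)) = s *\<^sub>R cj U (conjm A))"
      have "\<phi> A = complex_of_real s \<cdot>\<^sub>m (?U * conj_mat A * adj ?U)" if A: "A \<in> herm0 n" for A
      proof -
        have c: "conj_mat A \<in> carrier_mat n n" using hc[OF A] by (rule conj_mat_carrier)
        have "of_mat (\<phi> A) = s *\<^sub>R cj U (conjm (of_mat A))"
          using * A by (auto simp: herm0_iff to_of_mat dest!: bspec[of _ _ "of_mat A"])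
        also have "\<dots> = of_mat (complex_of_real s \<cdot>\<^sub>m (?U * conj_mat A * adj ?U))"
          by (simp add: of_mat_smult of_mat_conjugate[OF to_mat_carrier c] UU of_mat_conj)
        finally show ?thesis
          using of_mat_eq_iff[OF hc[OF mapsn[OF A]] conjugate_carrier[OF to_mat_carrier c]] by blast
      qed
      then show ?thesis using * by (simp add: n_def)
    qed
    ultimately show ?R unfolding n_def by blast
  qed
  have L: ?L if R: ?R
  proof -
    from R obtain U s where U: "U \<in> unitary_mats n" and s: "s = 1 \<or> s = (- 1 :: real)"
      and alt: "(\<forall>A\<in>herm0 n. \<phi> A = complex_of_real s \<cdot>\<^sub>m (U * A * adj U))
         \<or> (\<forall>A\<in>herm0 n. \<phi> A = complex_of_real s \<cdot>\<^sub>m (U * conj_mat A * adj U))"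
      unfolding n_def by auto
    have Uc: "U \<in> carrier_mat n n" and Uu: "unit n (of_mat U)" using U by (auto simp: unitary_mats_iff)
    \<comment> \<open>\<open>G\<close> is the identity or the entrywise conjugation; the properties
      listed are shared by both, so the two forms are treated together.\<close>
    obtain G where G: "\<And>A. A \<in> herm0 n \<Longrightarrow> of_mat (\<phi> A) = s *\<^sub>R cj (of_mat U) (G (of_mat A))"
      and Glin: "\<And>a b A B. G (a *\<^sub>R A + b *\<^sub>R B) = a *\<^sub>R G A + b *\<^sub>R G B"
      and Gsq: "\<And>A. A * A = one_cm n \<Longrightarrow> G A * G A = one_cm n"
      and GM: "\<And>A. inM n A \<Longrightarrow> inM n (G A)"
    proof -
      from alt show thesis
      proof
        assume "\<forall>A\<in>herm0 n. \<phi> A = complex_of_real s \<cdot>\<^sub>m (U * A * adj U)"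
        then show thesis
          using that[of "\<lambda>A. A"] of_mat_conjugate[OF Uc hc] by (simp add: of_mat_smult)
      next
        assume *: "\<forall>A\<in>herm0 n. \<phi> A = complex_of_real s \<cdot>\<^sub>m (U * conj_mat A * adj U)"
        have "conjm A * conjm A = one_cm n" if "A * A = one_cm n" for A
          using that conjm_mult[of A A] by simp
        then show thesis
          using * that[of conjm] of_mat_conjugate[OF Uc conj_mat_carrier[OF hc]]
          by (simp add: of_mat_smult of_mat_conj inM_conjm)
      qed
    qed
    have "real_linear_on (herm0 n) \<phi>" unfolding real_linear_on_def
    proof (intro ballI allI)
      fix A B and a b :: real
      assume A: "A \<in> herm0 n" and B: "B \<in> herm0 n"
      have "of_mat (\<phi> (complex_of_real a \<cdot>\<^sub>m A + complex_of_real b \<cdot>\<^sub>m B))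
          = of_mat (complex_of_real a \<cdot>\<^sub>m \<phi> A + complex_of_real b \<cdot>\<^sub>m \<phi> B)"
        unfolding G[OF comb[OF A B]] of_comb[OF A B] of_comb[OF mapsn[OF A] mapsn[OF B]] Glin G[OF A] G[OF B]
        by (simp add: scaleR_add_right mult.commute)
      then show "\<phi> (complex_of_real a \<cdot>\<^sub>m A + complex_of_real b \<cdot>\<^sub>m B)
          = complex_of_real a \<cdot>\<^sub>m \<phi> A + complex_of_real b \<cdot>\<^sub>m \<phi> B"
        using of_mat_eq_iff[OF hc[OF mapsn[OF comb[OF A B]]] hc[OF comb[OF mapsn[OF A] mapsn[OF B]]]] by blast
    qed
    moreover have "\<phi> A \<in> IH0 n" if "A \<in> IH0 n" for A
    proof -
      have A: "A \<in> herm0 n" "of_mat A * of_mat A = one_cm n" "inM n (of_mat A)"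
        using that by (auto simp: IH0_iff herm0_iff H0D)
      have "of_mat (\<phi> A) * of_mat (\<phi> A) = cj (of_mat U) (G (of_mat A)) * cj (of_mat U) (G (of_mat A))"
        unfolding G[OF A(1)] using s by auto
      also have "\<dots> = one_cm n" using Uu GM[OF A(3)] Gsq[OF A(2)] by (simp add: cj_mult cj_one)
      finally show ?thesis using mapsn[OF A(1)] by (simp add: IH0_iff herm0_iff)
    qed
    ultimately show ?L by (auto simp: n_def)
  qed
  show ?thesis using R L by blast
qed

end
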